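(* As a complex algebra without an identity, the isomorphism class of the integral coefficient ring of a finite-dimensional complex algebra equipped with a compatible orthogonal fixed embedding system is a Morita invariant. That is: let $A$ and $B$ be finite-dimensional complex algebras, each equipped with a compatible orthogonal fixed embedding system, and let $\mathcal{R}(A)$, $\mathcal{R}(B)$ be their integral coefficient rings. If $A$ and $B$ are Morita equivalent, then $\mathcal{R}(A)\cong\mathcal{R}(B)$ as non-unital complex algebras.
   Context: Let $A$ be a finite-dimensional (associative unital) complex algebra with a fixed basis $\{a_1,\dots,a_d\}$. For a finite-dimensional left $A$-module $M$ let $\rho_M:A\to\mathrm{End}_{\mathbb{C}}(M)$ be the structure map. For $t\in(\mathbb{R}_{\ge0})^d$, $I_A(t)=\{\sum_i\lambda_ia_i:0\le\lambda_i\le t_i\}\cong\prod_i[0,t_i]$ carries the transported $d$-dimensional Lebesgue measure $\mu_t$. The integral profile of $M$ is the map $\Phi_M:(\mathbb{R}_{\ge0})^d\to\mathrm{End}_{\mathbb{C}}(M)$, $\Phi_M(t)=\int_{I_A(t)}\rho_M(x)\,d\mu_t(x)$ (Bochner integral). Let $\mathcal{C}_A=\mathrm{add}(\mathrm{proj}\cup\mathrm{inj})$ be the full subcategory of finite-dimensional left $A$-modules containing all projective and all injective modules and closed under finite direct sums, direct summands and isomorphisms. Let $\Pi=\bigoplus_v(P(v)\oplus I(v))$, where $P(v)$ (resp. $I(v)$) runs over representatives of the isomorphism classes of indecomposable projective (resp. injective) left $A$-modules, and let $\Pi^{\oplus\mathbb{N}}$ be the countable direct sum. A fixed embedding system is a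 choice, for every $M\in\mathcal{C}_A$, of a left $A$-module $M'$ and an $A$-isomorphism $\sigma_M:\Pi^{\oplus\mathbb{N}}\to M\oplus M'$. For $f:(\mathbb{R}_{\ge0})^d\to\mathrm{End}_{\mathbb{C}}(M)$ define $\mathrm{Emb}_M(f):(\mathbb{R}_{\ge0})^d\to\mathrm{End}_{\mathbb{C}}(\Pi^{\oplus\mathbb{N}})$ by $\mathrm{Emb}_M(f)(t)=\sigma_M^{-1}\circ\iota_M\circ f(t)\circ\pi_M\circ\sigma_M$, where $\pi_M:M\oplus M'\to M$ and $\iota_M:M\to M\oplus M'$ are the canonical projection and inclusion. The integral coefficient ring $\mathcal{R}(A)$ is the (non-unital) complex subalgebra of the algebra $\mathrm{Map}((\mathbb{R}_{\ge0})^d,\mathrm{End}_{\mathbb{C}}(\Pi^{\oplus\mathbb{N}}))$ (pointwise operations) generated by all $\mathrm{Emb}_M(\Phi_M)$, $M\in\mathcal{C}_A$. Choose a representative $X$ of every isomorphism class of indecomposable modules in $\mathcal{C}_A$. The fixed embedding system is called compatible orthogonal if there are pairwise orthogonal fixed copies $X^{(1)},X^{(2)},\dots$ of the modules $X$ in $\Pi^{\oplus\mathbb{N}}$, giving a direct sum decomposition $\Pi^{\oplus\mathbb{N}}\cong\bigoplus_X\bigoplus_{r\ge1}X^{(r)}$, such that, whenever $M\cong\bigoplus_XX^{\oplus m_X}$ (the multiplicities $m_X$ being unique by Krull–Schmidt), the isomorphism $\sigma_M$ identifies the embedded copy of $M$ in $\Pi^{\oplus\mathbb{N}}$ with $\bigoplus_X\bigoplus_{1\le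 r\le m_X}X^{(r)}$.
   Formalization: "Compatible orthogonal" here also requires σ_M to send the remaining copies X^(r), r > m_X, onto the complement M'; without this the claim fails (A = B = ℂ: idempotents with equal image but different kernels give a noncommutative ring). *)

theory Defs
  imports "HOL-Analysis.Analysis" "HOL-Algebra.Module"
begin

text \<open>Both \<open>Modules.module\<close> (type classes) and \<open>Module.module\<close> (carriers) are in scope; only the
  latter is used, and it is always written with its qualifier.  In the record type \<open>module\<close> the
  fields \<open>mult\<close> and \<open>one\<close> are irrelevant for anything that is only a module.\<close>

section \<open>Complex vector spaces and complex algebras\<close>

definition cplx :: "(complex, complex) module" where
  "cplx = \<lparr>carrier = UNIV, monoid.mult = (*), one = 1, ring.zero = 0, add = (+), smult = (*)\<rparr>"

definition complex_algebra :: "(complex, 'a) module \<Rightarrow> bool" where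
  "complex_algebra A \<longleftrightarrow> ring A \<and> Module.module cplx A \<and>
     (\<forall>c. \<forall>x\<in>carrier A. \<forall>y\<in>carrier A.
        c \<odot>\<^bsub>A\<^esub> (x \<otimes>\<^bsub>A\<^esub> y) = (c \<odot>\<^bsub>A\<^esub> x) \<otimes>\<^bsub>A\<^esub> y \<and>
        c \<odot>\<^bsub>A\<^esub> (x \<otimes>\<^bsub>A\<^esub> y) = x \<otimes>\<^bsub>A\<^esub> (c \<odot>\<^bsub>A\<^esub> y))"

definition lin_comb :: "(complex, 'v) module \<Rightarrow> nat \<Rightarrow> (nat \<Rightarrow> 'v) \<Rightarrow> (nat \<Rightarrow> complex) \<Rightarrow> 'v" where
  "lin_comb V d b c = (\<Oplus>\<^bsub>V\<^esub> i\<in>{..<d}. c i \<odot>\<^bsub>V\<^esub> b i)"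

definition is_basis :: "(complex, 'v) module \<Rightarrow> nat \<Rightarrow> (nat \<Rightarrow> 'v) \<Rightarrow> bool" where
  "is_basis V d b \<longleftrightarrow> b \<in> {..<d} \<rightarrow> carrier V \<and>
     (\<forall>x\<in>carrier V. \<exists>!c. c \<in> {..<d} \<rightarrow>\<^sub>E UNIV \<and> x = lin_comb V d b c)"

definition algebra_with_basis :: "(complex, 'a) module \<Rightarrow> nat \<Rightarrow> (nat \<Rightarrow> 'a) \<Rightarrow> bool" where
  "algebra_with_basis A d a \<longleftrightarrow> complex_algebra A \<and> is_basis A d a"


section \<open>Left modules\<close>

text \<open>The library locale \<open>Module.module\<close> demands a commutative ring of scalars.\<close>

locale left_module = ring A + M?: abelian_group M
  for A :: "('a, 'b) ring_scheme" (structure) and M :: "('a, 'm) module" (structure) +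
  assumes smult_closed: "\<lbrakk>r \<in> carrier A; x \<in> carrier M\<rbrakk> \<Longrightarrow> r \<odot>\<^bsub>M\<^esub> x \<in> carrier M"
    and smult_l_distr: "\<lbrakk>r \<in> carrier A; s \<in> carrier A; x \<in> carrier M\<rbrakk> \<Longrightarrow>
          (r \<oplus>\<^bsub>A\<^esub> s) \<odot>\<^bsub>M\<^esub> x = r \<odot>\<^bsub>M\<^esub> x \<oplus>\<^bsub>M\<^esub> s \<odot>\<^bsub>M\<^esub> x"
    and smult_r_distr: "\<lbrakk>r \<in> carrier A; x \<in> carrier M; y \<in> carrier M\<rbrakk> \<Longrightarrow>
          r \<odot>\<^bsub>M\<^esub> (x \<oplus>\<^bsub>M\<^esub> y) = r \<odot>\<^bsub>M\<^esub> x \<oplus>\<^bsub>M\<^esub> r \<odot>\<^bsub>M\<^esub> y"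
    and smult_assoc: "\<lbrakk>r \<in> carrier A; s \<in> carrier A; x \<in> carrier M\<rbrakk> \<Longrightarrow>
          (r \<otimes>\<^bsub>A\<^esub> s) \<odot>\<^bsub>M\<^esub> x = r \<odot>\<^bsub>M\<^esub> (s \<odot>\<^bsub>M\<^esub> x)"
    and smult_one: "x \<in> carrier M \<Longrightarrow> \<one>\<^bsub>A\<^esub> \<odot>\<^bsub>M\<^esub> x = x"

text \<open>The complex vector space underlying a left module over a complex algebra:
  \<open>c\<close> acts as \<open>c \<cdot> 1\<^sub>A\<close>.\<close>

definition cspace :: "(complex, 'a) module \<Rightarrow> ('a, 'm) module \<Rightarrow> (complex, 'm) module" where
  "cspace A M = \<lparr>carrier = carrier M, monoid.mult = monoid.mult M, one = one M,
     ring.zero = ring.zero M, add = add M, smult = (\<lambda>c x. (c \<odot>\<^bsub>A\<^esub> \<one>\<^bsub>A\<^esub>) \<odot>\<^bsub>M\<^esub> x)\<rparr>"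

definition fd_module :: "(complex, 'a) module \<Rightarrow> ('a, 'm) module \<Rightarrow> bool" where
  "fd_module A M \<longleftrightarrow> left_module A M \<and> (\<exists>n b. is_basis (cspace A M) n b)"

definition mod_hom :: "('a, 'r) ring_scheme \<Rightarrow> ('a, 'm) module \<Rightarrow> ('a, 'n) module \<Rightarrow> ('m \<Rightarrow> 'n) set" where
  "mod_hom A M N = {f \<in> carrier M \<rightarrow>\<^sub>E carrier N.
     (\<forall>x\<in>carrier M. \<forall>y\<in>carrier M. f (x \<oplus>\<^bsub>M\<^esub> y) = f x \<oplus>\<^bsub>N\<^esub> f y) \<and>
     (\<forall>r\<in>carrier A. \<forall>x\<in>carrier M. f (r \<odot>\<^bsub>M\<^esub> x) = r \<odot>\<^bsub>N\<^esub> f x)}"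

definition mod_iso :: "('a, 'r) ring_scheme \<Rightarrow> ('a, 'm) module \<Rightarrow> ('a, 'n) module \<Rightarrow> ('m \<Rightarrow> 'n) set" where
  "mod_iso A M N = {f \<in> mod_hom A M N. bij_betw f (carrier M) (carrier N)}"

definition isomorphic_mod :: "('a, 'r) ring_scheme \<Rightarrow> ('a, 'm) module \<Rightarrow> ('a, 'n) module \<Rightarrow> bool" where
  "isomorphic_mod A M N \<longleftrightarrow> mod_iso A M N \<noteq> {}"

definition hom_space ::
    "(complex, 'a) module \<Rightarrow> ('a, 'm) module \<Rightarrow> ('a, 'n) module \<Rightarrow> (complex, 'm \<Rightarrow> 'n) module" where
  "hom_space A M N = \<lparr>carrier = mod_hom A M N, monoid.mult = undefined, one = undefined,
     ring.zero = (\<lambda>x\<in>carrier M. \<zero>\<^bsub>N\<^esub>), add = (\<lambda>f g. \<lambda>x\<in>carrier M. f x \<oplus>\<^bsub>N\<^esub> g x),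
     smult = (\<lambda>c f. \<lambda>x\<in>carrier M. (c \<odot>\<^bsub>A\<^esub> \<one>\<^bsub>A\<^esub>) \<odot>\<^bsub>N\<^esub> f x)\<rparr>"

definition end_algebra :: "(complex, 'v) module \<Rightarrow> (complex, 'v \<Rightarrow> 'v) module" where
  "end_algebra V = (hom_space cplx V V)
     \<lparr>monoid.mult := compose (carrier V), one := (\<lambda>x\<in>carrier V. x)\<rparr>"

definition dsum :: "('a, 'm) module \<Rightarrow> ('a, 'n) module \<Rightarrow> ('a, 'm \<times> 'n) module" where
  "dsum M N = \<lparr>carrier = carrier M \<times> carrier N, monoid.mult = undefined, one = undefined,
     ring.zero = (\<zero>\<^bsub>M\<^esub>, \<zero>\<^bsub>N\<^esub>),
     add = (\<lambda>(x, y) (x', y'). (x \<oplus>\<^bsub>M\<^esub> x', y \<oplus>\<^bsub>N\<^esub> y')),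
     smult = (\<lambda>r (x, y). (r \<odot>\<^bsub>M\<^esub> x, r \<odot>\<^bsub>N\<^esub> y))\<rparr>"

definition direct_sum :: "'i set \<Rightarrow> ('i \<Rightarrow> ('a, 'm) module) \<Rightarrow> ('a, 'i \<Rightarrow> 'm) module" where
  "direct_sum J X = \<lparr>carrier = {f \<in> (\<Pi>\<^sub>E j\<in>J. carrier (X j)). finite {j \<in> J. f j \<noteq> \<zero>\<^bsub>X j\<^esub>}},
     monoid.mult = undefined, one = undefined,
     ring.zero = (\<lambda>j\<in>J. \<zero>\<^bsub>X j\<^esub>), add = (\<lambda>f g. \<lambda>j\<in>J. f j \<oplus>\<^bsub>X j\<^esub> g j),
     smult = (\<lambda>r f. \<lambda>j\<in>J. r \<odot>\<^bsub>X j\<^esub> f j)\<rparr>"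

definition indecomposable :: "('a, 'r) ring_scheme \<Rightarrow> ('a, 'm) module \<Rightarrow> bool" where
  "indecomposable A X \<longleftrightarrow> carrier X \<noteq> {\<zero>\<^bsub>X\<^esub>} \<and>
     (\<forall>(M :: ('a, 'm) module) (N :: ('a, 'm) module).
        left_module A M \<and> left_module A N \<and> isomorphic_mod A X (dsum M N) \<longrightarrow>
        carrier M = {\<zero>\<^bsub>M\<^esub>} \<or> carrier N = {\<zero>\<^bsub>N\<^esub>})"


section \<open>Projective and injective modules, and the category they generate\<close>

text \<open>The category of finite-dimensional modules consists of the finite-dimensional modules whose
  carrier lies in a fixed type \<open>'m\<close>.  Once \<open>'m\<close> has at least the cardinality of the continuum this
  type contains an isomorphic copy of every finite-dimensional module.\<close>

definition large_universe :: "'m itself \<Rightarrow> bool" where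
  "large_universe _ \<longleftrightarrow> (\<exists>f :: complex \<Rightarrow> 'm. inj f)"

definition projective_mod :: "(complex, 'a) module \<Rightarrow> ('a, 'm) module \<Rightarrow> bool" where
  "projective_mod A P \<longleftrightarrow> fd_module A P \<and>
     (\<forall>(N :: ('a, 'm) module) (L :: ('a, 'm) module). \<forall>g\<in>mod_hom A N L. \<forall>f\<in>mod_hom A P L.
        fd_module A N \<and> fd_module A L \<and> g ` carrier N = carrier L \<longrightarrow>
        (\<exists>h\<in>mod_hom A P N. compose (carrier P) g h = f))"

definition injective_mod :: "(complex, 'a) module \<Rightarrow> ('a, 'm) module \<Rightarrow> bool" where
  "injective_mod A Q \<longleftrightarrow> fd_module A Q \<and>
     (\<forall>(N :: ('a, 'm) module) (L :: ('a, 'm) module). \<forall>g\<in>mod_hom A N L. \<forall>f\<in>mod_hom A N Q.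
        fd_module A N \<and> fd_module A L \<and> inj_on g (carrier N) \<longrightarrow>
        (\<exists>h\<in>mod_hom A L Q. compose (carrier N) h g = f))"

inductive add_proj_inj :: "(complex, 'a) module \<Rightarrow> ('a, 'm) module \<Rightarrow> bool"
  for A :: "(complex, 'a) module" where
  proj: "projective_mod A M \<Longrightarrow> add_proj_inj A M"
| inj: "injective_mod A M \<Longrightarrow> add_proj_inj A M"
| sum: "\<lbrakk>add_proj_inj A M; add_proj_inj A N; fd_module A L; isomorphic_mod A L (dsum M N)\<rbrakk> \<Longrightarrow>
          add_proj_inj A L"
| summand: "\<lbrakk>add_proj_inj A L; fd_module A M; fd_module A (N :: ('a, 'm) module); isomorphic_mod A L (dsum M N)\<rbrakk> \<Longrightarrow>
          add_proj_inj A M"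
| iso: "\<lbrakk>add_proj_inj A M; fd_module A N; isomorphic_mod A M N\<rbrakk> \<Longrightarrow> add_proj_inj A N"

definition indec_reps ::
    "(complex, 'a) module \<Rightarrow> (('a, 'm) module \<Rightarrow> bool) \<Rightarrow> ('a, 'm) module set \<Rightarrow> bool" where
  "indec_reps A Q S \<longleftrightarrow> (\<forall>X\<in>S. Q X \<and> indecomposable A X) \<and>
     (\<forall>Y. Q Y \<and> indecomposable A Y \<longrightarrow> (\<exists>!X. X \<in> S \<and> isomorphic_mod A Y X))"

definition proj_inj_reps ::
    "(complex, 'a) module \<Rightarrow> nat \<Rightarrow> (nat \<Rightarrow> ('a, 'm) module) \<Rightarrow> (nat \<Rightarrow> ('a, 'm) module) \<Rightarrow> bool" where
  "proj_inj_reps A n P Q \<longleftrightarrow>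
     inj_on P {..<n} \<and> indec_reps A (projective_mod A) (P ` {..<n}) \<and>
     inj_on Q {..<n} \<and> indec_reps A (injective_mod A) (Q ` {..<n})"


section \<open>The integral profile\<close>

text \<open>Integral with values in a finite-dimensional complex vector space \<open>V\<close> given by a carrier:
  the integral is determined by its images under all linear functionals.  The lemma below checks
  that on \<open>\<complex>\<^sup>n\<close> this is the Bochner integral.\<close>

definition has_vec_integral ::
    "(complex, 'v) module \<Rightarrow> 'x measure \<Rightarrow> ('x \<Rightarrow> 'v) \<Rightarrow> 'v \<Rightarrow> bool" where
  "has_vec_integral V \<mu> f w \<longleftrightarrow> w \<in> carrier V \<and>
     (\<forall>\<phi>\<in>mod_hom cplx V cplx. has_bochner_integral \<mu> (\<lambda>x. \<phi> (f x)) (\<phi> w))"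

definition vec_integral :: "(complex, 'v) module \<Rightarrow> 'x measure \<Rightarrow> ('x \<Rightarrow> 'v) \<Rightarrow> 'v" where
  "vec_integral V \<mu> f = (THE w. has_vec_integral V \<mu> f w)"

lemma has_vec_integral_iff_has_bochner_integral:
  fixes f :: "'x \<Rightarrow> complex ^ 'n"
  defines "V \<equiv> \<lparr>carrier = UNIV, monoid.mult = undefined, one = undefined, ring.zero = 0,
     add = (+), smult = (*s)\<rparr>"
  shows "has_vec_integral V \<mu> f w \<longleftrightarrow> has_bochner_integral \<mu> f w"
proof
  assume w: "has_bochner_integral \<mu> f w"
  have "has_bochner_integral \<mu> (\<lambda>x. \<phi> (f x)) (\<phi> w)" if \<phi>: "\<phi> \<in> mod_hom cplx V cplx" for \<phi>
  proof -
    have add: "\<phi> (x + y) = \<phi> x + \<phi> y" and sc: "\<phi> (c *s x) = c * \<phi> x" for x y c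
      using \<phi> by (auto simp: mod_hom_def V_def cplx_def)
    have "r *\<^sub>R x = complex_of_real r *s x" for r and x :: "complex ^ 'n"
      by (simp add: vec_eq_iff) (simp add: scaleR_conv_of_real)
    then have "\<phi> (r *\<^sub>R x) = r *\<^sub>R \<phi> x" for r x
      by (simp add: sc scaleR_conv_of_real)
    then have "linear \<phi>" by (intro linearI) (auto simp: add)
    then show ?thesis
      using has_bochner_integral_bounded_linear[OF _ w] by (simp add: linear_conv_bounded_linear)
  qed
  then show "has_vec_integral V \<mu> f w" by (simp add: has_vec_integral_def V_def)
next
  assume w: "has_vec_integral V \<mu> f w"
  have "has_bochner_integral \<mu> (\<lambda>x. f x $ i) (w $ i)" for i
  proof -
    have "(\<lambda>v :: complex ^ 'n. v $ i) \<in> mod_hom cplx V cplx" by (auto simp: mod_hom_def V_def cplx_def)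
    then show ?thesis using w unfolding has_vec_integral_def by (auto dest: bspec)
  qed
  moreover have "bounded_linear (\<lambda>z::complex. axis i z :: complex ^ 'n)" for i
    by (rule linear_conv_bounded_linear[THEN iffD1], rule linearI) (auto simp: axis_def vec_eq_iff)
  ultimately have "has_bochner_integral \<mu> (\<lambda>x. axis i (f x $ i) :: complex ^ 'n) (axis i (w $ i))" for i
    using has_bochner_integral_bounded_linear by fast
  then have "has_bochner_integral \<mu> (\<lambda>x. \<Sum>i\<in>UNIV. axis i (f x $ i) :: complex ^ 'n)
      (\<Sum>i\<in>UNIV. axis i (w $ i))"
    by (intro has_bochner_integral_sum) auto
  moreover have "(\<Sum>i\<in>UNIV. axis i (v $ i)) = v" for v :: "complex ^ 'n"
    by (simp add: vec_eq_iff axis_def if_distrib cong: if_cong)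
  ultimately show "has_bochner_integral \<mu> f w" by simp
qed

definition orthant :: "nat \<Rightarrow> (nat \<Rightarrow> real) set" where
  "orthant d = {..<d} \<rightarrow>\<^sub>E {0..}"

text \<open>Lebesgue measure on \<open>\<Prod>\<^sub>i [0, t i]\<close>, transported to
  \<open>I\<^sub>A(t) = {\<Sum>\<^sub>i \<lambda>\<^sub>i a\<^sub>i | 0 \<le> \<lambda>\<^sub>i \<le> t\<^sub>i}\<close>, which is the space of this measure.\<close>

definition box_measure ::
    "(complex, 'a) module \<Rightarrow> nat \<Rightarrow> (nat \<Rightarrow> 'a) \<Rightarrow> (nat \<Rightarrow> real) \<Rightarrow> 'a measure" where
  "box_measure A d a t =
     embed_measure
       (restrict_space (\<Pi>\<^sub>M i\<in>{..<d}. lborel) (\<Pi>\<^sub>E i\<in>{..<d}. {0..t i}))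
       (\<lambda>l. lin_comb A d a (\<lambda>i. complex_of_real (l i)))"

definition structure_map :: "('a, 'm) module \<Rightarrow> 'a \<Rightarrow> 'm \<Rightarrow> 'm" where
  "structure_map M x = (\<lambda>m\<in>carrier M. x \<odot>\<^bsub>M\<^esub> m)"

definition integral_profile ::
    "(complex, 'a) module \<Rightarrow> nat \<Rightarrow> (nat \<Rightarrow> 'a) \<Rightarrow> ('a, 'm) module \<Rightarrow> (nat \<Rightarrow> real) \<Rightarrow> 'm \<Rightarrow> 'm" where
  "integral_profile A d a M = (\<lambda>t\<in>orthant d.
     vec_integral (end_algebra (cspace A M)) (box_measure A d a t) (structure_map M))"


section \<open>Fixed embedding systems and the integral coefficient ring\<close>

definition Pi_N :: "nat \<Rightarrow> (nat \<Rightarrow> ('a, 'm) module) \<Rightarrow> (nat \<Rightarrow> ('a, 'm) module) \<Rightarrow>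
    ('a, nat \<Rightarrow> nat \<Rightarrow> 'm \<times> 'm) module" where
  "Pi_N n P Q = direct_sum (UNIV :: nat set) (\<lambda>_. direct_sum {..<n} (\<lambda>v. dsum (P v) (Q v)))"

text \<open>\<open>M' M\<close> is the complement and \<open>\<sigma> M\<close> the isomorphism chosen for \<open>M\<close>;
  \<open>W\<close> stands for the countable direct sum of copies of \<open>\<Pi>\<close>.\<close>

definition fixed_embedding_system ::
    "(complex, 'a) module \<Rightarrow> ('a, 'w) module \<Rightarrow> (('a, 'm) module \<Rightarrow> ('a, 'k) module) \<Rightarrow>
     (('a, 'm) module \<Rightarrow> 'w \<Rightarrow> 'm \<times> 'k) \<Rightarrow> bool" where
  "fixed_embedding_system A W M' \<sigma> \<longleftrightarrow>
     (\<forall>M. add_proj_inj A M \<longrightarrow> left_module A (M' M) \<and> \<sigma> M \<in> mod_iso A W (dsum M (M' M)))"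

definition emb :: "nat \<Rightarrow> ('a, 'w) module \<Rightarrow> ('a, 'k) module \<Rightarrow> ('w \<Rightarrow> 'm \<times> 'k) \<Rightarrow>
    ((nat \<Rightarrow> real) \<Rightarrow> 'm \<Rightarrow> 'm) \<Rightarrow> (nat \<Rightarrow> real) \<Rightarrow> 'w \<Rightarrow> 'w" where
  "emb d W K s f = (\<lambda>t\<in>orthant d. \<lambda>x\<in>carrier W.
     inv_into (carrier W) s (f t (fst (s x)), \<zero>\<^bsub>K\<^esub>))"

definition map_algebra :: "'t set \<Rightarrow> (complex, 'e) module \<Rightarrow> (complex, 't \<Rightarrow> 'e) module" where
  "map_algebra T E = \<lparr>carrier = T \<rightarrow>\<^sub>E carrier E,
     monoid.mult = (\<lambda>f g. \<lambda>t\<in>T. f t \<otimes>\<^bsub>E\<^esub> g t), one = (\<lambda>t\<in>T. \<one>\<^bsub>E\<^esub>),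
     ring.zero = (\<lambda>t\<in>T. \<zero>\<^bsub>E\<^esub>), add = (\<lambda>f g. \<lambda>t\<in>T. f t \<oplus>\<^bsub>E\<^esub> g t),
     smult = (\<lambda>c f. \<lambda>t\<in>T. c \<odot>\<^bsub>E\<^esub> f t)\<rparr>"

definition nonunital_subalgebra :: "(complex, 'a) module \<Rightarrow> 'a set \<Rightarrow> bool" where
  "nonunital_subalgebra E S \<longleftrightarrow> submodule S cplx E \<and> (\<forall>x\<in>S. \<forall>y\<in>S. x \<otimes>\<^bsub>E\<^esub> y \<in> S)"

text \<open>Only the non-unital algebra structure of the following record is meaningful: its field
  \<open>one\<close>, inherited from the algebra of all maps, need not lie in the carrier.\<close>

definition integral_coefficient_ring ::
    "(complex, 'a) module \<Rightarrow> nat \<Rightarrow> (nat \<Rightarrow> 'a) \<Rightarrow> ('a, 'w) module \<Rightarrow>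
     (('a, 'm) module \<Rightarrow> ('a, 'k) module) \<Rightarrow> (('a, 'm) module \<Rightarrow> 'w \<Rightarrow> 'm \<times> 'k) \<Rightarrow>
     (complex, (nat \<Rightarrow> real) \<Rightarrow> 'w \<Rightarrow> 'w) module" where
  "integral_coefficient_ring A d a W M' \<sigma> =
     (let E = map_algebra (orthant d) (end_algebra (cspace A W)) in
      E\<lparr>carrier := nonunital_subalgebra E hull
           {emb d W (M' M) (\<sigma> M) (integral_profile A d a M) | M. add_proj_inj A M}\<rparr>)"

definition nonunital_alg_isomorphic :: "(complex, 'a) module \<Rightarrow> (complex, 'b) module \<Rightarrow> bool" where
  "nonunital_alg_isomorphic R S \<longleftrightarrow>
     (\<exists>h\<in>mod_iso cplx R S. \<forall>x\<in>carrier R. \<forall>y\<in>carrier R. h (x \<otimes>\<^bsub>R\<^esub> y) = h x \<otimes>\<^bsub>S\<^esub> h y)"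


section \<open>Compatible orthogonal systems\<close>

text \<open>For a family of submodules \<open>C j\<close> of \<open>W\<close>: the canonical map from their external direct sum.\<close>

definition sum_map :: "('a, 'w) module \<Rightarrow> 'j set \<Rightarrow> ('j \<Rightarrow> 'w) \<Rightarrow> 'w" where
  "sum_map W J f = (\<Oplus>\<^bsub>W\<^esub> j\<in>{j \<in> J. f j \<noteq> \<zero>\<^bsub>W\<^esub>}. f j)"

definition sub_sum :: "('a, 'w) module \<Rightarrow> 'j set \<Rightarrow> ('j \<Rightarrow> 'w set) \<Rightarrow> 'w set" where
  "sub_sum W J C = sum_map W J ` carrier (direct_sum J (\<lambda>j. W\<lparr>carrier := C j\<rparr>))"

definition internal_direct_sum :: "('a, 'r) ring_scheme \<Rightarrow> ('a, 'w) module \<Rightarrow> 'j set \<Rightarrow> ('j \<Rightarrow> 'w set) \<Rightarrow> bool" where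
  "internal_direct_sum A W J C \<longleftrightarrow> (\<forall>j\<in>J. submodule (C j) A W) \<and>
     bij_betw (sum_map W J) (carrier (direct_sum J (\<lambda>j. W\<lparr>carrier := C j\<rparr>))) (carrier W)"

text \<open>The copy \<open>X\<^sup>(\<^sup>r\<^sup>)\<close> is \<open>C (X, r)\<close> with \<open>r \<ge> 1\<close>.  Orthogonality of the copies means that \<open>M\<close> is
  embedded as an orthogonal block: \<open>\<sigma> M\<close> carries the first \<open>m X\<close> copies of every \<open>X\<close> onto
  \<open>M \<oplus> 0\<close> and the remaining copies onto the complement \<open>0 \<oplus> M'\<close>, so that the idempotent
  \<open>\<sigma>\<^sub>M\<^sup>-\<^sup>1 \<circ> \<iota>\<^sub>M \<circ> \<pi>\<^sub>M \<circ> \<sigma>\<^sub>M\<close> is the projection of the fixed decomposition.\<close>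

definition compatible_orthogonal ::
    "(complex, 'a) module \<Rightarrow> ('a, 'w) module \<Rightarrow> (('a, 'm) module \<Rightarrow> ('a, 'k) module) \<Rightarrow>
     (('a, 'm) module \<Rightarrow> 'w \<Rightarrow> 'm \<times> 'k) \<Rightarrow> ('a, 'm) module set \<Rightarrow> bool" where
  "compatible_orthogonal A W M' \<sigma> S \<longleftrightarrow>
     (\<exists>C :: ('a, 'm) module \<times> nat \<Rightarrow> 'w set.
        internal_direct_sum A W (S \<times> {1..}) C \<and>
        (\<forall>X\<in>S. \<forall>r\<ge>1. isomorphic_mod A (W\<lparr>carrier := C (X, r)\<rparr>) X) \<and>
        (\<forall>M m. add_proj_inj A M \<and>
           isomorphic_mod A M (direct_sum {(X, r). X \<in> S \<and> 1 \<le> r \<and> r \<le> m X} (\<lambda>(X, r :: nat). X)) \<longrightarrow>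
           \<sigma> M ` sub_sum W {(X, r). X \<in> S \<and> 1 \<le> r \<and> r \<le> m X} C = carrier M \<times> {\<zero>\<^bsub>M' M\<^esub>} \<and>
           \<sigma> M ` sub_sum W {(X, r). X \<in> S \<and> m X < r} C = {\<zero>\<^bsub>M\<^esub>} \<times> carrier (M' M)))"


section \<open>Morita equivalence\<close>

text \<open>Functors between categories of finite-dimensional modules: \<open>F\<close> acts on objects and
  \<open>F\<^sub>1 M N\<close> on the morphisms from \<open>M\<close> to \<open>N\<close>.\<close>

type_synonym ('a, 'm, 'b, 'n) on_objects = "('a, 'm) module \<Rightarrow> ('b, 'n) module"
type_synonym ('a, 'm, 'n) on_morphisms = "('a, 'm) module \<Rightarrow> ('a, 'm) module \<Rightarrow> ('m \<Rightarrow> 'm) \<Rightarrow> ('n \<Rightarrow> 'n)"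

definition linear_functor :: "(complex, 'a) module \<Rightarrow> (complex, 'b) module \<Rightarrow>
    ('a, 'm, 'b, 'n) on_objects \<Rightarrow> ('a, 'm, 'n) on_morphisms \<Rightarrow> bool" where
  "linear_functor A B F F\<^sub>1 \<longleftrightarrow>
     (\<forall>M. fd_module A M \<longrightarrow> fd_module B (F M)) \<and>
     (\<forall>M N. fd_module A M \<and> fd_module A N \<longrightarrow>
        F\<^sub>1 M N \<in> mod_hom cplx (hom_space A M N) (hom_space B (F M) (F N))) \<and>
     (\<forall>M. fd_module A M \<longrightarrow> F\<^sub>1 M M (\<lambda>x\<in>carrier M. x) = (\<lambda>y\<in>carrier (F M). y)) \<and>
     (\<forall>L M N. \<forall>f\<in>mod_hom A L M. \<forall>g\<in>mod_hom A M N.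
        fd_module A L \<and> fd_module A M \<and> fd_module A N \<longrightarrow>
        F\<^sub>1 L N (compose (carrier L) g f) = compose (carrier (F L)) (F\<^sub>1 M N g) (F\<^sub>1 L M f))"

definition naturally_isomorphic :: "(complex, 'a) module \<Rightarrow> (complex, 'b) module \<Rightarrow>
    ('a, 'm, 'b, 'n) on_objects \<Rightarrow> ('a, 'm, 'n) on_morphisms \<Rightarrow>
    ('a, 'm, 'b, 'n) on_objects \<Rightarrow> ('a, 'm, 'n) on_morphisms \<Rightarrow> bool" where
  "naturally_isomorphic A B F F\<^sub>1 G G\<^sub>1 \<longleftrightarrow>
     (\<exists>\<eta>. (\<forall>M. fd_module A M \<longrightarrow> \<eta> M \<in> mod_iso B (F M) (G M)) \<and>
        (\<forall>M N. \<forall>f\<in>mod_hom A M N. fd_module A M \<and> fd_module A N \<longrightarrow>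
           compose (carrier (F M)) (\<eta> N) (F\<^sub>1 M N f) = compose (carrier (F M)) (G\<^sub>1 M N f) (\<eta> M)))"

definition morita_equivalent ::
    "'m itself \<Rightarrow> 'n itself \<Rightarrow> (complex, 'a) module \<Rightarrow> (complex, 'b) module \<Rightarrow> bool" where
  "morita_equivalent _ _ A B \<longleftrightarrow>
     (\<exists>(F :: ('a, 'm, 'b, 'n) on_objects) F\<^sub>1 (G :: ('b, 'n, 'a, 'm) on_objects) G\<^sub>1.
        linear_functor A B F F\<^sub>1 \<and> linear_functor B A G G\<^sub>1 \<and>
        naturally_isomorphic A A (\<lambda>M. G (F M)) (\<lambda>M N f. G\<^sub>1 (F M) (F N) (F\<^sub>1 M N f))
          (\<lambda>M. M) (\<lambda>M N f. f) \<and>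
        naturally_isomorphic B B (\<lambda>M. F (G M)) (\<lambda>M N f. F\<^sub>1 (G M) (G N) (G\<^sub>1 M N f))
          (\<lambda>M. M) (\<lambda>M N f. f))"

end

theory Submission
  imports Defs "HOL-Library.Function_Algebras"
begin

text \<open>The coefficient ring turns out to depend on very little.  Since the structure map
  \<open>\<rho>\<^sub>M\<close> is linear, integrating it over a box gives multiplication by an element of the algebra:
  \<open>\<Phi>\<^sub>M(t) = \<rho>\<^sub>M(Q(t))\<close> with \<open>Q(t) = (t\<^sub>1 \<cdots> t\<^sub>d / 2) \<cdot> \<Sum>\<^sub>i t\<^sub>i a\<^sub>i\<close>
  (\<open>integral_profile_eq\<close>).  For a compatible orthogonal system the embedded map \<open>Emb\<^sub>M(\<Phi>\<^sub>M)\<close> is therefore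
  \<open>Q(t)\<close> on the components \<open>X\<^sup>(\<^sup>r\<^sup>)\<close> that belong to the block of \<open>M\<close> and zero on all the others
  (\<open>emb_integral_profile\<close>), and every element of the coefficient ring acts on each component as a
  polynomial without constant term in \<open>Q(t)\<close>.  Subtracting the generators of \<open>X\<^sup>r\<^sup>-\<^sup>1\<close> and \<open>X\<^sup>r\<close> isolates
  the single component \<open>X\<^sup>(\<^sup>r\<^sup>)\<close>.

  On a nonzero component no nonzero polynomial with constant coefficients annihilates \<open>Q(t)\<close> for
  all \<open>t\<close> (\<open>profile_free\<close>): \<open>Q\<close> is homogeneous, so otherwise a fixed power of every positive
  combination of the \<open>a\<^sub>i\<close> would act as zero, and by density so would that power of \<open>1\<close>.  Hence the
  coefficient ring is the direct sum of copies of \<open>z\<complex>[z]\<close> indexed by the components \<open>X\<^sup>(\<^sup>r\<^sup>)\<close>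
  (\<open>coefficient_ring_structure\<close>).

  The number of components is all that remains.  It is at most countable, since the countable sum of
  copies of \<open>\<Pi>\<close> has countable dimension (\<open>countable_components\<close>); it is zero if the algebra is zero,
  and infinite otherwise, since the regular module is then a nonzero projective module
  (\<open>indec_reps_empty_iff\<close>).  Finally an algebra that is Morita equivalent to the zero algebra is zero
  (\<open>morita_equivalent_trivial\<close>).\<close>

section \<open>Complex vector spaces given by a carrier\<close>

lemma cplx_simps [simp]:
  "carrier cplx = UNIV" "x \<otimes>\<^bsub>cplx\<^esub> y = x * y" "\<one>\<^bsub>cplx\<^esub> = 1" "\<zero>\<^bsub>cplx\<^esub> = 0"
  "x \<oplus>\<^bsub>cplx\<^esub> y = x + y" "c \<odot>\<^bsub>cplx\<^esub> x = c * x"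
  by (simp_all add: cplx_def)

lemma cring_cplx: "cring cplx"
proof (rule cringI)
  show "abelian_group cplx"
    by (rule abelian_groupI) (auto simp: algebra_simps intro: exI[of _ "- _"])
  show "comm_monoid cplx" by (rule comm_monoidI) (auto simp: algebra_simps)
qed (auto simp: algebra_simps)

lemma a_inv_cplx [simp]: "\<ominus>\<^bsub>cplx\<^esub> x = - x"
proof -
  interpret cring cplx by (rule cring_cplx)
  show ?thesis using minus_equality[of "- x" x] by simp
qed

definition functional :: "(complex, 'v) module \<Rightarrow> ('v \<Rightarrow> complex) \<Rightarrow> bool" where
  "functional V f \<longleftrightarrow> (\<forall>x\<in>carrier V. \<forall>y\<in>carrier V. f (x \<oplus>\<^bsub>V\<^esub> y) = f x + f y) \<and>
     (\<forall>c. \<forall>x\<in>carrier V. f (c \<odot>\<^bsub>V\<^esub> x) = c * f x)"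

lemma functionalD:
  assumes "functional V f" "x \<in> carrier V"
  shows "y \<in> carrier V \<Longrightarrow> f (x \<oplus>\<^bsub>V\<^esub> y) = f x + f y" and "f (c \<odot>\<^bsub>V\<^esub> x) = c * f x"
  using assms by (auto simp: functional_def)

locale complex_space = V?: Module.module cplx V for V :: "(complex, 'v) module" (structure)
begin

lemma smult_zero [simp]: "x \<in> carrier V \<Longrightarrow> 0 \<odot> x = \<zero>"
  using smult_l_null by simp

lemma smult_one' [simp]: "x \<in> carrier V \<Longrightarrow> 1 \<odot> x = x"
  using smult_one by simp

lemma smult_closed' [simp, intro]: "x \<in> carrier V \<Longrightarrow> c \<odot> x \<in> carrier V"
  by simp

lemma smult_zero_right [simp]: "c \<odot> \<zero> = \<zero>"
  using smult_r_null by simp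

lemma smult_minus_one: "x \<in> carrier V \<Longrightarrow> (- 1) \<odot> x = \<ominus> x"
  using smult_l_minus[of 1 x] by simp

lemma smult_add: "x \<in> carrier V \<Longrightarrow> (c + d) \<odot> x = c \<odot> x \<oplus> d \<odot> x"
  using smult_l_distr[of c d x] by simp

lemma smult_smult: "x \<in> carrier V \<Longrightarrow> c \<odot> (d \<odot> x) = (c * d) \<odot> x"
  using smult_assoc1[of c d x] by simp

lemma smult_distr: "x \<in> carrier V \<Longrightarrow> y \<in> carrier V \<Longrightarrow> c \<odot> (x \<oplus> y) = c \<odot> x \<oplus> c \<odot> y"
  using smult_r_distr[of c x y] by simp

lemma smult_eq_zero: "x \<in> carrier V \<Longrightarrow> c \<odot> x = \<zero> \<Longrightarrow> c \<noteq> 0 \<Longrightarrow> x = \<zero>"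
  using smult_smult[of x "1/c" c] by simp

lemma functional_zero: "functional V f \<Longrightarrow> f \<zero> = 0"
  using functionalD(2)[of V f "\<zero>" 0] by simp

lemma functional_finsum:
  assumes "functional V f" "finite F" "g \<in> F \<rightarrow> carrier V"
  shows "f (\<Oplus>i\<in>F. g i) = (\<Sum>i\<in>F. f (g i))"
  using assms(2,3)
proof (induction F)
  case empty
  then show ?case by (simp add: functional_zero[OF assms(1)])
next
  case (insert i F)
  then have "g i \<in> carrier V" "g \<in> F \<rightarrow> carrier V" by auto
  then show ?case
    using insert functionalD(1)[OF assms(1), of "g i" "finsum V g F"] by simp
qed

lemma functional_lin_comb:
  assumes "functional V f" "b \<in> {..<d} \<rightarrow> carrier V"
  shows "f (lin_comb V d b c) = (\<Sum>i<d. c i * f (b i))"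
proof -
  have "f (lin_comb V d b c) = (\<Sum>i<d. f (c i \<odot> b i))"
    unfolding lin_comb_def by (rule functional_finsum[OF assms(1)]) (use assms(2) in auto)
  also have "\<dots> = (\<Sum>i<d. c i * f (b i))"
    using assms(2) functionalD(2)[OF assms(1)] by (intro sum.cong) auto
  finally show ?thesis .
qed

lemma lin_comb_closed [intro]: "b \<in> {..<d} \<rightarrow> carrier V \<Longrightarrow> lin_comb V d b c \<in> carrier V"
  unfolding lin_comb_def by (intro finsum_closed) auto

lemma lin_comb_add:
  assumes "b \<in> {..<d} \<rightarrow> carrier V"
  shows "lin_comb V d b (\<lambda>i. c i + c' i) = lin_comb V d b c \<oplus> lin_comb V d b c'"
proof -
  have "lin_comb V d b (\<lambda>i. c i + c' i) = (\<Oplus>i\<in>{..<d}. c i \<odot> b i \<oplus> c' i \<odot> b i)"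
    unfolding lin_comb_def using assms by (intro finsum_cong') (auto simp: smult_add Pi_iff)
  also have "\<dots> = lin_comb V d b c \<oplus> lin_comb V d b c'"
    unfolding lin_comb_def using assms by (intro finsum_addf) auto
  finally show ?thesis .
qed

lemma lin_comb_smult:
  assumes "b \<in> {..<d} \<rightarrow> carrier V"
  shows "lin_comb V d b (\<lambda>i. z * c i) = z \<odot> lin_comb V d b c"
proof -
  have "lin_comb V d b (\<lambda>i. z * c i) = (\<Oplus>i\<in>{..<d}. z \<odot> (c i \<odot> b i))"
    unfolding lin_comb_def using assms by (intro finsum_cong') (auto simp: smult_smult Pi_iff)
  also have "\<dots> = z \<odot> lin_comb V d b c"
    unfolding lin_comb_def using assms by (intro finsum_smult_ldistr[symmetric]) auto
  finally show ?thesis .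
qed

lemma lin_comb_cong:
  assumes "b \<in> {..<d} \<rightarrow> carrier V" "\<And>i. i < d \<Longrightarrow> c i = c' i"
  shows "lin_comb V d b c = lin_comb V d b c'"
  unfolding lin_comb_def using assms by (intro finsum_cong') (auto simp: Pi_iff)

end

text \<open>Coordinates are an injective linear map into finitely supported functions.  They replace bases
  below because they pass to subspaces, direct sums and transported copies by composition.\<close>

definition coords :: "(complex, 'v) module \<Rightarrow> ('v \<Rightarrow> 'i \<Rightarrow> complex) \<Rightarrow> bool" where
  "coords V \<kappa> \<longleftrightarrow> (\<forall>i. functional V (\<lambda>x. \<kappa> x i)) \<and> inj_on \<kappa> (carrier V) \<and>
     (\<forall>x\<in>carrier V. finite {i. \<kappa> x i \<noteq> 0})"

definition bounded_coords :: "(complex, 'v) module \<Rightarrow> nat \<Rightarrow> ('v \<Rightarrow> nat \<Rightarrow> complex) \<Rightarrow> bool" where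
  "bounded_coords V N \<kappa> \<longleftrightarrow> (\<forall>i. functional V (\<lambda>x. \<kappa> x i)) \<and> inj_on \<kappa> (carrier V) \<and>
     (\<forall>x\<in>carrier V. \<forall>i\<ge>N. \<kappa> x i = 0)"

lemma bounded_coords_imp_coords: "bounded_coords V N \<kappa> \<Longrightarrow> coords V \<kappa>"
proof -
  assume a: "bounded_coords V N \<kappa>"
  have "finite {i. \<kappa> x i \<noteq> 0}" if "x \<in> carrier V" for x
    by (rule finite_subset[of _ "{..<N}"]) (use a that in \<open>auto simp: bounded_coords_def not_less[symmetric]\<close>)
  with a show ?thesis by (auto simp: bounded_coords_def coords_def)
qed

lemma (in complex_space) coords_eqI:
  assumes "coords V \<kappa>" "x \<in> carrier V" "y \<in> carrier V" "\<And>f. functional V f \<Longrightarrow> f x = f y"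
  shows "x = y"
proof -
  have "\<kappa> x = \<kappa> y" using assms by (auto simp: coords_def)
  then show ?thesis using assms by (auto simp: coords_def inj_on_def)
qed

lemma (in complex_space) basis_imp_bounded_coords:
  assumes "is_basis V d b"
  obtains \<kappa> where "bounded_coords V d \<kappa>"
proof -
  have b: "b \<in> {..<d} \<rightarrow> carrier V"
    and ex: "\<And>x. x \<in> carrier V \<Longrightarrow> \<exists>!c. c \<in> {..<d} \<rightarrow>\<^sub>E UNIV \<and> x = lin_comb V d b c"
    using assms by (auto simp: is_basis_def)
  define K where "K x = (THE c. c \<in> {..<d} \<rightarrow>\<^sub>E UNIV \<and> x = lin_comb V d b c)" for x
  have K: "K x \<in> {..<d} \<rightarrow>\<^sub>E UNIV" "lin_comb V d b (K x) = x" if "x \<in> carrier V" for x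
    using theI'[OF ex[OF that]] by (auto simp: K_def)
  have uniq: "K (lin_comb V d b c) i = c i" if "i < d" for c i
  proof -
    have "lin_comb V d b c = lin_comb V d b (restrict c {..<d})"
      by (rule lin_comb_cong[OF b]) auto
    then have "K (lin_comb V d b c) = restrict c {..<d}"
      using ex[of "lin_comb V d b c"] K[of "lin_comb V d b c"] b by (metis lin_comb_closed restrict_PiE_iff UNIV_I)
    then show ?thesis using that by simp
  qed
  define \<kappa> where "\<kappa> x i = (if i < d then K x i else 0)" for x i
  have "functional V (\<lambda>x. \<kappa> x i)" for i
    unfolding functional_def
  proof (intro conjI ballI allI)
    fix x y assume xy: "x \<in> carrier V" "y \<in> carrier V"
    have "x \<oplus> y = lin_comb V d b (\<lambda>i. K x i + K y i)"
      using K xy by (simp add: lin_comb_add[OF b])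
    then show "\<kappa> (x \<oplus> y) i = \<kappa> x i + \<kappa> y i" using uniq[of i "\<lambda>i. K x i + K y i"] by (auto simp: \<kappa>_def)
  next
    fix c x assume x: "x \<in> carrier V"
    have "c \<odot> x = lin_comb V d b (\<lambda>i. c * K x i)"
      using K x by (simp add: lin_comb_smult[OF b])
    then show "\<kappa> (c \<odot> x) i = c * \<kappa> x i" using uniq[of i "\<lambda>i. c * K x i"] by (auto simp: \<kappa>_def)
  qed
  moreover have "inj_on \<kappa> (carrier V)"
  proof
    fix x y assume xy: "x \<in> carrier V" "y \<in> carrier V" and eq: "\<kappa> x = \<kappa> y"
    have "lin_comb V d b (K x) = lin_comb V d b (K y)"
      by (rule lin_comb_cong[OF b]) (use fun_cong[OF eq] in \<open>metis \<kappa>_def\<close>)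
    then show "x = y" using K xy by simp
  qed
  ultimately have "bounded_coords V d \<kappa>" by (auto simp: bounded_coords_def \<kappa>_def)
  then show ?thesis by (rule that)
qed

interpretation cf: vector_space "\<lambda>(c::complex) (f::'i \<Rightarrow> complex). (\<lambda>i. c * f i)"
  by unfold_locales (auto simp: algebra_simps fun_eq_iff)

lemma (in complex_space) coords_lin_comb:
  assumes "\<forall>i. functional V (\<lambda>x. \<kappa> x i)" "b \<in> {..<d} \<rightarrow> carrier V"
  shows "\<kappa> (lin_comb V d b c) = (\<Sum>j<d. (\<lambda>i. c j * \<kappa> (b j) i))"
proof
  fix i
  have "\<kappa> (lin_comb V d b c) i = (\<Sum>j<d. c j * \<kappa> (b j) i)"
    using functional_lin_comb[of "\<lambda>x. \<kappa> x i", OF _ assms(2)] assms(1) by simp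
  moreover have "(\<Sum>j<n. (\<lambda>i. c j * \<kappa> (b j) i)) i = (\<Sum>j<n. c j * \<kappa> (b j) i)" for n
    by (induction n) auto
  ultimately show "\<kappa> (lin_comb V d b c) i = (\<Sum>j<d. (\<lambda>i. c j * \<kappa> (b j) i)) i" by simp
qed

lemma finite_support_in_span:
  assumes "finite F" "{i. f i \<noteq> (0::complex)} \<subseteq> F"
  shows "f \<in> cf.span ((\<lambda>k i. if i = k then 1 else 0) ` F)"
proof -
  let ?e = "\<lambda>k i. if i = k then 1 else (0::complex)"
  have "(\<Sum>k\<in>G. (\<lambda>i. f k * ?e k i)) i = (if i \<in> G then f i else 0)" if "finite G" for G i
    using that by (induction G) auto
  then have "f = (\<Sum>k\<in>F. (\<lambda>i. f k * ?e k i))" using assms by (auto simp: fun_eq_iff)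
  also have "\<dots> \<in> cf.span (?e ` F)"
    by (intro cf.span_sum cf.span_scale cf.span_base) auto
  finally show ?thesis .
qed

text \<open>The image of a coordinate map is a subspace of the span of finitely many unit vectors; a basis of
  the image pulls back.\<close>

lemma (in complex_space) bounded_coords_imp_basis:
  assumes "bounded_coords V N \<kappa>"
  shows "\<exists>n b. is_basis V n b"
proof -
  have lin: "\<forall>i. functional V (\<lambda>x. \<kappa> x i)" and inj: "inj_on \<kappa> (carrier V)"
    and bd: "\<And>x i. x \<in> carrier V \<Longrightarrow> i \<ge> N \<Longrightarrow> \<kappa> x i = 0"
    using assms by (auto simp: bounded_coords_def)
  let ?V = "\<kappa> ` carrier V" and ?e = "(\<lambda>k i. if i = k then 1 else (0::complex)) ` {..<N}"
  obtain B where B: "B \<subseteq> ?V" "cf.independent B" "?V \<subseteq> cf.span B" "card B = cf.dim ?V"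
    by (rule cf.basis_exists)
  have "\<kappa> x \<in> cf.span ?e" if "x \<in> carrier V" for x
    by (rule finite_support_in_span) (use bd[OF that] in \<open>auto simp: not_less[symmetric]\<close>)
  then have "B \<subseteq> cf.span ?e" using B(1) by auto
  then have fin: "finite B" using cf.independent_span_bound[OF _ B(2), of ?e] by auto
  then obtain \<beta> where \<beta>: "bij_betw \<beta> {..<card B} B"
    using ex_bij_betw_nat_finite[OF fin] by (auto simp: lessThan_atLeast0)
  define b where "b i = inv_into (carrier V) \<kappa> (\<beta> i)" for i
  have bV: "b i \<in> carrier V" "\<kappa> (b i) = \<beta> i" if "i < card B" for i
    using that \<beta> B(1) by (auto simp: b_def bij_betw_def intro!: inv_into_into f_inv_into_f)
  then have b: "b \<in> {..<card B} \<rightarrow> carrier V" by auto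
  have kb: "\<kappa> (lin_comb V (card B) b c) = (\<Sum>j<card B. (\<lambda>i. c j * \<beta> j i))" for c
    unfolding coords_lin_comb[OF lin b] by (intro sum.cong refl) (simp add: bV)
  have sumB: "(\<Sum>v\<in>B. (\<lambda>i. u v * v i)) = (\<Sum>j<card B. (\<lambda>i. u (\<beta> j) * \<beta> j i))" for u
    using sum.reindex_bij_betw[OF \<beta>, of "\<lambda>v i. u v * v i"] by simp
  have "\<exists>!c. c \<in> {..<card B} \<rightarrow>\<^sub>E UNIV \<and> x = lin_comb V (card B) b c" if x: "x \<in> carrier V" for x
  proof (rule ex_ex1I)
    have "\<kappa> x \<in> cf.span B" using B(3) x by auto
    then obtain u where "\<kappa> x = (\<Sum>v\<in>B. (\<lambda>i. u v * v i))" using cf.span_finite[OF fin] by auto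
    also have "\<dots> = (\<Sum>j<card B. (\<lambda>i. (\<lambda>j\<in>{..<card B}. u (\<beta> j)) j * \<beta> j i))"
      unfolding sumB by (rule sum.cong) (simp_all add: fun_eq_iff)
    finally have "\<kappa> x = \<kappa> (lin_comb V (card B) b (\<lambda>j\<in>{..<card B}. u (\<beta> j)))"
      unfolding kb .
    then have "x = lin_comb V (card B) b (\<lambda>j\<in>{..<card B}. u (\<beta> j))"
      using inj x b by (auto dest!: inj_onD)
    then show "\<exists>c. c \<in> {..<card B} \<rightarrow>\<^sub>E UNIV \<and> x = lin_comb V (card B) b c"
      by (intro exI[of _ "\<lambda>j\<in>{..<card B}. u (\<beta> j)"]) auto
  next
    fix c c'
    assume c: "c \<in> {..<card B} \<rightarrow>\<^sub>E UNIV \<and> x = lin_comb V (card B) b c"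
      and c': "c' \<in> {..<card B} \<rightarrow>\<^sub>E UNIV \<and> x = lin_comb V (card B) b c'"
    define u where "u v = c (inv_into {..<card B} \<beta> v) - c' (inv_into {..<card B} \<beta> v)" for v
    have inv: "inv_into {..<card B} \<beta> (\<beta> j) = j" if "j < card B" for j
      using \<beta> that by (auto simp: bij_betw_def intro: inv_into_f_f)
    have "(\<Sum>j<card B. (\<lambda>i. c j * \<beta> j i)) = (\<Sum>j<card B. (\<lambda>i. c' j * \<beta> j i))"
      using c c' kb[of c] kb[of c'] by metis
    then have "(\<Sum>j<card B. (\<lambda>i. c j * \<beta> j i) - (\<lambda>i. c' j * \<beta> j i)) = 0"
      by (simp add: sum_subtractf)
    also have "(\<Sum>j<card B. (\<lambda>i. c j * \<beta> j i) - (\<lambda>i. c' j * \<beta> j i)) = (\<Sum>v\<in>B. (\<lambda>i. u v * v i))"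
      unfolding sumB by (intro sum.cong refl) (auto simp: u_def inv algebra_simps fun_eq_iff)
    finally have "u v = 0" if "v \<in> B" for v
      using B(2) fin that unfolding cf.dependent_finite[OF fin] by blast
    then have "c j = c' j" if "j < card B" for j
      using inv[OF that] that \<beta> unfolding u_def bij_betw_def by fastforce
    then show "c = c'" using c c' PiE_ext[of c "{..<card B}" "\<lambda>_. UNIV" c'] by auto
  qed
  then have "is_basis V (card B) b" unfolding is_basis_def by (intro conjI ballI b)
  then show ?thesis by (intro exI)
qed

section \<open>Left modules over a complex algebra\<close>

lemma cspace_simps [simp]:
  "carrier (cspace A M) = carrier M" "x \<oplus>\<^bsub>cspace A M\<^esub> y = x \<oplus>\<^bsub>M\<^esub> y" "\<zero>\<^bsub>cspace A M\<^esub> = \<zero>\<^bsub>M\<^esub>"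
  by (simp_all add: cspace_def)

lemma finsum_cspace [simp]: "finsum (cspace A M) = finsum M"
  by (intro ext) (simp add: finsum_def finprod_def cspace_def)

lemma a_inv_cspace [simp]: "\<ominus>\<^bsub>cspace A M\<^esub> x = \<ominus>\<^bsub>M\<^esub> x"
  by (simp add: a_inv_def m_inv_def cspace_def)

lemma abelian_group_cspace: "abelian_group M \<Longrightarrow> abelian_group (cspace A M)"
  using abelian_groupE[of M] by (intro abelian_groupI) simp_all

locale lmod =
  fixes A :: "(complex, 'a) module" and M :: "('a, 'm) module"
  assumes alg: "complex_algebra A" and lm: "left_module A M"
begin

sublocale left_module A M by (rule lm)

lemma one_smult_closed [simp, intro]: "c \<odot>\<^bsub>A\<^esub> \<one>\<^bsub>A\<^esub> \<in> carrier A"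
  using alg one_closed by (auto simp: complex_algebra_def Module.module_def module_axioms_def)

lemma csmult_def: "c \<odot>\<^bsub>cspace A M\<^esub> x = (c \<odot>\<^bsub>A\<^esub> \<one>\<^bsub>A\<^esub>) \<odot>\<^bsub>M\<^esub> x"
  by (simp add: cspace_def)

sublocale S: complex_space A
  using alg by (simp add: complex_algebra_def complex_space_def)

lemma smult_alg_eq:
  assumes "r \<in> carrier A"
  shows "(c \<odot>\<^bsub>A\<^esub> \<one>\<^bsub>A\<^esub>) \<otimes>\<^bsub>A\<^esub> r = c \<odot>\<^bsub>A\<^esub> r" "r \<otimes>\<^bsub>A\<^esub> (c \<odot>\<^bsub>A\<^esub> \<one>\<^bsub>A\<^esub>) = c \<odot>\<^bsub>A\<^esub> r"
  using alg assms unfolding complex_algebra_def by (metis one_closed l_one r_one)+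

lemmas act_closed [simp, intro] = smult_closed

sublocale V: complex_space "cspace A M"
proof (unfold complex_space_def, rule moduleI[OF cring_cplx])
  show "abelian_group (cspace A M)"
    by (rule abelian_group_cspace) (rule M.abelian_group_axioms)
qed (auto simp: csmult_def smult_r_distr S.smult_add smult_l_distr smult_one
    smult_assoc[symmetric] smult_alg_eq S.smult_smult mult.commute)

lemma csmult_closed [simp, intro]: "x \<in> carrier M \<Longrightarrow> c \<odot>\<^bsub>cspace A M\<^esub> x \<in> carrier M"
  using V.smult_closed' by simp

lemma act_csmult:
  assumes "r \<in> carrier A" "x \<in> carrier M"
  shows "r \<odot>\<^bsub>M\<^esub> (c \<odot>\<^bsub>cspace A M\<^esub> x) = c \<odot>\<^bsub>cspace A M\<^esub> (r \<odot>\<^bsub>M\<^esub> x)"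
    and "(c \<odot>\<^bsub>A\<^esub> r) \<odot>\<^bsub>M\<^esub> x = c \<odot>\<^bsub>cspace A M\<^esub> (r \<odot>\<^bsub>M\<^esub> x)"
  using assms by (simp_all add: csmult_def smult_assoc[symmetric] smult_alg_eq)

lemma act_zero [simp]: "r \<in> carrier A \<Longrightarrow> r \<odot>\<^bsub>M\<^esub> \<zero>\<^bsub>M\<^esub> = \<zero>\<^bsub>M\<^esub>"
  using act_csmult(1)[of r "\<zero>\<^bsub>M\<^esub>" 0] by (metis V.smult_zero cspace_simps(1,3) M.zero_closed act_closed)

lemma zero_act [simp]: "x \<in> carrier M \<Longrightarrow> \<zero>\<^bsub>A\<^esub> \<odot>\<^bsub>M\<^esub> x = \<zero>\<^bsub>M\<^esub>"
proof -
  assume x: "x \<in> carrier M"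
  have zcA: "\<zero>\<^bsub>A\<^esub> \<in> carrier A" by simp
  have "(0 \<odot>\<^bsub>A\<^esub> \<zero>\<^bsub>A\<^esub>) \<odot>\<^bsub>M\<^esub> x = 0 \<odot>\<^bsub>cspace A M\<^esub> (\<zero>\<^bsub>A\<^esub> \<odot>\<^bsub>M\<^esub> x)"
    using act_csmult(2)[OF zcA x] by simp
  then show ?thesis
    using S.smult_zero[OF zcA] V.smult_zero[of "\<zero>\<^bsub>A\<^esub> \<odot>\<^bsub>M\<^esub> x"] act_closed[OF zcA x] by simp
qed

end

lemma left_moduleI:
  assumes "ring A" "abelian_group M"
    and "\<And>r x. \<lbrakk>r \<in> carrier A; x \<in> carrier M\<rbrakk> \<Longrightarrow> r \<odot>\<^bsub>M\<^esub> x \<in> carrier M"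
    and "\<And>r s x. \<lbrakk>r \<in> carrier A; s \<in> carrier A; x \<in> carrier M\<rbrakk> \<Longrightarrow>
          (r \<oplus>\<^bsub>A\<^esub> s) \<odot>\<^bsub>M\<^esub> x = r \<odot>\<^bsub>M\<^esub> x \<oplus>\<^bsub>M\<^esub> s \<odot>\<^bsub>M\<^esub> x"
    and "\<And>r x y. \<lbrakk>r \<in> carrier A; x \<in> carrier M; y \<in> carrier M\<rbrakk> \<Longrightarrow>
          r \<odot>\<^bsub>M\<^esub> (x \<oplus>\<^bsub>M\<^esub> y) = r \<odot>\<^bsub>M\<^esub> x \<oplus>\<^bsub>M\<^esub> r \<odot>\<^bsub>M\<^esub> y"
    and "\<And>r s x. \<lbrakk>r \<in> carrier A; s \<in> carrier A; x \<in> carrier M\<rbrakk> \<Longrightarrow>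
          (r \<otimes>\<^bsub>A\<^esub> s) \<odot>\<^bsub>M\<^esub> x = r \<odot>\<^bsub>M\<^esub> (s \<odot>\<^bsub>M\<^esub> x)"
    and "\<And>x. x \<in> carrier M \<Longrightarrow> \<one>\<^bsub>A\<^esub> \<odot>\<^bsub>M\<^esub> x = x"
  shows "left_module A M"
  using assms by (intro left_module.intro left_module_axioms.intro) auto

lemma dsum_simps [simp]:
  "carrier (dsum M N) = carrier M \<times> carrier N" "\<zero>\<^bsub>dsum M N\<^esub> = (\<zero>\<^bsub>M\<^esub>, \<zero>\<^bsub>N\<^esub>)"
  "(x, y) \<oplus>\<^bsub>dsum M N\<^esub> (x', y') = (x \<oplus>\<^bsub>M\<^esub> x', y \<oplus>\<^bsub>N\<^esub> y')"
  "r \<odot>\<^bsub>dsum M N\<^esub> (x, y) = (r \<odot>\<^bsub>M\<^esub> x, r \<odot>\<^bsub>N\<^esub> y)"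
  by (simp_all add: dsum_def)

lemma direct_sum_simps [simp]:
  "carrier (direct_sum J X) = {f \<in> (\<Pi>\<^sub>E j\<in>J. carrier (X j)). finite {j \<in> J. f j \<noteq> \<zero>\<^bsub>X j\<^esub>}}"
  "\<zero>\<^bsub>direct_sum J X\<^esub> = (\<lambda>j\<in>J. \<zero>\<^bsub>X j\<^esub>)"
  "f \<oplus>\<^bsub>direct_sum J X\<^esub> g = (\<lambda>j\<in>J. f j \<oplus>\<^bsub>X j\<^esub> g j)"
  "r \<odot>\<^bsub>direct_sum J X\<^esub> f = (\<lambda>j\<in>J. r \<odot>\<^bsub>X j\<^esub> f j)"
  by (simp_all add: direct_sum_def)

lemma left_module_dsum:
  assumes "left_module A M" "left_module A N"
  shows "left_module A (dsum M N)"
proof -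
  interpret M: left_module A M by fact
  interpret N: left_module A N by fact
  show ?thesis
  proof (rule left_moduleI)
    show "abelian_group (dsum M N)"
    proof (rule abelian_groupI)
      show "\<exists>y\<in>carrier (dsum M N). y \<oplus>\<^bsub>dsum M N\<^esub> x = \<zero>\<^bsub>dsum M N\<^esub>" if "x \<in> carrier (dsum M N)" for x
        using that by (intro bexI[of _ "(\<ominus>\<^bsub>M\<^esub> fst x, \<ominus>\<^bsub>N\<^esub> snd x)"]) (auto simp: M.M.l_neg N.M.l_neg)
    qed (auto simp: M.M.a_ac N.M.a_ac)
  qed (auto simp: M.smult_closed N.smult_closed M.smult_l_distr N.smult_l_distr M.smult_r_distr
      N.smult_r_distr M.smult_assoc N.smult_assoc M.smult_one N.smult_one M.ring_axioms)
qed

lemma left_module_direct_sum: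
  assumes A: "complex_algebra A" and X: "\<And>j. j \<in> J \<Longrightarrow> left_module A (X j)"
  shows "left_module A (direct_sum J X)"
proof -
  have lX: "lmod A (X j)" if "j \<in> J" for j using A X that by (simp add: lmod_def)
  have aX: "abelian_group (X j)" if "j \<in> J" for j using X[OF that] by (simp add: left_module_def)
  note aclosed = abelian_groupE(1)[OF aX] and zclosed = abelian_groupE(2)[OF aX]
  note lz = abelian_groupE(5)[OF aX]
  note [simp] = left_module.smult_closed[OF X] left_module.smult_l_distr[OF X] left_module.smult_r_distr[OF X]
    left_module.smult_assoc[OF X] left_module.smult_one[OF X] aclosed zclosed lz
  let ?D = "direct_sum J X"
  have fin: "finite {j \<in> J. f j \<noteq> \<zero>\<^bsub>X j\<^esub>}" "f j \<in> carrier (X j)" if "f \<in> carrier ?D" "j \<in> J" for f j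
    using that by (auto simp: Pi_iff PiE_def)
  have add: "f \<oplus>\<^bsub>?D\<^esub> g \<in> carrier ?D" if "f \<in> carrier ?D" "g \<in> carrier ?D" for f g
  proof -
    have "{j \<in> J. f j \<oplus>\<^bsub>X j\<^esub> g j \<noteq> \<zero>\<^bsub>X j\<^esub>} \<subseteq> {j \<in> J. f j \<noteq> \<zero>\<^bsub>X j\<^esub>} \<union> {j \<in> J. g j \<noteq> \<zero>\<^bsub>X j\<^esub>}"
      by auto
    then have "finite {j \<in> J. f j \<oplus>\<^bsub>X j\<^esub> g j \<noteq> \<zero>\<^bsub>X j\<^esub>}"
      using that by (auto intro: finite_subset)
    then show ?thesis using that by (auto simp: PiE_def Pi_iff cong: conj_cong)
  qed
  have smult: "r \<odot>\<^bsub>?D\<^esub> f \<in> carrier ?D" if "r \<in> carrier A" "f \<in> carrier ?D" for r f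
  proof -
    have "{j \<in> J. r \<odot>\<^bsub>X j\<^esub> f j \<noteq> \<zero>\<^bsub>X j\<^esub>} \<subseteq> {j \<in> J. f j \<noteq> \<zero>\<^bsub>X j\<^esub>}"
      using lmod.act_zero[OF lX that(1)] by auto
    then have "finite {j \<in> J. r \<odot>\<^bsub>X j\<^esub> f j \<noteq> \<zero>\<^bsub>X j\<^esub>}"
      using that by (auto intro: finite_subset)
    then show ?thesis using that by (auto simp: PiE_def Pi_iff cong: conj_cong)
  qed
  have neg: "\<exists>g\<in>carrier ?D. g \<oplus>\<^bsub>?D\<^esub> f = \<zero>\<^bsub>?D\<^esub>" if f: "f \<in> carrier ?D" for f
  proof
    let ?g = "\<lambda>j\<in>J. \<ominus>\<^bsub>X j\<^esub> f j"
    have "{j \<in> J. \<ominus>\<^bsub>X j\<^esub> f j \<noteq> \<zero>\<^bsub>X j\<^esub>} \<subseteq> {j \<in> J. f j \<noteq> \<zero>\<^bsub>X j\<^esub>}"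
      using abelian_group.minus_equality[OF aX] lz zclosed by auto
    then have "finite {j \<in> J. \<ominus>\<^bsub>X j\<^esub> f j \<noteq> \<zero>\<^bsub>X j\<^esub>}"
      using f by (auto intro: finite_subset)
    then show "?g \<in> carrier ?D" using f abelian_group.a_inv_closed[OF aX]
      by (auto simp: PiE_def Pi_iff cong: conj_cong)
    show "?g \<oplus>\<^bsub>?D\<^esub> f = \<zero>\<^bsub>?D\<^esub>"
      using f abelian_group.l_neg[OF aX] by (auto simp: fun_eq_iff)
  qed
  show ?thesis
  proof (rule left_moduleI)
    show "ring A" using A by (simp add: complex_algebra_def)
    show "abelian_group ?D"
    proof (rule abelian_groupI)
      show "\<zero>\<^bsub>?D\<^esub> \<in> carrier ?D" by (auto simp: cong: conj_cong)
      show "\<zero>\<^bsub>?D\<^esub> \<oplus>\<^bsub>?D\<^esub> f = f" if "f \<in> carrier ?D" for f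
        by (rule ext) (use that in \<open>auto simp: fin(2)[OF that] dest: PiE_arb[of f J]\<close>)
      show "(f \<oplus>\<^bsub>?D\<^esub> g) \<oplus>\<^bsub>?D\<^esub> h = f \<oplus>\<^bsub>?D\<^esub> (g \<oplus>\<^bsub>?D\<^esub> h)"
        if "f \<in> carrier ?D" "g \<in> carrier ?D" "h \<in> carrier ?D" for f g h
        by (rule ext) (simp add: abelian_groupE(3)[OF aX] fin(2)[OF that(1)] fin(2)[OF that(2)] fin(2)[OF that(3)])
      show "f \<oplus>\<^bsub>?D\<^esub> g = g \<oplus>\<^bsub>?D\<^esub> f" if "f \<in> carrier ?D" "g \<in> carrier ?D" for f g
        by (rule ext) (simp add: abelian_groupE(4)[OF aX fin(2)[OF that(1)] fin(2)[OF that(2)]])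
      show "f \<oplus>\<^bsub>?D\<^esub> g \<in> carrier ?D" if "f \<in> carrier ?D" "g \<in> carrier ?D" for f g
        by (rule add[OF that])
      show "\<exists>g\<in>carrier ?D. g \<oplus>\<^bsub>?D\<^esub> f = \<zero>\<^bsub>?D\<^esub>" if "f \<in> carrier ?D" for f
        by (rule neg[OF that])
    qed
    show "\<one>\<^bsub>A\<^esub> \<odot>\<^bsub>?D\<^esub> f = f" if "f \<in> carrier ?D" for f
      by (rule ext) (use that in \<open>auto simp: fin(2)[OF that] dest: PiE_arb[of f J]\<close>)
    show "(r \<oplus>\<^bsub>A\<^esub> s) \<odot>\<^bsub>?D\<^esub> f = r \<odot>\<^bsub>?D\<^esub> f \<oplus>\<^bsub>?D\<^esub> s \<odot>\<^bsub>?D\<^esub> f"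
      "(r \<otimes>\<^bsub>A\<^esub> s) \<odot>\<^bsub>?D\<^esub> f = r \<odot>\<^bsub>?D\<^esub> (s \<odot>\<^bsub>?D\<^esub> f)"
      if "r \<in> carrier A" "s \<in> carrier A" "f \<in> carrier ?D" for r s f
      by (rule ext, simp add: that(1,2) fin(2)[OF that(3)])+
    show "r \<odot>\<^bsub>?D\<^esub> (f \<oplus>\<^bsub>?D\<^esub> g) = r \<odot>\<^bsub>?D\<^esub> f \<oplus>\<^bsub>?D\<^esub> r \<odot>\<^bsub>?D\<^esub> g"
      if "r \<in> carrier A" "f \<in> carrier ?D" "g \<in> carrier ?D" for r f g
      by (rule ext) (simp add: that(1) fin(2)[OF that(2)] fin(2)[OF that(3)])
    show "r \<odot>\<^bsub>?D\<^esub> f \<in> carrier ?D" if "r \<in> carrier A" "f \<in> carrier ?D" for r f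
      by (rule smult[OF that])
  qed
qed

lemma mod_homD:
  assumes "f \<in> mod_hom A M N"
  shows "x \<in> carrier M \<Longrightarrow> f x \<in> carrier N"
    "\<lbrakk>x \<in> carrier M; y \<in> carrier M\<rbrakk> \<Longrightarrow> f (x \<oplus>\<^bsub>M\<^esub> y) = f x \<oplus>\<^bsub>N\<^esub> f y"
    "\<lbrakk>r \<in> carrier A; x \<in> carrier M\<rbrakk> \<Longrightarrow> f (r \<odot>\<^bsub>M\<^esub> x) = r \<odot>\<^bsub>N\<^esub> f x"
    "x \<notin> carrier M \<Longrightarrow> f x = undefined"
  using assms by (simp_all add: mod_hom_def PiE_iff extensional_def)

lemma mod_homI:
  assumes "\<And>x. x \<in> carrier M \<Longrightarrow> f x \<in> carrier N"
    "\<And>x y. \<lbrakk>x \<in> carrier M; y \<in> carrier M\<rbrakk> \<Longrightarrow> f (x \<oplus>\<^bsub>M\<^esub> y) = f x \<oplus>\<^bsub>N\<^esub> f y"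
    "\<And>r x. \<lbrakk>r \<in> carrier A; x \<in> carrier M\<rbrakk> \<Longrightarrow> f (r \<odot>\<^bsub>M\<^esub> x) = r \<odot>\<^bsub>N\<^esub> f x"
    "\<And>x. x \<notin> carrier M \<Longrightarrow> f x = undefined"
  shows "f \<in> mod_hom A M N"
  by (simp add: mod_hom_def PiE_iff extensional_def assms)

lemma mod_isoD: "f \<in> mod_iso A M N \<Longrightarrow> f \<in> mod_hom A M N" "f \<in> mod_iso A M N \<Longrightarrow> bij_betw f (carrier M) (carrier N)"
  by (auto simp: mod_iso_def)

lemma isomorphic_modI: "f \<in> mod_hom A M N \<Longrightarrow> bij_betw f (carrier M) (carrier N) \<Longrightarrow> isomorphic_mod A M N"
  unfolding isomorphic_mod_def mod_iso_def by blast

lemma isomorphic_modI': "f \<in> mod_iso A M N \<Longrightarrow> isomorphic_mod A M N"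
  unfolding isomorphic_mod_def by blast

lemma mod_hom_csmult:
  assumes "lmod A M" "f \<in> mod_hom A M N" "x \<in> carrier M"
  shows "f (c \<odot>\<^bsub>cspace A M\<^esub> x) = c \<odot>\<^bsub>cspace A N\<^esub> f x"
  using mod_homD(3)[OF assms(2) lmod.one_smult_closed[OF assms(1)] assms(3)] by (simp add: cspace_def)

lemma mod_hom_zero:
  assumes "lmod A M" "lmod A N" "f \<in> mod_hom A M N"
  shows "f \<zero>\<^bsub>M\<^esub> = \<zero>\<^bsub>N\<^esub>"
proof -
  interpret M: lmod A M by fact
  interpret N: lmod A N by fact
  have "f (0 \<odot>\<^bsub>cspace A M\<^esub> \<zero>\<^bsub>M\<^esub>) = 0 \<odot>\<^bsub>cspace A N\<^esub> f \<zero>\<^bsub>M\<^esub>"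
    by (rule mod_hom_csmult[OF assms(1,3) M.M.zero_closed])
  moreover have "0 \<odot>\<^bsub>cspace A M\<^esub> \<zero>\<^bsub>M\<^esub> = \<zero>\<^bsub>M\<^esub>" using M.V.smult_zero[of "\<zero>\<^bsub>M\<^esub>"] by simp
  moreover have "f \<zero>\<^bsub>M\<^esub> \<in> carrier N" by (rule mod_homD(1)[OF assms(3) M.M.zero_closed])
  then have "0 \<odot>\<^bsub>cspace A N\<^esub> f \<zero>\<^bsub>M\<^esub> = \<zero>\<^bsub>N\<^esub>" using N.V.smult_zero[of "f \<zero>\<^bsub>M\<^esub>"] by simp
  ultimately show ?thesis by metis
qed

lemma mod_hom_compose:
  assumes "f \<in> mod_hom A L M" "g \<in> mod_hom A M N" "left_module A L"
  shows "compose (carrier L) g f \<in> mod_hom A L N"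
proof -
  interpret left_module A L by fact
  show ?thesis
    by (intro mod_homI)
      (simp_all add: compose_def mod_homD[OF assms(1)] mod_homD[OF assms(2)] smult_closed)
qed

lemma mod_iso_compose:
  assumes "f \<in> mod_iso A L M" "g \<in> mod_iso A M N" "left_module A L"
  shows "compose (carrier L) g f \<in> mod_iso A L N"
proof -
  have "bij_betw (g \<circ> f) (carrier L) (carrier N)"
    by (rule bij_betw_trans[OF mod_isoD(2)[OF assms(1)] mod_isoD(2)[OF assms(2)]])
  then have "bij_betw (compose (carrier L) g f) (carrier L) (carrier N)"
    by (subst bij_betw_cong[of _ _ "g \<circ> f"]) (simp_all add: compose_def)
  then show ?thesis
    using mod_hom_compose[OF mod_isoD(1)[OF assms(1)] mod_isoD(1)[OF assms(2)] assms(3)]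
    by (simp add: mod_iso_def)
qed

lemma mod_iso_inv:
  assumes f: "f \<in> mod_iso A M N" and M: "left_module A M" and N: "left_module A N"
  shows "(\<lambda>y\<in>carrier N. inv_into (carrier M) f y) \<in> mod_iso A N M"
proof -
  interpret M: left_module A M by fact
  interpret N: left_module A N by fact
  have hom: "f \<in> mod_hom A M N" and bij: "bij_betw f (carrier M) (carrier N)"
    using f by (auto simp: mod_iso_def)
  let ?i = "inv_into (carrier M) f"
  have inv: "?i (f x) = x" if "x \<in> carrier M" for x
    using bij that by (auto simp: bij_betw_def)
  have ex: "\<exists>x\<in>carrier M. y = f x" if "y \<in> carrier N" for y
    using bij that by (auto simp: bij_betw_def)
  have "(\<lambda>y\<in>carrier N. ?i y) \<in> mod_hom A N M"
  proof (rule mod_homI)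
    fix x y assume "x \<in> carrier N" "y \<in> carrier N"
    then obtain x' y' where "x' \<in> carrier M" "y' \<in> carrier M" "x = f x'" "y = f y'" using ex by metis
    then show "restrict ?i (carrier N) (x \<oplus>\<^bsub>N\<^esub> y) = restrict ?i (carrier N) x \<oplus>\<^bsub>M\<^esub> restrict ?i (carrier N) y"
      by (simp add: mod_homD(1)[OF hom] inv mod_homD(2)[OF hom, symmetric])
  next
    fix r y assume r: "r \<in> carrier A" and "y \<in> carrier N"
    then obtain y' where "y' \<in> carrier M" "y = f y'" using ex by metis
    with r show "restrict ?i (carrier N) (r \<odot>\<^bsub>N\<^esub> y) = r \<odot>\<^bsub>M\<^esub> restrict ?i (carrier N) y"
      by (simp add: mod_homD(1)[OF hom] inv mod_homD(3)[OF hom, symmetric] M.smult_closed)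
  next
    fix y assume "y \<in> carrier N"
    then obtain y' where "y' \<in> carrier M" "y = f y'" using ex by metis
    then show "restrict ?i (carrier N) y \<in> carrier M" by (simp add: mod_homD(1)[OF hom] inv)
  qed simp
  moreover have "bij_betw (restrict ?i (carrier N)) (carrier N) (carrier M)"
    using bij_betw_inv_into[OF bij] by (simp add: bij_betw_def)
  ultimately show ?thesis by (simp add: mod_iso_def)
qed

lemma isomorphic_mod_sym:
  "isomorphic_mod A M N \<Longrightarrow> left_module A M \<Longrightarrow> left_module A N \<Longrightarrow> isomorphic_mod A N M"
  unfolding isomorphic_mod_def using mod_iso_inv by blast

lemma isomorphic_mod_trans:
  "isomorphic_mod A L M \<Longrightarrow> isomorphic_mod A M N \<Longrightarrow> left_module A L \<Longrightarrow> isomorphic_mod A L N"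
  unfolding isomorphic_mod_def using mod_iso_compose by blast

lemma isomorphic_mod_dsum:
  assumes "isomorphic_mod A M M'" "isomorphic_mod A N N'" "left_module A M" "left_module A N"
  shows "isomorphic_mod A (dsum M N) (dsum M' N')"
proof -
  interpret M: left_module A M by fact
  interpret N: left_module A N by fact
  obtain f g where f: "f \<in> mod_iso A M M'" and g: "g \<in> mod_iso A N N'"
    using assms by (auto simp: isomorphic_mod_def)
  let ?h = "\<lambda>p\<in>carrier M \<times> carrier N. map_prod f g p"
  note f' = mod_homD[OF mod_isoD(1)[OF f]] and g' = mod_homD[OF mod_isoD(1)[OF g]]
  have "?h \<in> mod_hom A (dsum M N) (dsum M' N')"
    by (intro mod_homI) (auto simp: f' g' M.smult_closed N.smult_closed)
  moreover have "bij_betw ?h (carrier (dsum M N)) (carrier (dsum M' N'))"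
    using bij_betw_map_prod[OF mod_isoD(2)[OF f] mod_isoD(2)[OF g]]
    by (subst bij_betw_cong[of _ _ "map_prod f g"]) simp_all
  ultimately show ?thesis by (rule isomorphic_modI)
qed

lemma functional_pullback:
  assumes "lmod A M" "f \<in> mod_hom A M N" "functional (cspace A N) \<phi>"
  shows "functional (cspace A M) (\<lambda>x. \<phi> (f x))"
  unfolding functional_def
proof (intro conjI ballI allI)
  fix x y assume "x \<in> carrier (cspace A M)" "y \<in> carrier (cspace A M)"
  then show "\<phi> (f (x \<oplus>\<^bsub>cspace A M\<^esub> y)) = \<phi> (f x) + \<phi> (f y)"
    using functionalD(1)[OF assms(3), of "f x" "f y"] by (simp add: mod_homD[OF assms(2)])
next
  fix c x assume "x \<in> carrier (cspace A M)"
  then show "\<phi> (f (c \<odot>\<^bsub>cspace A M\<^esub> x)) = c * \<phi> (f x)"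
    using functionalD(2)[OF assms(3), of "f x"] by (simp add: mod_homD[OF assms(2)] mod_hom_csmult[OF assms(1,2)])
qed

lemma bounded_coords_pullback:
  assumes "lmod A M" "f \<in> mod_hom A M N" "inj_on f (carrier M)" "bounded_coords (cspace A N) n \<kappa>"
  shows "bounded_coords (cspace A M) n (\<lambda>x. \<kappa> (f x))"
proof -
  have "inj_on (\<lambda>x. \<kappa> (f x)) (carrier M)"
    using assms(3,4) mod_homD(1)[OF assms(2)] by (simp add: bounded_coords_def inj_on_def)
  moreover have "functional (cspace A M) (\<lambda>x. \<kappa> (f x) i)" for i
    by (rule functional_pullback[OF assms(1,2)]) (use assms(4) in \<open>simp add: bounded_coords_def\<close>)
  ultimately show ?thesis
    using assms(4) mod_homD(1)[OF assms(2)] by (simp add: bounded_coords_def)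
qed

text \<open>Every use of finite dimension below goes through coordinates.\<close>

lemma fd_module_iff:
  assumes "complex_algebra A"
  shows "fd_module A M \<longleftrightarrow> left_module A M \<and> (\<exists>n \<kappa>. bounded_coords (cspace A M) n \<kappa>)"
proof (cases "left_module A M")
  case True
  then interpret lmod A M using assms by (simp add: lmod_def)
  show ?thesis
    using True V.bounded_coords_imp_basis
    by (auto simp: fd_module_def elim!: V.basis_imp_bounded_coords)
qed (simp add: fd_module_def)

lemma fd_module_mono:
  assumes "complex_algebra A" "fd_module A N" "left_module A M" "f \<in> mod_hom A M N" "inj_on f (carrier M)"
  shows "fd_module A M"
proof -
  obtain n \<kappa> where "bounded_coords (cspace A N) n \<kappa>" using fd_module_iff[OF assms(1)] assms(2) by blast
  then have "bounded_coords (cspace A M) n (\<lambda>x. \<kappa> (f x))"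
    using bounded_coords_pullback[OF _ assms(4,5)] assms(1,3) by (simp add: lmod_def)
  then show ?thesis using assms(3) fd_module_iff[OF assms(1)] by blast
qed

lemma fd_module_isomorphic:
  assumes "complex_algebra A" "fd_module A N" "left_module A M" "isomorphic_mod A M N"
  shows "fd_module A M"
proof -
  obtain f where "f \<in> mod_iso A M N" using assms(4) by (auto simp: isomorphic_mod_def)
  then show ?thesis
    using fd_module_mono[OF assms(1-3), of f] by (simp add: mod_iso_def bij_betw_def)
qed

lemma bounded_coords_dsum:
  assumes "bounded_coords (cspace A M) n \<kappa>" "bounded_coords (cspace A N) m \<kappa>'"
  shows "bounded_coords (cspace A (dsum M N)) (n + m) (\<lambda>p i. if i < n then \<kappa> (fst p) i else \<kappa>' (snd p) (i - n))"
proof -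
  let ?k = "\<lambda>p i. if i < n then \<kappa> (fst p) i else \<kappa>' (snd p) (i - n)"
  have cs: "c \<odot>\<^bsub>cspace A (dsum M N)\<^esub> (x, y) = (c \<odot>\<^bsub>cspace A M\<^esub> x, c \<odot>\<^bsub>cspace A N\<^esub> y)" for c x y
    by (simp add: cspace_def)
  note f = functionalD[of "cspace A M" "\<lambda>x. \<kappa> x i" for i] functionalD[of "cspace A N" "\<lambda>x. \<kappa>' x i" for i]
  have "functional (cspace A (dsum M N)) (\<lambda>x. ?k x i)" for i
    unfolding functional_def using assms by (auto simp: bounded_coords_def cs f[simplified])
  moreover have "inj_on ?k (carrier M \<times> carrier N)"
  proof (rule inj_onI, clarify)
    fix x y x' y'
    assume c: "x \<in> carrier M" "x' \<in> carrier M" "y \<in> carrier N" "y' \<in> carrier N"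
      and eq: "?k (x, y) = ?k (x', y')"
    have "\<kappa> x i = \<kappa> x' i" for i
      using fun_cong[OF eq, of i] c assms by (cases "i < n") (auto simp: bounded_coords_def)
    moreover have "\<kappa>' y i = \<kappa>' y' i" for i using fun_cong[OF eq, of "n + i"] by simp
    ultimately show "x = x' \<and> y = y'"
      using c assms by (auto simp: bounded_coords_def inj_on_def fun_eq_iff)
  qed
  ultimately show ?thesis using assms by (auto simp: bounded_coords_def)
qed

lemma fd_module_dsum:
  assumes "complex_algebra A" "fd_module A M" "fd_module A N"
  shows "fd_module A (dsum M N)"
proof -
  obtain n \<kappa> m \<kappa>' where "bounded_coords (cspace A M) n \<kappa>" "bounded_coords (cspace A N) m \<kappa>'"
    using assms(2,3) unfolding fd_module_iff[OF assms(1)] by blast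
  from bounded_coords_dsum[OF this] show ?thesis
    using assms(2,3) left_module_dsum[of A M N] unfolding fd_module_iff[OF assms(1)] by blast
qed

text \<open>Modules live on a fixed carrier type, so direct sums and the regular module have to be moved along
  an injection of their carriers into that type.\<close>

definition transport_mod :: "('m \<Rightarrow> 'n) \<Rightarrow> ('a, 'm) module \<Rightarrow> ('a, 'n) module" where
  "transport_mod h M = (let g = inv_into (carrier M) h in
     \<lparr>carrier = h ` carrier M, monoid.mult = undefined, one = undefined, ring.zero = h \<zero>\<^bsub>M\<^esub>,
      add = (\<lambda>x y. h (g x \<oplus>\<^bsub>M\<^esub> g y)), smult = (\<lambda>r x. h (r \<odot>\<^bsub>M\<^esub> g x))\<rparr>)"

lemma transport_mod:
  assumes M: "left_module A M" and h: "inj_on h (carrier M)"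
  shows "left_module A (transport_mod h M)" and "isomorphic_mod A M (transport_mod h M)"
    and "carrier (transport_mod h M) = h ` carrier M"
proof -
  interpret M: left_module A M by fact
  let ?T = "transport_mod h M"
  have [simp]: "carrier ?T = h ` carrier M" "\<zero>\<^bsub>?T\<^esub> = h \<zero>\<^bsub>M\<^esub>"
    by (simp_all add: transport_mod_def Let_def)
  then show "carrier ?T = h ` carrier M" by simp
  have [simp]: "h x \<oplus>\<^bsub>?T\<^esub> h y = h (x \<oplus>\<^bsub>M\<^esub> y)" if "x \<in> carrier M" "y \<in> carrier M" for x y
    using h that by (simp_all add: transport_mod_def Let_def)
  have s [simp]: "r \<odot>\<^bsub>?T\<^esub> h x = h (r \<odot>\<^bsub>M\<^esub> x)" if "x \<in> carrier M" for x r
    using h that by (simp_all add: transport_mod_def Let_def)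
  show T: "left_module A ?T"
  proof (rule left_moduleI)
    show "abelian_group ?T"
    proof (rule abelian_groupI)
      show "\<exists>y\<in>carrier ?T. y \<oplus>\<^bsub>?T\<^esub> x = \<zero>\<^bsub>?T\<^esub>" if x: "x \<in> carrier ?T" for x
      proof -
        obtain x' where "x' \<in> carrier M" "x = h x'" using x by auto
        then show ?thesis by (intro bexI[of _ "h (\<ominus>\<^bsub>M\<^esub> x')"]) (simp_all add: M.M.l_neg)
      qed
    qed (auto simp: M.M.a_ac)
  qed (auto simp: M.smult_closed M.smult_l_distr M.smult_r_distr M.smult_assoc M.smult_one M.ring_axioms)
  have "restrict h (carrier M) \<in> mod_hom A M ?T"
    by (rule mod_homI) (simp_all add: M.smult_closed)
  moreover have "bij_betw (restrict h (carrier M)) (carrier M) (carrier ?T)"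
    using h by (simp add: bij_betw_def)
  ultimately show "isomorphic_mod A M ?T" by (rule isomorphic_modI)
qed

section \<open>Decomposition into indecomposable modules\<close>

lemma direct_sum_split:
  assumes A: "complex_algebra A" "\<And>j. j \<in> J \<Longrightarrow> left_module A (X j)"
    and J: "finite J" "J = i ` I \<union> k ` K" "i ` I \<inter> k ` K = {}" "inj_on i I" "inj_on k K"
    and XY: "\<And>j. j \<in> I \<Longrightarrow> X (i j) = Y j" "\<And>j. j \<in> K \<Longrightarrow> X (k j) = Z j"
  shows "isomorphic_mod A (direct_sum J X) (dsum (direct_sum I Y) (direct_sum K Z))"
proof -
  let ?D = "direct_sum J X" and ?E = "dsum (direct_sum I Y) (direct_sum K Z)"
  interpret D: left_module A ?D using A by (rule left_module_direct_sum)
  have fin: "finite {j \<in> J. Q j}" "finite {j \<in> I. Q' j}" "finite {j \<in> K. Q'' j}" for Q Q' Q''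
    using J by (auto simp: finite_image_iff)
  have cD: "carrier ?D = (\<Pi>\<^sub>E j\<in>J. carrier (X j))"
    and cE: "carrier ?E = (\<Pi>\<^sub>E j\<in>I. carrier (Y j)) \<times> (\<Pi>\<^sub>E j\<in>K. carrier (Z j))"
    by (auto simp: fin)
  have iJ: "i j \<in> J" if "j \<in> I" for j using J that by auto
  have kJ: "k j \<in> J" if "j \<in> K" for j using J that by auto
  let ?h = "\<lambda>f\<in>carrier ?D. (\<lambda>j\<in>I. f (i j), \<lambda>j\<in>K. f (k j))"
  have hom: "?h \<in> mod_hom A ?D ?E"
  proof (rule mod_homI)
    fix f g assume fg: "f \<in> carrier ?D" "g \<in> carrier ?D"
    show "?h f \<in> carrier ?E"
      using fg iJ kJ XY unfolding cD cE by (fastforce simp: PiE_iff)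
    show "?h (f \<oplus>\<^bsub>?D\<^esub> g) = ?h f \<oplus>\<^bsub>?E\<^esub> ?h g"
      unfolding restrict_apply'[OF D.a_closed[OF fg]] restrict_apply'[OF fg(1)] restrict_apply'[OF fg(2)]
      using iJ kJ XY by (simp add: fun_eq_iff)
  next
    fix r f assume rf: "r \<in> carrier A" "f \<in> carrier ?D"
    show "?h (r \<odot>\<^bsub>?D\<^esub> f) = r \<odot>\<^bsub>?E\<^esub> ?h f"
      unfolding restrict_apply'[OF D.smult_closed[OF rf]] restrict_apply'[OF rf(2)]
      using iJ kJ XY by (simp add: fun_eq_iff)
  qed auto
  have "bij_betw ?h (carrier ?D) (carrier ?E)"
  proof (rule bij_betwI')
    fix f g assume fg: "f \<in> carrier ?D" "g \<in> carrier ?D"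
    have "f = g" if eq: "?h f = ?h g"
    proof (rule PiE_ext)
      show "f \<in> (\<Pi>\<^sub>E j\<in>J. carrier (X j))" "g \<in> (\<Pi>\<^sub>E j\<in>J. carrier (X j))" using fg cD by auto
      fix j assume "j \<in> J"
      have "(\<lambda>j\<in>I. f (i j)) = (\<lambda>j\<in>I. g (i j))" "(\<lambda>j\<in>K. f (k j)) = (\<lambda>j\<in>K. g (k j))"
        using eq fg by (simp_all del: direct_sum_simps)
      then have "f (i j) = g (i j)" if "j \<in> I" for j using that by (metis restrict_apply')
      moreover have "f (k j) = g (k j)" if "j \<in> K" for j
        using that \<open>(\<lambda>j\<in>K. f (k j)) = (\<lambda>j\<in>K. g (k j))\<close> by (metis restrict_apply')
      ultimately show "f j = g j" using \<open>j \<in> J\<close> J(2) by auto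
    qed
    then show "(?h f = ?h g) = (f = g)" by (intro iffI arg_cong[where f = ?h])
  next
    fix f assume "f \<in> carrier ?D"
    then show "?h f \<in> carrier ?E" using mod_homD(1)[OF hom] by blast
  next
    fix p assume "p \<in> carrier ?E"
    then obtain f g where p: "p = (f, g)" and f: "f \<in> (\<Pi>\<^sub>E j\<in>I. carrier (Y j))" and g: "g \<in> (\<Pi>\<^sub>E j\<in>K. carrier (Z j))"
      unfolding cE by auto
    define u where "u = (\<lambda>j\<in>J. if j \<in> i ` I then f (inv_into I i j) else g (inv_into K k j))"
    have ui: "u (i j) = f j" if "j \<in> I" for j using that iJ J(4) by (auto simp: u_def)
    have uk: "u (k j) = g j" if "j \<in> K" for j using that kJ J(3,5) by (auto simp: u_def)
    have "u j \<in> carrier (X j)" if "j \<in> J" for j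
      using that f g ui uk XY unfolding J(2) by (auto simp: PiE_iff)
    then have "u \<in> (\<Pi>\<^sub>E j\<in>J. carrier (X j))" by (auto simp: u_def)
    moreover have "(\<lambda>j\<in>I. u (i j)) = f" "(\<lambda>j\<in>K. u (k j)) = g"
      using f g ui uk by (auto simp: fun_eq_iff PiE_iff extensional_def)
    ultimately show "\<exists>u\<in>carrier ?D. p = ?h u"
      unfolding cD by (intro bexI[of _ u]) (auto simp: p)
  qed
  then show ?thesis by (rule isomorphic_modI[OF hom])
qed

lemma direct_sum_singleton:
  assumes "left_module A (X j)"
  shows "isomorphic_mod A (X j) (direct_sum {j} X)"
proof -
  interpret left_module A "X j" by fact
  let ?h = "\<lambda>x\<in>carrier (X j). (\<lambda>i\<in>{j}. x)"
  have "?h \<in> mod_hom A (X j) (direct_sum {j} X)"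
    by (intro mod_homI) (auto simp: smult_closed fun_eq_iff)
  moreover have "bij_betw ?h (carrier (X j)) (carrier (direct_sum {j} X))"
  proof (rule bij_betwI')
    fix f assume f: "f \<in> carrier (direct_sum {j} X)"
    then have "f = (\<lambda>i\<in>{j}. f j)" by (auto simp: fun_eq_iff PiE_iff extensional_def)
    then show "\<exists>x\<in>carrier (X j). f = ?h x" using f by (intro bexI[of _ "f j"]) (auto simp: PiE_iff)
  next
    fix x y assume "x \<in> carrier (X j)" "y \<in> carrier (X j)"
    then show "(?h x = ?h y) = (x = y)" by (auto dest: fun_cong[of _ _ j])
  qed auto
  ultimately show ?thesis by (rule isomorphic_modI)
qed

lemma direct_sum_empty:
  assumes "left_module A M" "carrier M = {\<zero>\<^bsub>M\<^esub>}"
  shows "isomorphic_mod A M (direct_sum {} X)"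
proof -
  interpret left_module A M by fact
  have "(\<lambda>x\<in>carrier M. \<lambda>j. undefined) \<in> mod_iso A M (direct_sum {} X)"
    using smult_closed assms(2) by (auto simp: mod_iso_def bij_betw_def intro!: mod_homI)
  then show ?thesis by (rule isomorphic_modI')
qed

abbreviation copies :: "('a, 'm) module set \<Rightarrow> (('a, 'm) module \<Rightarrow> nat) \<Rightarrow>
    ('a, ('a, 'm) module \<times> nat \<Rightarrow> 'm) module" where
  "copies S m \<equiv> direct_sum {(X, r). X \<in> S \<and> 1 \<le> r \<and> r \<le> m X} (\<lambda>(X, r :: nat). X)"

lemma finite_copies_index:
  assumes "finite {X \<in> S. m X \<noteq> 0}"
  shows "finite {(X, r :: nat). X \<in> S \<and> 1 \<le> r \<and> r \<le> m X}"
proof (rule finite_subset)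
  show "{(X, r :: nat). X \<in> S \<and> 1 \<le> r \<and> r \<le> m X} \<subseteq> (SIGMA X:{X \<in> S. m X \<noteq> 0}. {..m X})" by auto
qed (use assms in auto)

lemma copies_add:
  assumes A: "complex_algebra A" "\<And>X. X \<in> S \<Longrightarrow> left_module A X"
    and fin: "finite {X \<in> S. m X \<noteq> 0}" "finite {X \<in> S. m' X \<noteq> 0}"
    and L: "left_module A L" "left_module A M" "left_module A N" "isomorphic_mod A L (dsum M N)"
    and iso: "isomorphic_mod A M (copies S m)" "isomorphic_mod A N (copies S m')"
  shows "isomorphic_mod A L (copies S (\<lambda>X. m X + m' X))"
    and "finite {X \<in> S. m X + m' X \<noteq> 0}"
proof -
  show fin': "finite {X \<in> S. m X + m' X \<noteq> 0}"
    by (rule finite_subset[OF _ finite_UnI[OF fin]]) auto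
  have split: "isomorphic_mod A (copies S (\<lambda>X. m X + m' X)) (dsum (copies S m) (copies S m'))"
  proof (rule direct_sum_split[where i = id and k = "\<lambda>(X, r). (X, m X + r)", OF A(1)])
    show "{(X, r :: nat). X \<in> S \<and> 1 \<le> r \<and> r \<le> m X + m' X} =
        id ` {(X, r). X \<in> S \<and> 1 \<le> r \<and> r \<le> m X} \<union>
        (\<lambda>(X, r). (X, m X + r)) ` {(X, r). X \<in> S \<and> 1 \<le> r \<and> r \<le> m' X}" (is "?J = ?I \<union> ?K")
    proof
      show "?J \<subseteq> ?I \<union> ?K"
      proof clarify
        fix X r assume *: "X \<in> S" "1 \<le> r" "r \<le> m X + m' X" "(X, r) \<notin> ?K"
        have "(X, r) \<in> ?K" if "r > m X"
          using that * by (intro image_eqI[of _ _ "(X, r - m X)"]) auto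
        then show "(X, r) \<in> ?I" using * by force
      qed
    qed auto
  qed (use A(2) finite_copies_index[OF fin'] in \<open>auto simp: inj_on_def\<close>)
  have lm: "left_module A (copies S n)" for n
    by (rule left_module_direct_sum[OF A(1)]) (use A(2) in auto)
  note isomorphic_mod_trans[OF L(4) isomorphic_mod_dsum[OF iso L(2,3)] L(1)]
  from isomorphic_mod_trans[OF this isomorphic_mod_sym[OF split lm left_module_dsum[OF lm lm]] L(1)]
  show "isomorphic_mod A L (copies S (\<lambda>X. m X + m' X))" .
qed

lemma copies_single:
  assumes "X \<in> S" "left_module A X"
  shows "isomorphic_mod A X (copies S (\<lambda>Y. if Y = X then 1 else 0))"
proof -
  have "{(Y, r :: nat). Y \<in> S \<and> 1 \<le> r \<and> r \<le> (if Y = X then 1 else 0)} = {(X, 1)}"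
    using assms by (auto split: if_splits)
  then show ?thesis using direct_sum_singleton[of A "\<lambda>(X, r). X" "(X, 1 :: nat)"] assms by simp
qed

lemma copies_zero:
  assumes "left_module A M" "carrier M = {\<zero>\<^bsub>M\<^esub>}"
  shows "isomorphic_mod A M (copies S (\<lambda>Y. 0))"
proof -
  have "{(Y, r :: nat). Y \<in> S \<and> 1 \<le> r \<and> r \<le> 0} = {}" by auto
  then show ?thesis using direct_sum_empty[OF assms, of "\<lambda>(X, r). X"] by (simp only:)
qed

text \<open>Gaussian elimination: a submodule that meets the line spanned by \<open>v\<close> only in zero needs one
  coordinate less, because a coordinate that does not vanish at \<open>v\<close> can be cleared.\<close>

lemma bounded_coords_drop:
  assumes L: "lmod A L" and M: "lmod A M" and \<alpha>: "\<alpha> \<in> mod_hom A L M" and v: "v \<in> carrier M" "v \<noteq> \<zero>\<^bsub>M\<^esub>"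
    and disj: "\<And>x c. x \<in> carrier L \<Longrightarrow> \<alpha> x = c \<odot>\<^bsub>cspace A M\<^esub> v \<Longrightarrow> x = \<zero>\<^bsub>L\<^esub>"
    and \<kappa>: "bounded_coords (cspace A M) N \<kappa>"
  shows "0 < N" "\<exists>\<kappa>'. bounded_coords (cspace A L) (N - 1) \<kappa>'"
proof -
  interpret L: lmod A L by fact
  interpret M: lmod A M by fact
  have lin: "functional (cspace A M) (\<lambda>x. \<kappa> x i)" and bd: "x \<in> carrier M \<Longrightarrow> i \<ge> N \<Longrightarrow> \<kappa> x i = 0" for x i
    using \<kappa> by (auto simp: bounded_coords_def)
  have inj: "x = y" if "x \<in> carrier M" "y \<in> carrier M" "\<And>i. \<kappa> x i = \<kappa> y i" for x y
    using \<kappa> that by (auto simp: bounded_coords_def inj_on_def fun_eq_iff)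
  obtain k where k: "\<kappa> v k \<noteq> 0"
    using inj[of v "\<zero>\<^bsub>M\<^esub>"] v M.V.functional_zero[OF lin] by auto
  then have kN: "k < N" using bd[OF v(1), of k] by (metis not_less)
  then show "0 < N" by simp
  note lin' = functionalD[OF lin, simplified] functionalD[OF functional_pullback[OF L \<alpha> lin], simplified]
  \<comment> \<open>\<open>\<kappa>0\<close> clears coordinate \<open>k\<close>, and \<open>\<pi>\<close> exchanges it with the last one.\<close>
  define \<kappa>0 where "\<kappa>0 x i = \<kappa> (\<alpha> x) i - \<kappa> (\<alpha> x) k / \<kappa> v k * \<kappa> v i" for x i
  define \<pi> where "\<pi> i = (if i = k then N - 1 else if i = N - 1 then k else i)" for i
  define \<kappa>' where "\<kappa>' x i = \<kappa>0 x (\<pi> i)" for x i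
  have "functional (cspace A L) (\<lambda>x. \<kappa>' x i)" for i
    by (auto simp: functional_def \<kappa>'_def \<kappa>0_def lin' algebra_simps add_divide_distrib)
  moreover have "inj_on \<kappa>' (carrier L)"
  proof
    fix x y assume xy: "x \<in> carrier L" "y \<in> carrier L" "\<kappa>' x = \<kappa>' y"
    define c where "c = (\<kappa> (\<alpha> x) k - \<kappa> (\<alpha> y) k) / \<kappa> v k"
    have "\<pi> (\<pi> i) = i" for i using kN by (auto simp: \<pi>_def)
    then have "\<kappa>0 x i = \<kappa>0 y i" for i
      using fun_cong[OF xy(3), of "\<pi> i"] by (simp add: \<kappa>'_def)
    then have e: "\<kappa> (\<alpha> x) i = \<kappa> (\<alpha> y) i + c * \<kappa> v i" for i
      by (auto simp: \<kappa>0_def c_def algebra_simps diff_divide_distrib dest: spec)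
    let ?d = "x \<oplus>\<^bsub>L\<^esub> (- 1) \<odot>\<^bsub>cspace A L\<^esub> y"
    have "\<alpha> ?d = c \<odot>\<^bsub>cspace A M\<^esub> v"
    proof (rule inj)
      fix i show "\<kappa> (\<alpha> ?d) i = \<kappa> (c \<odot>\<^bsub>cspace A M\<^esub> v) i"
        using e[of i] xy v by (simp add: lin')
    qed (use xy v mod_homD(1)[OF \<alpha>] in auto)
    then have "?d = \<zero>\<^bsub>L\<^esub>" using disj xy by auto
    then have "x \<oplus>\<^bsub>L\<^esub> \<ominus>\<^bsub>L\<^esub> y = \<zero>\<^bsub>L\<^esub>" using xy L.V.smult_minus_one[of y] by simp
    then have "\<ominus>\<^bsub>L\<^esub> (\<ominus>\<^bsub>L\<^esub> y) = x" using xy by (intro L.M.minus_equality) auto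
    then show "x = y" using xy by simp
  qed
  moreover have "\<kappa>' x i = 0" if "x \<in> carrier L" "i \<ge> N - 1" for x i
  proof -
    have z: "\<kappa>0 x k = 0" using k by (simp add: \<kappa>0_def)
    have "\<kappa>0 x i = 0" if "i \<ge> N" for i
      using bd[OF _ that] mod_homD(1)[OF \<alpha> \<open>x \<in> carrier L\<close>] v by (simp add: \<kappa>0_def)
    then show ?thesis using z that kN by (cases "i = N - 1") (auto simp: \<kappa>'_def \<pi>_def)
  qed
  ultimately show "\<exists>\<kappa>'. bounded_coords (cspace A L) (N - 1) \<kappa>'"
    by (auto simp: bounded_coords_def)
qed

text \<open>The induction measure for decomposing a module: a complement that is not zero costs a coordinate.\<close>

lemma bounded_coords_summand:
  assumes A: "complex_algebra A" and lm: "left_module A L" "left_module A M" "left_module A N"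
    and iso: "isomorphic_mod A L (dsum M N)" and N: "carrier N \<noteq> {\<zero>\<^bsub>N\<^esub>}"
    and \<kappa>: "bounded_coords (cspace A L) n \<kappa>"
  shows "\<exists>k<n. \<exists>\<kappa>'. bounded_coords (cspace A M) k \<kappa>'"
proof -
  interpret L: lmod A L using A lm by (simp add: lmod_def)
  interpret M: lmod A M using A lm by (simp add: lmod_def)
  interpret N: lmod A N using A lm by (simp add: lmod_def)
  have lD: "left_module A (dsum M N)" using lm left_module_dsum by blast
  then interpret D: lmod A "dsum M N" using A by (simp add: lmod_def)
  obtain h where h: "h \<in> mod_iso A (dsum M N) L"
    using isomorphic_mod_sym[OF iso lm(1) lD] by (auto simp: isomorphic_mod_def)
  note hom = mod_isoD(1)[OF h]
  have inj: "inj_on h (carrier (dsum M N))" using mod_isoD(2)[OF h] by (simp add: bij_betw_def)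
  obtain y where y: "y \<in> carrier N" "y \<noteq> \<zero>\<^bsub>N\<^esub>" using N N.M.zero_closed by blast
  have i: "(\<lambda>x\<in>carrier M. (x, \<zero>\<^bsub>N\<^esub>)) \<in> mod_hom A M (dsum M N)"
    by (intro mod_homI) auto
  let ?\<alpha> = "compose (carrier M) h (\<lambda>x\<in>carrier M. (x, \<zero>\<^bsub>N\<^esub>))"
  have \<alpha>: "?\<alpha> \<in> mod_hom A M L" by (rule mod_hom_compose[OF i hom lm(2)])
  have cs: "c \<odot>\<^bsub>cspace A (dsum M N)\<^esub> (x, y) = (c \<odot>\<^bsub>cspace A M\<^esub> x, c \<odot>\<^bsub>cspace A N\<^esub> y)" for c x y
    by (simp add: cspace_def)
  have v: "h (\<zero>\<^bsub>M\<^esub>, y) \<in> carrier L" using mod_homD(1)[OF hom] y by simp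
  have v0: "h (\<zero>\<^bsub>M\<^esub>, y) \<noteq> \<zero>\<^bsub>L\<^esub>"
    using inj_onD[OF inj, of "(\<zero>\<^bsub>M\<^esub>, y)" "(\<zero>\<^bsub>M\<^esub>, \<zero>\<^bsub>N\<^esub>)"] mod_hom_zero[OF D.lmod_axioms L.lmod_axioms hom] y by auto
  have disj: "x = \<zero>\<^bsub>M\<^esub>" if "x \<in> carrier M" "?\<alpha> x = c \<odot>\<^bsub>cspace A L\<^esub> h (\<zero>\<^bsub>M\<^esub>, y)" for x c
  proof -
    have "h (x, \<zero>\<^bsub>N\<^esub>) = h (\<zero>\<^bsub>M\<^esub>, c \<odot>\<^bsub>cspace A N\<^esub> y)"
      using that y mod_hom_csmult[OF D.lmod_axioms hom, of "(\<zero>\<^bsub>M\<^esub>, y)" c] M.V.smult_zero_right[of c]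
      by (simp add: compose_def cs)
    then show ?thesis using inj_onD[OF inj, of "(x, \<zero>\<^bsub>N\<^esub>)" "(\<zero>\<^bsub>M\<^esub>, c \<odot>\<^bsub>cspace A N\<^esub> y)"] that y by auto
  qed
  note bounded_coords_drop[OF M.lmod_axioms L.lmod_axioms \<alpha> v v0 disj \<kappa>]
  then show ?thesis by (intro exI[of _ "n - 1"]) auto
qed

lemma dsum_commute:
  assumes "left_module A M" "left_module A N"
  shows "isomorphic_mod A (dsum M N) (dsum N M)"
proof -
  interpret M: left_module A M by fact
  interpret N: left_module A N by fact
  have "(\<lambda>p\<in>carrier (dsum M N). prod.swap p) \<in> mod_iso A (dsum M N) (dsum N M)"
    by (auto simp: mod_iso_def bij_betw_def inj_on_def image_iff M.smult_closed N.smult_closed intro!: mod_homI)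
  then show ?thesis by (rule isomorphic_modI')
qed

lemma add_proj_inj_imp_fd_module: "add_proj_inj A M \<Longrightarrow> fd_module A M"
  by (induction rule: add_proj_inj.induct) (auto simp: projective_mod_def injective_mod_def)

text \<open>A module that is neither zero nor indecomposable splits into two summands with fewer coordinates
  each, which again belong to the category.\<close>

lemma ex_copies:
  fixes M :: "('a, 'm) module" and S :: "('a, 'm) module set"
  assumes A: "complex_algebra A" and S: "indec_reps A (add_proj_inj A) S"
    and "add_proj_inj A M" "bounded_coords (cspace A M) n \<kappa>"
  shows "\<exists>m. finite {X \<in> S. m X \<noteq> 0} \<and> isomorphic_mod A M (copies S m)"
  using assms(3,4)
proof (induction n arbitrary: M \<kappa> rule: less_induct)
  case (less n)
  have lS: "left_module A X" if "X \<in> S" for X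
    using S that add_proj_inj_imp_fd_module by (auto simp: indec_reps_def fd_module_def)
  have fM: "fd_module A M" using add_proj_inj_imp_fd_module[OF less.prems(1)] .
  then have lM: "left_module A M" by (simp add: fd_module_def)
  have ex: "\<exists>m. finite {X \<in> S. m X \<noteq> 0} \<and> isomorphic_mod A M (copies S m)"
    if "finite {X \<in> S. m X \<noteq> 0}" "isomorphic_mod A M (copies S m)" for m
    by (intro exI[of _ m] conjI that)
  consider (zero) "carrier M = {\<zero>\<^bsub>M\<^esub>}" | (indec) "indecomposable A M"
    | (dec) K N :: "('a, 'm) module" where "left_module A K" "left_module A N"
      "isomorphic_mod A M (dsum K N)" "carrier K \<noteq> {\<zero>\<^bsub>K\<^esub>}" "carrier N \<noteq> {\<zero>\<^bsub>N\<^esub>}"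
    unfolding indecomposable_def by blast
  then show ?case
  proof cases
    case zero
    have "finite {X \<in> S. (0 :: nat) \<noteq> 0}" by simp
    then show ?thesis by (rule ex[OF _ copies_zero[OF lM zero]])
  next
    case indec
    then obtain X where X: "X \<in> S" "isomorphic_mod A M X"
      using S less.prems(1) unfolding indec_reps_def by blast
    have "finite {Y \<in> S. (if Y = X then 1 else 0 :: nat) \<noteq> 0}" by simp
    then show ?thesis
      by (rule ex[OF _ isomorphic_mod_trans[OF X(2) copies_single[OF X(1) lS[OF X(1)]] lM]])
  next
    case dec
    have iso: "isomorphic_mod A M (dsum N K)"
      using isomorphic_mod_trans[OF dec(3) dsum_commute[OF dec(1,2)] lM] .
    obtain k \<kappa>1 l \<kappa>2 where k: "k < n" "bounded_coords (cspace A K) k \<kappa>1"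
      and l: "l < n" "bounded_coords (cspace A N) l \<kappa>2"
      using bounded_coords_summand[OF A lM dec(1,2,3,5) less.prems(2)]
        bounded_coords_summand[OF A lM dec(2,1) iso dec(4) less.prems(2)] by blast
    have fd: "fd_module A K" "fd_module A N" using dec k l A by (auto simp: fd_module_iff)
    have "add_proj_inj A K" by (rule add_proj_inj.summand[OF less.prems(1) fd dec(3)])
    moreover have "add_proj_inj A N" by (rule add_proj_inj.summand[OF less.prems(1) fd(2,1) iso])
    ultimately obtain m m' where m: "finite {X \<in> S. m X \<noteq> 0}" "isomorphic_mod A K (copies S m)"
      and m': "finite {X \<in> S. m' X \<noteq> 0}" "isomorphic_mod A N (copies S m')"
      using less.IH[OF k(1) _ k(2)] less.IH[OF l(1) _ l(2)] by meson
    note add = copies_add[OF A lS m(1) m'(1) lM dec(1,2,3) m(2) m'(2)]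
    show ?thesis by (rule ex[OF add(2,1)])
  qed
qed

lemma infinite_universe: "large_universe TYPE('m) \<Longrightarrow> infinite (UNIV :: 'm set)"
  unfolding large_universe_def using infinite_UNIV_char_0[where 'a = complex]
  by (meson finite_imageD finite_subset subset_UNIV)

text \<open>An infinite set has the cardinality of its square, so the carrier of a direct sum of two modules
  fits into their common carrier type.\<close>

lemma large_universe_pair:
  assumes "large_universe TYPE('m)"
  obtains p :: "'m \<times> 'm \<Rightarrow> 'm" where "inj p"
proof -
  obtain p :: "'m \<times> 'm \<Rightarrow> 'm" where "bij_betw p (UNIV \<times> UNIV) UNIV"
    using card_of_Times_same_infinite[OF infinite_universe[OF assms], folded card_of_ordIso] by blast
  then show ?thesis using that by (auto simp: bij_betw_def)
qed

text \<open>All powers of \<open>X\<close> occur in the category, so there are enough generators to separate the copies of \<open>X\<close>.\<close>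

lemma ex_power:
  fixes S :: "('a, 'm) module set"
  assumes U: "large_universe TYPE('m)" and A: "complex_algebra A" and S: "indec_reps A (add_proj_inj A) S"
    and X: "X \<in> S"
  shows "\<exists>M :: ('a, 'm) module. add_proj_inj A M \<and> isomorphic_mod A M (copies S (\<lambda>Y. if Y = X then r else 0))"
proof (induction r)
  have lS: "left_module A X" if "X \<in> S" for X
    using S that add_proj_inj_imp_fd_module by (auto simp: indec_reps_def fd_module_def)
  have addX: "add_proj_inj A X" using S X by (auto simp: indec_reps_def)
  have fX: "fd_module A X" using add_proj_inj_imp_fd_module[OF addX] .
  then interpret X: lmod A X using A by (simp add: lmod_def fd_module_def)
  {
    case 0
    let ?D = "direct_sum {} (\<lambda>_ :: unit. X)"
    have D: "left_module A ?D" by (rule left_module_direct_sum[OF A]) auto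
    have cD: "carrier ?D = {\<lambda>_. undefined}" by auto
    define Z where "Z = transport_mod (\<lambda>_. \<zero>\<^bsub>X\<^esub>) ?D"
    have lZ: "left_module A Z" and cZ: "carrier Z = {\<zero>\<^bsub>X\<^esub>}"
      using transport_mod[OF D, of "\<lambda>_. \<zero>\<^bsub>X\<^esub>"] by (auto simp: Z_def cD)
    interpret Z: lmod A Z using lZ A by (simp add: lmod_def)
    have zZ: "\<zero>\<^bsub>Z\<^esub> = \<zero>\<^bsub>X\<^esub>" using Z.M.zero_closed cZ by auto
    have [simp]: "r \<odot>\<^bsub>Z\<^esub> \<zero>\<^bsub>X\<^esub> = \<zero>\<^bsub>X\<^esub>" if "r \<in> carrier A" for r using Z.act_zero[OF that] zZ by simp
    have [simp]: "\<zero>\<^bsub>X\<^esub> \<oplus>\<^bsub>Z\<^esub> \<zero>\<^bsub>X\<^esub> = \<zero>\<^bsub>X\<^esub>" using Z.M.r_zero[of "\<zero>\<^bsub>X\<^esub>"] zZ cZ by simp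
    have "(\<lambda>x\<in>carrier Z. x) \<in> mod_hom A Z X"
      using X.act_zero by (intro mod_homI) (auto simp: cZ)
    then have fZ: "fd_module A Z"
      by (rule fd_module_mono[OF A fX lZ]) (auto simp: cZ)
    have "(\<lambda>x\<in>carrier X. (\<zero>\<^bsub>X\<^esub>, x)) \<in> mod_iso A X (dsum Z X)"
      by (auto simp: mod_iso_def bij_betw_def inj_on_def cZ intro!: mod_homI)
    then have "add_proj_inj A Z"
      by (intro add_proj_inj.summand[OF addX fZ fX]) (auto simp: isomorphic_mod_def)
    moreover have "isomorphic_mod A Z (copies S (\<lambda>_. 0))"
      by (rule copies_zero[OF lZ]) (simp add: cZ zZ)
    ultimately show ?case by auto
  next
    case (Suc r)
    then obtain M :: "('a, 'm) module" where M: "add_proj_inj A M"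
      "isomorphic_mod A M (copies S (\<lambda>Y. if Y = X then r else 0))" by blast
    have fM: "fd_module A M" using add_proj_inj_imp_fd_module[OF M(1)] .
    then have lM: "left_module A M" by (simp add: fd_module_def)
    obtain p :: "'m \<times> 'm \<Rightarrow> 'm" where p: "inj p" using large_universe_pair[OF U] .
    have D: "left_module A (dsum M X)" using left_module_dsum[OF lM X.lm] .
    define L where "L = transport_mod p (dsum M X)"
    have L: "left_module A L" "isomorphic_mod A (dsum M X) L"
      using transport_mod[OF D inj_on_subset[OF p]] by (auto simp: L_def)
    have L': "isomorphic_mod A L (dsum M X)" by (rule isomorphic_mod_sym[OF L(2) D L(1)])
    have "fd_module A L"
      by (rule fd_module_isomorphic[OF A fd_module_dsum[OF A fM fX] L(1) L'])
    then have "add_proj_inj A L" by (rule add_proj_inj.sum[OF M(1) addX _ L'])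
    moreover have "isomorphic_mod A L (copies S (\<lambda>Y. (if Y = X then r else 0) + (if Y = X then 1 else 0)))"
      by (rule copies_add(1)[OF A lS _ _ L(1) lM X.lm L' M(2) copies_single[OF X X.lm]]) auto
    then have "isomorphic_mod A L (copies S (\<lambda>Y. if Y = X then Suc r else 0))"
      by (rule back_subst[of "\<lambda>m. isomorphic_mod A L (copies S m)"]) (auto simp: fun_eq_iff)
    ultimately show ?case by blast
  }
qed

section \<open>The algebra of maps into an endomorphism algebra\<close>

lemma end_algebra_simps [simp]:
  "carrier (end_algebra V) = mod_hom cplx V V"
  "f \<otimes>\<^bsub>end_algebra V\<^esub> g = compose (carrier V) f g"
  "f \<oplus>\<^bsub>end_algebra V\<^esub> g = (\<lambda>x\<in>carrier V. f x \<oplus>\<^bsub>V\<^esub> g x)"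
  "\<zero>\<^bsub>end_algebra V\<^esub> = (\<lambda>x\<in>carrier V. \<zero>\<^bsub>V\<^esub>)"
  "c \<odot>\<^bsub>end_algebra V\<^esub> f = (\<lambda>x\<in>carrier V. c \<odot>\<^bsub>V\<^esub> f x)"
  by (simp_all add: end_algebra_def hom_space_def)

lemma map_algebra_simps [simp]:
  "carrier (map_algebra T E) = T \<rightarrow>\<^sub>E carrier E"
  "f \<otimes>\<^bsub>map_algebra T E\<^esub> g = (\<lambda>t\<in>T. f t \<otimes>\<^bsub>E\<^esub> g t)"
  "f \<oplus>\<^bsub>map_algebra T E\<^esub> g = (\<lambda>t\<in>T. f t \<oplus>\<^bsub>E\<^esub> g t)"
  "\<zero>\<^bsub>map_algebra T E\<^esub> = (\<lambda>t\<in>T. \<zero>\<^bsub>E\<^esub>)"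
  "c \<odot>\<^bsub>map_algebra T E\<^esub> f = (\<lambda>t\<in>T. c \<odot>\<^bsub>E\<^esub> f t)"
  by (simp_all add: map_algebra_def)

lemma complex_spaceI:
  assumes "\<And>x y. \<lbrakk>x \<in> carrier V; y \<in> carrier V\<rbrakk> \<Longrightarrow> x \<oplus>\<^bsub>V\<^esub> y \<in> carrier V" "\<zero>\<^bsub>V\<^esub> \<in> carrier V"
    "\<And>x y z. \<lbrakk>x \<in> carrier V; y \<in> carrier V; z \<in> carrier V\<rbrakk> \<Longrightarrow> (x \<oplus>\<^bsub>V\<^esub> y) \<oplus>\<^bsub>V\<^esub> z = x \<oplus>\<^bsub>V\<^esub> (y \<oplus>\<^bsub>V\<^esub> z)"
    "\<And>x y. \<lbrakk>x \<in> carrier V; y \<in> carrier V\<rbrakk> \<Longrightarrow> x \<oplus>\<^bsub>V\<^esub> y = y \<oplus>\<^bsub>V\<^esub> x"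
    "\<And>x. x \<in> carrier V \<Longrightarrow> \<zero>\<^bsub>V\<^esub> \<oplus>\<^bsub>V\<^esub> x = x"
    and smult: "\<And>c x. x \<in> carrier V \<Longrightarrow> c \<odot>\<^bsub>V\<^esub> x \<in> carrier V"
    "\<And>c d x. x \<in> carrier V \<Longrightarrow> (c + d) \<odot>\<^bsub>V\<^esub> x = c \<odot>\<^bsub>V\<^esub> x \<oplus>\<^bsub>V\<^esub> d \<odot>\<^bsub>V\<^esub> x"
    "\<And>c x y. \<lbrakk>x \<in> carrier V; y \<in> carrier V\<rbrakk> \<Longrightarrow> c \<odot>\<^bsub>V\<^esub> (x \<oplus>\<^bsub>V\<^esub> y) = c \<odot>\<^bsub>V\<^esub> x \<oplus>\<^bsub>V\<^esub> c \<odot>\<^bsub>V\<^esub> y"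
    "\<And>c d x. x \<in> carrier V \<Longrightarrow> (c * d) \<odot>\<^bsub>V\<^esub> x = c \<odot>\<^bsub>V\<^esub> (d \<odot>\<^bsub>V\<^esub> x)"
    "\<And>x. x \<in> carrier V \<Longrightarrow> 1 \<odot>\<^bsub>V\<^esub> x = x"
    "\<And>x. x \<in> carrier V \<Longrightarrow> 0 \<odot>\<^bsub>V\<^esub> x = \<zero>\<^bsub>V\<^esub>"
  shows "complex_space V"
  unfolding complex_space_def
proof (rule moduleI[OF cring_cplx])
  show "abelian_group V"
  proof (rule abelian_groupI)
    fix x assume x: "x \<in> carrier V"
    have "(-1) \<odot>\<^bsub>V\<^esub> x \<oplus>\<^bsub>V\<^esub> x = (-1 + 1) \<odot>\<^bsub>V\<^esub> x" using smult(2)[OF x, of "-1" 1] smult(5)[OF x] by simp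
    then show "\<exists>y\<in>carrier V. y \<oplus>\<^bsub>V\<^esub> x = \<zero>\<^bsub>V\<^esub>"
      using smult(1)[OF x, of "-1"] smult(6)[OF x] by auto
  qed (use assms(1-5) in auto)
qed (simp_all add: smult)

context complex_space begin

lemma endD:
  assumes "f \<in> mod_hom cplx V V"
  shows "x \<in> carrier V \<Longrightarrow> f x \<in> carrier V"
    "\<lbrakk>x \<in> carrier V; y \<in> carrier V\<rbrakk> \<Longrightarrow> f (x \<oplus> y) = f x \<oplus> f y"
    "x \<in> carrier V \<Longrightarrow> f (c \<odot> x) = c \<odot> f x"
    "x \<notin> carrier V \<Longrightarrow> f x = undefined"
  using mod_homD[OF assms] by simp_all

lemma endI:
  assumes "\<And>x. x \<in> carrier V \<Longrightarrow> f x \<in> carrier V"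
    "\<And>x y. \<lbrakk>x \<in> carrier V; y \<in> carrier V\<rbrakk> \<Longrightarrow> f (x \<oplus> y) = f x \<oplus> f y"
    "\<And>c x. x \<in> carrier V \<Longrightarrow> f (c \<odot> x) = c \<odot> f x"
    "\<And>x. x \<notin> carrier V \<Longrightarrow> f x = undefined"
  shows "f \<in> mod_hom cplx V V"
  using assms by (intro mod_homI) simp_all

lemma end_eqI:
  assumes "f \<in> mod_hom cplx V V" "g \<in> mod_hom cplx V V" "\<And>x. x \<in> carrier V \<Longrightarrow> f x = g x"
  shows "f = g"
proof
  fix x show "f x = g x" using assms(3) endD(4)[OF assms(1)] endD(4)[OF assms(2)] by (cases "x \<in> carrier V") auto
qed

text \<open>Covers both the endomorphisms and the maps on a parameter set.\<close>

lemma complex_space_pointwise: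
  fixes F :: "(complex, 't \<Rightarrow> 'v) module"
  assumes F: "carrier F \<subseteq> T \<rightarrow>\<^sub>E carrier V" "\<zero>\<^bsub>F\<^esub> \<in> carrier F"
    and ops: "\<And>f g. f \<oplus>\<^bsub>F\<^esub> g = (\<lambda>t\<in>T. f t \<oplus> g t)" "\<zero>\<^bsub>F\<^esub> = (\<lambda>t\<in>T. \<zero>)" "\<And>c f. c \<odot>\<^bsub>F\<^esub> f = (\<lambda>t\<in>T. c \<odot> f t)"
    and closed: "\<And>f g. f \<in> carrier F \<Longrightarrow> g \<in> carrier F \<Longrightarrow> f \<oplus>\<^bsub>F\<^esub> g \<in> carrier F"
      "\<And>c f. f \<in> carrier F \<Longrightarrow> c \<odot>\<^bsub>F\<^esub> f \<in> carrier F"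
  shows "complex_space F"
proof -
  have mem: "f t \<in> carrier V" if "f \<in> carrier F" "t \<in> T" for f t
    by (rule PiE_mem[OF subsetD[OF F(1) that(1)] that(2)])
  have restr: "restrict f T = f" if "f \<in> carrier F" for f
    by (rule PiE_restrict[OF subsetD[OF F(1) that]])
  show ?thesis
  proof (rule complex_spaceI)
    fix f g h assume f: "f \<in> carrier F" and g: "g \<in> carrier F" and h: "h \<in> carrier F"
    show "(f \<oplus>\<^bsub>F\<^esub> g) \<oplus>\<^bsub>F\<^esub> h = f \<oplus>\<^bsub>F\<^esub> (g \<oplus>\<^bsub>F\<^esub> h)"
      unfolding ops by (rule restrict_ext) (simp add: mem[OF f] mem[OF g] mem[OF h] M.a_assoc)
  next
    fix f g assume f: "f \<in> carrier F" and g: "g \<in> carrier F"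
    show "f \<oplus>\<^bsub>F\<^esub> g = g \<oplus>\<^bsub>F\<^esub> f"
      unfolding ops by (rule restrict_ext) (simp add: mem[OF f] mem[OF g] M.a_comm)
    show "c \<odot>\<^bsub>F\<^esub> (f \<oplus>\<^bsub>F\<^esub> g) = c \<odot>\<^bsub>F\<^esub> f \<oplus>\<^bsub>F\<^esub> c \<odot>\<^bsub>F\<^esub> g" for c
      unfolding ops by (rule restrict_ext) (simp add: mem[OF f] mem[OF g] smult_distr)
  next
    fix f assume f: "f \<in> carrier F"
    have "\<zero>\<^bsub>F\<^esub> \<oplus>\<^bsub>F\<^esub> f = restrict f T" "1 \<odot>\<^bsub>F\<^esub> f = restrict f T"
      unfolding ops by (rule restrict_ext, simp add: mem[OF f])+
    then show "\<zero>\<^bsub>F\<^esub> \<oplus>\<^bsub>F\<^esub> f = f" "1 \<odot>\<^bsub>F\<^esub> f = f" unfolding restr[OF f] .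
    show "(c + d) \<odot>\<^bsub>F\<^esub> f = c \<odot>\<^bsub>F\<^esub> f \<oplus>\<^bsub>F\<^esub> d \<odot>\<^bsub>F\<^esub> f" "(c * d) \<odot>\<^bsub>F\<^esub> f = c \<odot>\<^bsub>F\<^esub> (d \<odot>\<^bsub>F\<^esub> f)" for c d
      unfolding ops by (rule restrict_ext, simp add: mem[OF f] smult_add smult_smult)+
    show "0 \<odot>\<^bsub>F\<^esub> f = \<zero>\<^bsub>F\<^esub>"
      unfolding ops by (rule restrict_ext) (simp add: mem[OF f])
  qed (use closed F(2) in blast)+
qed

lemma complex_space_end: "complex_space (end_algebra V)"
proof (rule complex_space_pointwise[where T = "carrier V"])
  show "carrier (end_algebra V) \<subseteq> carrier V \<rightarrow>\<^sub>E carrier V"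
    by (auto simp: mod_hom_def)
  show "\<zero>\<^bsub>end_algebra V\<^esub> \<in> carrier (end_algebra V)"
    unfolding end_algebra_simps by (rule endI) simp_all
  fix f assume "f \<in> carrier (end_algebra V)"
  then have "f \<in> mod_hom cplx V V" by simp
  note f = endD(1-3)[OF this]
  show "c \<odot>\<^bsub>end_algebra V\<^esub> f \<in> carrier (end_algebra V)" for c
    unfolding end_algebra_simps by (rule endI) (simp_all add: f smult_distr smult_smult mult.commute)
  fix g assume "g \<in> carrier (end_algebra V)"
  then have "g \<in> mod_hom cplx V V" by simp
  note g = endD(1-3)[OF this]
  show "f \<oplus>\<^bsub>end_algebra V\<^esub> g \<in> carrier (end_algebra V)"
    unfolding end_algebra_simps by (rule endI) (simp_all add: f g M.a_ac smult_distr)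
qed simp_all

lemma complex_space_map: "complex_space (map_algebra T V)"
  by (rule complex_space_pointwise[where T = T]) auto

text \<open>Evaluating at a vector and then applying a functional is a functional on the endomorphisms, so
  an integral of endomorphisms is unique as soon as the functionals separate vectors.\<close>

lemma has_vec_integral_unique:
  assumes "coords V \<kappa>" "has_vec_integral (end_algebra V) \<mu> F v" "has_vec_integral (end_algebra V) \<mu> F w"
  shows "v = w"
proof -
  have vw: "v \<in> mod_hom cplx V V" "w \<in> mod_hom cplx V V"
    using assms(2,3) by (simp_all add: has_vec_integral_def)
  have "f (v x) = f (w x)" if f: "functional V f" and x: "x \<in> carrier V" for f x
  proof -
    let ?\<phi> = "\<lambda>g\<in>mod_hom cplx V V. f (g x)"
    have "?\<phi> \<in> mod_hom cplx (end_algebra V) cplx"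
    proof (rule mod_homI)
      fix g h assume gh: "g \<in> carrier (end_algebra V)" "h \<in> carrier (end_algebra V)"
      then have "g \<oplus>\<^bsub>end_algebra V\<^esub> h \<in> carrier (end_algebra V)"
        using complex_space_end abelian_groupE(1)[of "end_algebra V"]
        by (simp add: complex_space_def Module.module_def)
      then show "?\<phi> (g \<oplus>\<^bsub>end_algebra V\<^esub> h) = ?\<phi> g \<oplus>\<^bsub>cplx\<^esub> ?\<phi> h"
        using gh functionalD(1)[OF f endD(1)[OF _ x] endD(1)[OF _ x]] x by simp
    next
      fix c g assume g: "g \<in> carrier (end_algebra V)"
      then have "c \<odot>\<^bsub>end_algebra V\<^esub> g \<in> carrier (end_algebra V)"
        by (rule complex_space.smult_closed'[OF complex_space_end])
      then show "?\<phi> (c \<odot>\<^bsub>end_algebra V\<^esub> g) = c \<odot>\<^bsub>cplx\<^esub> ?\<phi> g"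
        using g functionalD(2)[OF f endD(1)[OF _ x]] x by simp
    qed simp_all
    then have "has_bochner_integral \<mu> (\<lambda>y. ?\<phi> (F y)) (?\<phi> v)" "has_bochner_integral \<mu> (\<lambda>y. ?\<phi> (F y)) (?\<phi> w)"
      using assms(2,3) unfolding has_vec_integral_def by blast+
    then show ?thesis using has_bochner_integral_eq vw by fastforce
  qed
  then have "v x = w x" if "x \<in> carrier V" for x
    using coords_eqI[OF assms(1) endD(1)[OF vw(1)] endD(1)[OF vw(2)]] that by blast
  then show ?thesis by (rule end_eqI[OF vw])
qed

end

section \<open>The integral profile is multiplication by an element of the algebra\<close>

text \<open>By Fubini the integral is the product of \<open>\<integral>\<^sub>0\<^sup>t\<^sup>i x dx = t\<^sub>i\<^sup>2/2\<close> and the other side lengths.\<close>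

lemma box_coordinate_integral:
  fixes t :: "nat \<Rightarrow> real"
  assumes i: "i < d" and t: "\<And>j. j < d \<Longrightarrow> 0 \<le> t j"
  shows "has_bochner_integral (restrict_space (\<Pi>\<^sub>M j\<in>{..<d}. lborel) (\<Pi>\<^sub>E j\<in>{..<d}. {0..t j}))
           (\<lambda>l. l i) (t i * (\<Prod>j<d. t j) / 2)"
proof -
  let ?P = "\<Pi>\<^sub>M j\<in>{..<d}. (lborel :: real measure)" and ?B = "\<Pi>\<^sub>E j\<in>{..<d}. {0..t j}"
  interpret product_sigma_finite "\<lambda>_ :: nat. lborel :: real measure" by unfold_locales
  define g where "g j x = indicator {0..t j} x * (if j = i then x else 1)" for j and x :: real
  have g: "has_bochner_integral lborel (g j) (if j = i then t j ^ 2 / 2 else t j)" if "j < d" for j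
  proof (cases "j = i")
    case True
    have "has_bochner_integral lborel (\<lambda>x. indicator {0..t j} x *\<^sub>R x) (t j ^ 2 / 2 - 0 ^ 2 / 2)"
      by (rule has_bochner_integral_FTC_Icc) (use t[OF that] in
          \<open>auto intro!: derivative_eq_intros continuous_intros simp flip: has_real_derivative_iff_has_vector_derivative\<close>)
    then show ?thesis using True by (simp add: g_def[abs_def])
  next
    case False
    have "has_bochner_integral lborel (indicator {0..t j} :: real \<Rightarrow> real) (measure lborel {0..t j})"
      by (rule has_bochner_integral_real_indicator) (simp_all add: emeasure_lborel_Icc_eq)
    then show ?thesis using False t[OF that] by (simp add: g_def[abs_def])
  qed
  have int: "integrable ?P (\<lambda>l. \<Prod>j\<in>{..<d}. g j (l j))"
    by (rule product_integrable_prod) (use g in \<open>auto simp: has_bochner_integral_iff\<close>)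
  have "integral\<^sup>L ?P (\<lambda>l. \<Prod>j\<in>{..<d}. g j (l j)) = (\<Prod>j<d. integral\<^sup>L lborel (g j))"
    by (rule product_integral_prod) (use g in \<open>auto simp: has_bochner_integral_iff\<close>)
  also have "\<dots> = (\<Prod>j<d. if j = i then t j ^ 2 / 2 else t j)"
    using g by (intro prod.cong) (auto simp: has_bochner_integral_iff)
  also have "\<dots> = t i * (\<Prod>j<d. t j) / 2"
    using i by (simp add: prod.remove[of "{..<d}" i] power2_eq_square)
  finally have hb: "has_bochner_integral ?P (\<lambda>l. \<Prod>j\<in>{..<d}. g j (l j)) (t i * (\<Prod>j<d. t j) / 2)"
    using int by (simp add: has_bochner_integral_iff)
  have eq: "(\<Prod>j\<in>{..<d}. g j (l j)) = indicator ?B l *\<^sub>R l i" if l: "l \<in> space ?P" for l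
  proof (cases "l \<in> ?B")
    case True
    then have "(\<Prod>j\<in>{..<d}. g j (l j)) = (\<Prod>j<d. if j = i then l i else 1)"
      by (intro prod.cong) (auto simp: g_def PiE_iff)
    then show ?thesis using True i by simp
  next
    case False
    then obtain j where "j < d" "l j \<notin> {0..t j}" using l by (auto simp: space_PiM PiE_iff)
    then have "j \<in> {..<d}" "g j (l j) = 0" by (auto simp: g_def)
    then have "(\<Prod>j\<in>{..<d}. g j (l j)) = 0" by (intro prod_zero) auto
    then show ?thesis using False by simp
  qed
  have "has_bochner_integral ?P (\<lambda>l. indicator ?B l *\<^sub>R l i) (t i * (\<Prod>j<d. t j) / 2)"
    using hb has_bochner_integral_cong[OF refl eq refl, of ?P] by simp
  moreover have "?B \<inter> space ?P \<in> sets ?P"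
    by (rule sets.Int) (auto intro!: sets_PiM_I_finite)
  ultimately show ?thesis
    by (simp add: has_bochner_integral_iff integrable_restrict_space integral_restrict_space)
qed

text \<open>The barycentre of the box, scaled by its volume.\<close>

definition profile_elt :: "(complex, 'a) module \<Rightarrow> nat \<Rightarrow> (nat \<Rightarrow> 'a) \<Rightarrow> (nat \<Rightarrow> real) \<Rightarrow> 'a" where
  "profile_elt A d a t = lin_comb A d a (\<lambda>i. complex_of_real (t i * (\<Prod>j<d. t j) / 2))"

lemma has_bochner_integral_embed_measure:
  fixes g :: "'b \<Rightarrow> complex"
  assumes inj: "inj_on h (space M)" and int: "has_bochner_integral M (\<lambda>x. g (h x)) v"
  shows "has_bochner_integral (embed_measure M h) g v"
proof -
  have "(\<lambda>x. g (h x)) \<in> borel_measurable M" using int by (auto elim: has_bochner_integral.cases)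
  then have "g \<in> borel_measurable (embed_measure M h)" by (rule measurable_embed_measure1)
  then show ?thesis
    by (subst embed_measure_eq_distr'[OF inj])
      (rule has_bochner_integral_distr[OF _ measurable_embed_measure2'[OF inj] int])
qed

lemma box_measure_functional_integral:
  assumes A: "algebra_with_basis A d a" and t: "t \<in> orthant d" and f: "functional A f"
  shows "has_bochner_integral (box_measure A d a t) f (f (profile_elt A d a t))"
proof -
  interpret complex_space A
    using A by (simp add: algebra_with_basis_def complex_algebra_def complex_space_def)
  have a: "a \<in> {..<d} \<rightarrow> carrier A" and basis: "is_basis A d a"
    using A by (auto simp: algebra_with_basis_def is_basis_def)
  let ?M = "restrict_space (\<Pi>\<^sub>M i\<in>{..<d}. lborel) (\<Pi>\<^sub>E i\<in>{..<d}. {0..t i})"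
  let ?h = "\<lambda>l :: nat \<Rightarrow> real. lin_comb A d a (\<lambda>i. complex_of_real (l i))"
  have "inj_on ?h (space ?M)"
  proof
    fix l l' assume l: "l \<in> space ?M" "l' \<in> space ?M" and eq: "?h l = ?h l'"
    have h: "?h k = lin_comb A d a (\<lambda>i\<in>{..<d}. complex_of_real (k i))" for k
      by (rule lin_comb_cong[OF a]) simp
    have "\<exists>!c. c \<in> {..<d} \<rightarrow>\<^sub>E UNIV \<and> ?h l = lin_comb A d a c"
      using basis lin_comb_closed[OF a] unfolding is_basis_def by blast
    moreover have "(\<lambda>i\<in>{..<d}. complex_of_real (l i)) \<in> {..<d} \<rightarrow>\<^sub>E UNIV"
      "(\<lambda>i\<in>{..<d}. complex_of_real (l' i)) \<in> {..<d} \<rightarrow>\<^sub>E UNIV" by auto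
    ultimately have e: "(\<lambda>i\<in>{..<d}. complex_of_real (l i)) = (\<lambda>i\<in>{..<d}. complex_of_real (l' i))"
      using h[of l] h[of l'] eq by metis
    have "l i = l' i" if "i < d" for i using fun_cong[OF e, of i] that by simp
    then show "l = l'"
      using l by (intro extensionalityI[of _ "{..<d}"]) (auto simp: space_restrict_space space_PiM PiE_iff)
  qed
  moreover have "has_bochner_integral ?M (\<lambda>l. f (?h l)) (f (profile_elt A d a t))"
    unfolding profile_elt_def functional_lin_comb[OF f a]
  proof (rule has_bochner_integral_sum)
    fix i assume i: "i \<in> {..<d}"
    have "has_bochner_integral ?M (\<lambda>l. l i) (t i * (\<Prod>j<d. t j) / 2)"
      by (rule box_coordinate_integral) (use i t in \<open>auto simp: orthant_def PiE_iff\<close>)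
    then have "has_bochner_integral ?M (\<lambda>l. complex_of_real (l i)) (complex_of_real (t i * (\<Prod>j<d. t j) / 2))"
      by (rule has_bochner_integral_of_real)
    then show "has_bochner_integral ?M (\<lambda>l. complex_of_real (l i) * f (a i))
        (complex_of_real (t i * (\<Prod>j<d. t j) / 2) * f (a i))"
      by (rule has_bochner_integral_mult_left)
  qed
  ultimately show ?thesis
    unfolding box_measure_def by (rule has_bochner_integral_embed_measure)
qed

lemma (in lmod) structure_map_end:
  assumes "r \<in> carrier A"
  shows "structure_map M r \<in> mod_hom cplx (cspace A M) (cspace A M)"
  by (rule V.endI) (simp_all add: structure_map_def assms smult_r_distr act_csmult)

text \<open>Composing the structure map with a functional on the endomorphisms gives a functional on the
  algebra, and functionals commute with the integral.\<close>

lemma integral_profile_eq: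
  assumes A: "algebra_with_basis A d a" and M: "fd_module A M" and t: "t \<in> orthant d"
  shows "integral_profile A d a M t = structure_map M (profile_elt A d a t)"
proof -
  have alg: "complex_algebra A" using A by (simp add: algebra_with_basis_def)
  interpret lmod A M using alg M by (simp add: lmod_def fd_module_def)
  obtain n \<kappa> where "bounded_coords (cspace A M) n \<kappa>" using M unfolding fd_module_iff[OF alg] by blast
  then have \<kappa>: "coords (cspace A M) \<kappa>" by (rule bounded_coords_imp_coords)
  have a: "a \<in> {..<d} \<rightarrow> carrier A" using A by (auto simp: algebra_with_basis_def is_basis_def)
  have Q: "profile_elt A d a t \<in> carrier A" unfolding profile_elt_def by (rule S.lin_comb_closed[OF a])
  let ?E = "end_algebra (cspace A M)"
  have "has_vec_integral ?E (box_measure A d a t) (structure_map M) (structure_map M (profile_elt A d a t))"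
    unfolding has_vec_integral_def
  proof (intro conjI ballI)
    show "structure_map M (profile_elt A d a t) \<in> carrier ?E" using structure_map_end[OF Q] by simp
    fix \<phi> assume \<phi>: "\<phi> \<in> mod_hom cplx ?E cplx"
    have "functional A (\<lambda>r. \<phi> (structure_map M r))"
      unfolding functional_def
    proof (intro conjI ballI allI)
      fix r s assume rs: "r \<in> carrier A" "s \<in> carrier A"
      have "structure_map M (r \<oplus>\<^bsub>A\<^esub> s) = structure_map M r \<oplus>\<^bsub>?E\<^esub> structure_map M s"
        by (rule ext) (simp add: structure_map_def rs smult_l_distr)
      then show "\<phi> (structure_map M (r \<oplus>\<^bsub>A\<^esub> s)) = \<phi> (structure_map M r) + \<phi> (structure_map M s)"
        using mod_homD(2)[OF \<phi>, of "structure_map M r" "structure_map M s"] structure_map_end rs by simp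
    next
      fix c r assume r: "r \<in> carrier A"
      have "structure_map M (c \<odot>\<^bsub>A\<^esub> r) = c \<odot>\<^bsub>?E\<^esub> structure_map M r"
        by (rule ext) (simp add: structure_map_def r act_csmult)
      then show "\<phi> (structure_map M (c \<odot>\<^bsub>A\<^esub> r)) = c * \<phi> (structure_map M r)"
        using mod_homD(3)[OF \<phi>, of c "structure_map M r"] structure_map_end[OF r] by simp
    qed
    from box_measure_functional_integral[OF A t this]
    show "has_bochner_integral (box_measure A d a t) (\<lambda>x. \<phi> (structure_map M x))
        (\<phi> (structure_map M (profile_elt A d a t)))" .
  qed
  then have "vec_integral ?E (box_measure A d a t) (structure_map M) = structure_map M (profile_elt A d a t)"
    unfolding vec_integral_def using V.has_vec_integral_unique[OF \<kappa>] by blast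
  then show ?thesis using t by (simp add: integral_profile_def)
qed

section \<open>Polynomials acting through an algebra element\<close>

text \<open>Evaluation of the polynomial at the action of \<open>r\<close>, by Horner's scheme.\<close>

definition poly_act :: "(complex, 'a) module \<Rightarrow> ('a, 'm) module \<Rightarrow> 'a \<Rightarrow> complex poly \<Rightarrow> 'm \<Rightarrow> 'm" where
  "poly_act A M r p w = fold_coeffs (\<lambda>c u. c \<odot>\<^bsub>cspace A M\<^esub> w \<oplus>\<^bsub>M\<^esub> r \<odot>\<^bsub>M\<^esub> u) p \<zero>\<^bsub>M\<^esub>"

context lmod begin

lemma poly_act_0 [simp]: "poly_act A M r 0 w = \<zero>\<^bsub>M\<^esub>"
  by (simp add: poly_act_def)

lemma poly_act_pCons:
  assumes "r \<in> carrier A" "w \<in> carrier M"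
  shows "poly_act A M r (pCons c p) w = c \<odot>\<^bsub>cspace A M\<^esub> w \<oplus>\<^bsub>M\<^esub> r \<odot>\<^bsub>M\<^esub> poly_act A M r p w"
proof (cases "p = 0 \<and> c = 0")
  case True
  then show ?thesis using assms V.smult_zero[of w] by simp
next
  case False
  then have "p \<noteq> 0 \<or> c \<noteq> 0" by simp
  then show ?thesis unfolding poly_act_def by auto
qed

lemma poly_act_stable:
  assumes C: "C \<subseteq> carrier M" "\<zero>\<^bsub>M\<^esub> \<in> C" "\<And>x y. x \<in> C \<Longrightarrow> y \<in> C \<Longrightarrow> x \<oplus>\<^bsub>M\<^esub> y \<in> C"
    "\<And>r x. r \<in> carrier A \<Longrightarrow> x \<in> C \<Longrightarrow> r \<odot>\<^bsub>M\<^esub> x \<in> C"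
    and r: "r \<in> carrier A" and w: "w \<in> C"
  shows "poly_act A M r p w \<in> C"
proof (induction p)
  case 0
  show ?case using C(2) by simp
next
  case (pCons c p)
  have "c \<odot>\<^bsub>cspace A M\<^esub> w \<in> C" unfolding csmult_def by (rule C(4)[OF one_smult_closed w])
  moreover have "r \<odot>\<^bsub>M\<^esub> poly_act A M r p w \<in> C" by (rule C(4)[OF r pCons.IH])
  moreover have "w \<in> carrier M" using C(1) w by auto
  ultimately show ?case using C(3) by (simp only: poly_act_pCons[OF r])
qed

lemma poly_act_closed [simp, intro]:
  assumes "r \<in> carrier A" "w \<in> carrier M"
  shows "poly_act A M r p w \<in> carrier M"
  by (rule poly_act_stable) (use assms in auto)

lemma poly_act_X: "r \<in> carrier A \<Longrightarrow> w \<in> carrier M \<Longrightarrow> poly_act A M r [:0, 1:] w = r \<odot>\<^bsub>M\<^esub> w"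
  using V.smult_zero[of w] V.smult_one'[of w] by (simp add: poly_act_pCons)

lemma poly_act_add:
  assumes r: "r \<in> carrier A" and w: "w \<in> carrier M"
  shows "poly_act A M r (p + q) w = poly_act A M r p w \<oplus>\<^bsub>M\<^esub> poly_act A M r q w"
proof (induction p q rule: poly_induct2)
  case (pCons c p d q)
  have "poly_act A M r (pCons c p + pCons d q) w =
      (c \<odot>\<^bsub>cspace A M\<^esub> w \<oplus>\<^bsub>M\<^esub> d \<odot>\<^bsub>cspace A M\<^esub> w) \<oplus>\<^bsub>M\<^esub>
      (r \<odot>\<^bsub>M\<^esub> poly_act A M r p w \<oplus>\<^bsub>M\<^esub> r \<odot>\<^bsub>M\<^esub> poly_act A M r q w)"
    using r w V.smult_add[of w c d] by (simp add: poly_act_pCons pCons.IH smult_r_distr)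
  also have "\<dots> = poly_act A M r (pCons c p) w \<oplus>\<^bsub>M\<^esub> poly_act A M r (pCons d q) w"
    using r w by (simp add: poly_act_pCons M.a_ac)
  finally show ?case .
qed simp

lemma poly_act_smult:
  assumes r: "r \<in> carrier A" and w: "w \<in> carrier M"
  shows "poly_act A M r (Polynomial.smult z p) w = z \<odot>\<^bsub>cspace A M\<^esub> poly_act A M r p w"
proof (induction p)
  case (pCons c p)
  show ?case
    using r w V.smult_smult[of w z c] act_csmult(1)[OF r poly_act_closed[OF r w], of z p]
      V.smult_distr[of "c \<odot>\<^bsub>cspace A M\<^esub> w" "r \<odot>\<^bsub>M\<^esub> poly_act A M r p w" z]
    by (simp add: poly_act_pCons pCons.IH)
qed (use V.smult_zero_right in simp)

lemma poly_act_mult: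
  assumes r: "r \<in> carrier A" and w: "w \<in> carrier M"
  shows "poly_act A M r (p * q) w = poly_act A M r p (poly_act A M r q w)"
proof (induction p)
  case (pCons c p)
  have "poly_act A M r (pCons c p * q) w =
      poly_act A M r (Polynomial.smult c q) w \<oplus>\<^bsub>M\<^esub> poly_act A M r (pCons 0 (p * q)) w"
    using poly_act_add[OF r w] by (simp add: mult_pCons_left)
  also have "poly_act A M r (pCons 0 (p * q)) w = r \<odot>\<^bsub>M\<^esub> poly_act A M r p (poly_act A M r q w)"
    using r w V.smult_zero[of w] by (simp add: poly_act_pCons pCons.IH)
  finally show ?case
    using r w by (simp add: poly_act_smult poly_act_pCons)
qed simp

lemma poly_act_commute:
  assumes r: "r \<in> carrier A" and s: "s \<in> carrier A" and rs: "r \<otimes>\<^bsub>A\<^esub> s = s \<otimes>\<^bsub>A\<^esub> r" and w: "w \<in> carrier M"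
  shows "s \<odot>\<^bsub>M\<^esub> poly_act A M r p w = poly_act A M r p (s \<odot>\<^bsub>M\<^esub> w)"
proof (induction p)
  case (pCons c p)
  have "s \<odot>\<^bsub>M\<^esub> poly_act A M r (pCons c p) w =
      c \<odot>\<^bsub>cspace A M\<^esub> (s \<odot>\<^bsub>M\<^esub> w) \<oplus>\<^bsub>M\<^esub> s \<odot>\<^bsub>M\<^esub> (r \<odot>\<^bsub>M\<^esub> poly_act A M r p w)"
    using r s w by (simp add: poly_act_pCons smult_r_distr act_csmult)
  also have "s \<odot>\<^bsub>M\<^esub> (r \<odot>\<^bsub>M\<^esub> poly_act A M r p w) = r \<odot>\<^bsub>M\<^esub> (s \<odot>\<^bsub>M\<^esub> poly_act A M r p w)"
    using smult_assoc[OF s r] smult_assoc[OF r s] rs r w by simp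
  finally show ?case using r s w by (simp add: poly_act_pCons pCons.IH)
qed (use s in simp)

abbreviation act_pow :: "'a \<Rightarrow> nat \<Rightarrow> 'm \<Rightarrow> 'm" where
  "act_pow r k \<equiv> (\<lambda>u. r \<odot>\<^bsub>M\<^esub> u) ^^ k"

lemma act_pow_closed [simp, intro]: "r \<in> carrier A \<Longrightarrow> w \<in> carrier M \<Longrightarrow> act_pow r k w \<in> carrier M"
  by (induction k) auto

lemma act_pow_linear:
  assumes "r \<in> carrier A" "u \<in> carrier M" "v \<in> carrier M"
  shows "act_pow r k (u \<oplus>\<^bsub>M\<^esub> z \<odot>\<^bsub>cspace A M\<^esub> v) = act_pow r k u \<oplus>\<^bsub>M\<^esub> z \<odot>\<^bsub>cspace A M\<^esub> act_pow r k v"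
  using assms by (induction k) (simp_all add: smult_r_distr act_csmult)

lemma act_pow_scale:
  assumes r: "r \<in> carrier A" and w: "w \<in> carrier M"
  shows "act_pow (z \<odot>\<^bsub>A\<^esub> r) k w = (z ^ k) \<odot>\<^bsub>cspace A M\<^esub> act_pow r k w"
proof (induction k)
  case 0
  show ?case using w V.smult_one'[of w] by simp
next
  case (Suc k)
  show ?case
    using r w V.smult_smult[of "r \<odot>\<^bsub>M\<^esub> act_pow r k w" "z ^ k" z]
    by (simp add: Suc.IH act_csmult mult.commute)
qed

lemma act_pow_one: "w \<in> carrier M \<Longrightarrow> act_pow \<one>\<^bsub>A\<^esub> k w = w"
  by (induction k) (simp_all add: smult_one)

text \<open>Separates the homogeneous parts: scaling \<open>r\<close> by \<open>z\<close> turns the action of \<open>p\<close>, seen through a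
  functional, into a polynomial in \<open>z\<close> whose coefficients are those of \<open>p\<close> times the powers of \<open>r\<close>.\<close>

lemma poly_act_scale_polynomial:
  assumes f: "functional (cspace A M) f" and r: "r \<in> carrier A" and w: "w \<in> carrier M"
  shows "\<exists>P. (\<forall>k. coeff P k = coeff p k * f (act_pow r k w)) \<and>
    (\<forall>z. f (poly_act A M (z \<odot>\<^bsub>A\<^esub> r) p w) = poly P z)"
  using w
proof (induction p arbitrary: w)
  case 0
  then show ?case using V.functional_zero[OF f] by (intro exI[of _ 0]) simp
next
  case (pCons c p)
  have rw: "r \<odot>\<^bsub>M\<^esub> w \<in> carrier M" using r pCons.prems by simp
  then obtain P where P: "\<And>k. coeff P k = coeff p k * f (act_pow r k (r \<odot>\<^bsub>M\<^esub> w))"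
    "\<And>z. f (poly_act A M (z \<odot>\<^bsub>A\<^esub> r) p (r \<odot>\<^bsub>M\<^esub> w)) = poly P z"
    using pCons.IH by blast
  have "coeff (pCons (c * f w) P) k = coeff (pCons c p) k * f (act_pow r k w)" for k
  proof (cases k)
    case (Suc j)
    have "act_pow r j (r \<odot>\<^bsub>M\<^esub> w) = act_pow r (Suc j) w" by (simp only: funpow_Suc_right o_apply)
    then show ?thesis using P(1)[of j] Suc by (simp del: funpow.simps)
  qed simp
  moreover have "f (poly_act A M (z \<odot>\<^bsub>A\<^esub> r) (pCons c p) w) = poly (pCons (c * f w) P) z" for z
  proof -
    have zr: "z \<odot>\<^bsub>A\<^esub> r \<in> carrier A" using r by (rule S.smult_closed')
    have comm: "(z \<odot>\<^bsub>A\<^esub> r) \<otimes>\<^bsub>A\<^esub> r = r \<otimes>\<^bsub>A\<^esub> (z \<odot>\<^bsub>A\<^esub> r)"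
      using alg r unfolding complex_algebra_def by metis
    have "(z \<odot>\<^bsub>A\<^esub> r) \<odot>\<^bsub>M\<^esub> poly_act A M (z \<odot>\<^bsub>A\<^esub> r) p w =
        z \<odot>\<^bsub>cspace A M\<^esub> (r \<odot>\<^bsub>M\<^esub> poly_act A M (z \<odot>\<^bsub>A\<^esub> r) p w)"
      using act_csmult(2)[OF r poly_act_closed[OF zr pCons.prems]] by simp
    also have "r \<odot>\<^bsub>M\<^esub> poly_act A M (z \<odot>\<^bsub>A\<^esub> r) p w = poly_act A M (z \<odot>\<^bsub>A\<^esub> r) p (r \<odot>\<^bsub>M\<^esub> w)"
      by (rule poly_act_commute[OF zr r comm pCons.prems])
    finally have e: "(z \<odot>\<^bsub>A\<^esub> r) \<odot>\<^bsub>M\<^esub> poly_act A M (z \<odot>\<^bsub>A\<^esub> r) p w =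
        z \<odot>\<^bsub>cspace A M\<^esub> poly_act A M (z \<odot>\<^bsub>A\<^esub> r) p (r \<odot>\<^bsub>M\<^esub> w)" .
    have cl: "poly_act A M (z \<odot>\<^bsub>A\<^esub> r) p (r \<odot>\<^bsub>M\<^esub> w) \<in> carrier (cspace A M)" using zr rw by simp
    have w': "w \<in> carrier (cspace A M)" using pCons.prems by simp
    show ?thesis
      using functionalD(1)[OF f V.smult_closed'[OF w'] V.smult_closed'[OF cl]]
        functionalD(2)[OF f w'] functionalD(2)[OF f cl]
      by (simp add: poly_act_pCons[OF zr pCons.prems] e P(2))
  qed
  ultimately show ?case by blast
qed

text \<open>Along a line in the algebra the powers depend polynomially on the parameter, so a power that
  vanishes at infinitely many points of the line vanishes on the whole line.\<close>

lemma act_pow_line_polynomial: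
  assumes f: "functional (cspace A M) f" and x: "x \<in> carrier A" and y: "y \<in> carrier A" and w: "w \<in> carrier M"
  shows "\<exists>P. \<forall>s. f (act_pow (x \<oplus>\<^bsub>A\<^esub> s \<odot>\<^bsub>A\<^esub> y) k w) = poly P s"
  using w
proof (induction k arbitrary: w)
  case 0
  show ?case by (intro exI[of _ "[:f w:]"]) simp
next
  case (Suc k)
  obtain P Q where P: "\<And>s. f (act_pow (x \<oplus>\<^bsub>A\<^esub> s \<odot>\<^bsub>A\<^esub> y) k (x \<odot>\<^bsub>M\<^esub> w)) = poly P s"
    and Q: "\<And>s. f (act_pow (x \<oplus>\<^bsub>A\<^esub> s \<odot>\<^bsub>A\<^esub> y) k (y \<odot>\<^bsub>M\<^esub> w)) = poly Q s"
    using Suc.IH[OF act_closed[OF x Suc.prems]] Suc.IH[OF act_closed[OF y Suc.prems]] by blast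
  have "f (act_pow (x \<oplus>\<^bsub>A\<^esub> s \<odot>\<^bsub>A\<^esub> y) (Suc k) w) = poly (P + pCons 0 Q) s" for s
  proof -
    let ?r = "x \<oplus>\<^bsub>A\<^esub> s \<odot>\<^bsub>A\<^esub> y"
    have sy: "s \<odot>\<^bsub>A\<^esub> y \<in> carrier A" using y by (rule S.smult_closed')
    then have r: "?r \<in> carrier A" using x by simp
    have xw: "x \<odot>\<^bsub>M\<^esub> w \<in> carrier M" and yw: "y \<odot>\<^bsub>M\<^esub> w \<in> carrier M" using x y Suc.prems by auto
    have "?r \<odot>\<^bsub>M\<^esub> w = x \<odot>\<^bsub>M\<^esub> w \<oplus>\<^bsub>M\<^esub> s \<odot>\<^bsub>cspace A M\<^esub> (y \<odot>\<^bsub>M\<^esub> w)"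
      using smult_l_distr[OF x sy Suc.prems] act_csmult(2)[OF y Suc.prems] by simp
    then have "act_pow ?r (Suc k) w =
        act_pow ?r k (x \<odot>\<^bsub>M\<^esub> w) \<oplus>\<^bsub>M\<^esub> s \<odot>\<^bsub>cspace A M\<^esub> act_pow ?r k (y \<odot>\<^bsub>M\<^esub> w)"
      unfolding funpow_Suc_right o_apply using act_pow_linear[OF r xw yw] by simp
    moreover have c: "act_pow ?r k (x \<odot>\<^bsub>M\<^esub> w) \<in> carrier (cspace A M)" "act_pow ?r k (y \<odot>\<^bsub>M\<^esub> w) \<in> carrier (cspace A M)"
      using act_pow_closed[OF r xw] act_pow_closed[OF r yw] by simp_all
    ultimately show ?thesis
      using functionalD(1)[OF f c(1) V.smult_closed'[OF c(2)]] functionalD(2)[OF f c(2)]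
      by (simp add: P Q)
  qed
  then show ?case by blast
qed

end

section \<open>The integral profile satisfies no polynomial identity\<close>

lemma poly_zero_if_infinite_zeros:
  fixes P :: "complex poly"
  assumes "infinite Z" "\<And>z. z \<in> Z \<Longrightarrow> poly P z = 0"
  shows "P = 0"
proof (rule ccontr)
  assume "P \<noteq> 0"
  then have "finite {z. poly P z = 0}" by (rule poly_roots_finite)
  then have "finite Z" by (rule rev_finite_subset) (use assms(2) in auto)
  with assms(1) show False by simp
qed

lemma infinite_of_real_greaterThan: "infinite (complex_of_real ` {b<..})"
proof
  assume "finite (complex_of_real ` {b<..})"
  then have "finite {b<..}" by (rule finite_imageD) (auto simp: inj_on_def)
  then show False using infinite_Ioi by blast
qed

locale based_lmod = lmod A M for A :: "(complex, 'a) module" and M :: "('a, 'm) module" +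
  fixes d :: nat and a :: "nat \<Rightarrow> 'a" and \<kappa> :: "'m \<Rightarrow> 'i \<Rightarrow> complex"
  assumes basis: "is_basis A d a" and coords: "coords (cspace A M) \<kappa>"
begin

abbreviation Q :: "(nat \<Rightarrow> real) \<Rightarrow> 'a" where "Q \<equiv> profile_elt A d a"

abbreviation real_comb :: "(nat \<Rightarrow> real) \<Rightarrow> 'a" where
  "real_comb v \<equiv> lin_comb A d a (\<lambda>i. complex_of_real (v i))"

lemma basis_mem: "a \<in> {..<d} \<rightarrow> carrier A"
  using basis by (simp add: is_basis_def)

lemma lin_comb_mem [simp, intro]: "lin_comb A d a c \<in> carrier A"
  by (rule S.lin_comb_closed[OF basis_mem])

lemma Q_mem [simp, intro]: "Q t \<in> carrier A"
  unfolding profile_elt_def by (rule lin_comb_mem)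

lemma lin_comb_add_scale:
  "lin_comb A d a c \<oplus>\<^bsub>A\<^esub> s \<odot>\<^bsub>A\<^esub> lin_comb A d a c' = lin_comb A d a (\<lambda>i. c i + s * c' i)"
  by (simp add: S.lin_comb_add[OF basis_mem] S.lin_comb_smult[OF basis_mem])

lemma Q_eq: "Q t = complex_of_real ((\<Prod>j<d. t j) / 2) \<odot>\<^bsub>A\<^esub> real_comb t"
  unfolding profile_elt_def S.lin_comb_smult[OF basis_mem, symmetric]
  by (rule arg_cong[where f = "lin_comb A d a"]) (simp add: mult.commute)

lemma Q_scale:
  assumes "0 < z" "t \<in> orthant d"
  obtains t' where "t' \<in> orthant d" "Q t' = complex_of_real z \<odot>\<^bsub>A\<^esub> Q t"
proof
  \<comment> \<open>\<open>Q\<close> is homogeneous of degree \<open>d + 1\<close>.\<close>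
  define s where "s = root (Suc d) z"
  have s: "s > 0" "s ^ Suc d = z" using assms(1) by (simp_all add: s_def del: power_Suc)
  let ?t = "\<lambda>i\<in>{..<d}. s * t i"
  show "?t \<in> orthant d" using assms(2) s(1) by (auto simp: orthant_def PiE_iff)
  have "(\<Prod>j<d. ?t j) = s ^ d * (\<Prod>j<d. t j)" by (simp add: prod.distrib)
  then have e: "?t i * (\<Prod>j<d. ?t j) / 2 = z * (t i * (\<Prod>j<d. t j) / 2)" if "i < d" for i
    using that s(2) by (simp add: algebra_simps)
  show "Q ?t = complex_of_real z \<odot>\<^bsub>A\<^esub> Q t"
    unfolding profile_elt_def S.lin_comb_smult[OF basis_mem, symmetric]
    by (rule S.lin_comb_cong[OF basis_mem]) (simp only: e of_real_mult)
qed

text \<open>By homogeneity of the profile every homogeneous part of a polynomial identity vanishes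
  separately: if the coefficient of degree \<open>k\<close> is not zero, then the \<open>k\<close>-th power of every positive
  combination of the basis annihilates \<open>w0\<close>.  This extends along lines from the positive cone to all
  real and then to all complex combinations, so also the identity element annihilates \<open>w0\<close>.\<close>

theorem profile_free:
  assumes C: "C \<subseteq> carrier M" "\<And>r x. r \<in> carrier A \<Longrightarrow> x \<in> C \<Longrightarrow> r \<odot>\<^bsub>M\<^esub> x \<in> C"
    and w0: "w0 \<in> C" "w0 \<noteq> \<zero>\<^bsub>M\<^esub>"
    and zero: "\<And>t w. t \<in> orthant d \<Longrightarrow> w \<in> C \<Longrightarrow> poly_act A M (Q t) p w = \<zero>\<^bsub>M\<^esub>"
  shows "p = 0"
proof (rule poly_eqI, rule ccontr)
  fix k assume "coeff p k \<noteq> coeff 0 k"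
  then have k: "coeff p k \<noteq> 0" by simp
  have eq0: "x = \<zero>\<^bsub>M\<^esub>" if "x \<in> carrier M" "\<And>f. functional (cspace A M) f \<Longrightarrow> f x = 0" for x :: 'm
  proof (rule V.coords_eqI[OF coords])
    fix f assume f: "functional (cspace A M) f"
    show "f x = f \<zero>\<^bsub>M\<^esub>" using that(2)[OF f] V.functional_zero[OF f] by simp
  qed (use that(1) in simp_all)
  define nil where "nil r \<longleftrightarrow> r \<in> carrier A \<and> act_pow r k w0 = \<zero>\<^bsub>M\<^esub>" for r
  have w0M: "w0 \<in> carrier M" using C(1) w0(1) by auto
  have line: "nil (x \<oplus>\<^bsub>A\<^esub> s \<odot>\<^bsub>A\<^esub> y)"
    if xy: "x \<in> carrier A" "y \<in> carrier A" and Z: "infinite Z" "\<And>s. s \<in> Z \<Longrightarrow> nil (x \<oplus>\<^bsub>A\<^esub> s \<odot>\<^bsub>A\<^esub> y)" for x y :: 'a and s Z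
  proof -
    have r: "x \<oplus>\<^bsub>A\<^esub> s \<odot>\<^bsub>A\<^esub> y \<in> carrier A" using xy S.smult_closed'[OF xy(2)] by simp
    have "act_pow (x \<oplus>\<^bsub>A\<^esub> s \<odot>\<^bsub>A\<^esub> y) k w0 = \<zero>\<^bsub>M\<^esub>"
    proof (rule eq0[OF act_pow_closed[OF r w0M]])
      fix f assume f: "functional (cspace A M) f"
      obtain P where P: "\<And>s. f (act_pow (x \<oplus>\<^bsub>A\<^esub> s \<odot>\<^bsub>A\<^esub> y) k w0) = poly P s"
        using act_pow_line_polynomial[OF f xy w0M] by blast
      have "P = 0"
        by (rule poly_zero_if_infinite_zeros[OF Z(1)])
          (use Z(2) V.functional_zero[OF f] in \<open>simp add: nil_def flip: P\<close>)
      then show "f (act_pow (x \<oplus>\<^bsub>A\<^esub> s \<odot>\<^bsub>A\<^esub> y) k w0) = 0" using P by simp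
    qed
    with r show ?thesis by (simp add: nil_def)
  qed
  have pow0: "act_pow (Q t) k w0 = \<zero>\<^bsub>M\<^esub>" if t: "t \<in> orthant d" for t
  proof (rule eq0[OF act_pow_closed[OF Q_mem w0M]])
    fix f assume f: "functional (cspace A M) f"
    obtain P where P: "\<And>k. coeff P k = coeff p k * f (act_pow (Q t) k w0)"
      "\<And>z. f (poly_act A M (z \<odot>\<^bsub>A\<^esub> Q t) p w0) = poly P z"
      using poly_act_scale_polynomial[OF f Q_mem w0M, of p] by blast
    have "poly P z = 0" if z: "z \<in> complex_of_real ` {0<..}" for z
    proof -
      obtain x where x: "0 < x" "z = complex_of_real x" using z by auto
      obtain t' where t': "t' \<in> orthant d" "Q t' = z \<odot>\<^bsub>A\<^esub> Q t" using Q_scale[OF x(1) t] x(2) by metis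
      show ?thesis using zero[OF t'(1) w0(1)] P(2)[of z] V.functional_zero[OF f] t'(2) by simp
    qed
    then have "P = 0" by (rule poly_zero_if_infinite_zeros[OF infinite_of_real_greaterThan])
    then show "f (act_pow (Q t) k w0) = 0" using P(1)[of k] k by simp
  qed
  \<comment> \<open>\<open>Q t\<close> is a nonzero multiple of \<open>real_comb t\<close> when all \<open>t i\<close> are positive.\<close>
  have pos: "nil (real_comb v)" if v: "\<And>i. i < d \<Longrightarrow> 0 < v i" for v :: "nat \<Rightarrow> real"
  proof -
    let ?t = "\<lambda>i\<in>{..<d}. v i"
    define z where "z = complex_of_real ((\<Prod>j<d. ?t j) / 2)"
    have "(\<Prod>j<d. ?t j) > 0" by (rule prod_pos) (use v in simp)
    then have z: "z \<noteq> 0" unfolding z_def of_real_eq_0_iff by linarith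
    have t: "?t \<in> orthant d" using v by (auto simp: orthant_def intro: less_imp_le)
    have rc: "real_comb ?t = real_comb v" by (rule S.lin_comb_cong[OF basis_mem]) simp
    have "(z ^ k) \<odot>\<^bsub>cspace A M\<^esub> act_pow (real_comb v) k w0 = \<zero>\<^bsub>M\<^esub>"
      using pow0[OF t] unfolding Q_eq rc z_def[symmetric] using act_pow_scale[OF lin_comb_mem w0M] by simp
    then have "act_pow (real_comb v) k w0 = \<zero>\<^bsub>M\<^esub>"
      using V.smult_eq_zero[of "act_pow (real_comb v) k w0" "z ^ k"] act_pow_closed[OF lin_comb_mem w0M] z by simp
    then show ?thesis by (simp add: nil_def)
  qed
  \<comment> \<open>The line through \<open>v\<close> in the direction of the sum of the basis enters the positive cone.\<close>
  have real: "nil (real_comb v)" for v :: "nat \<Rightarrow> real"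
  proof -
    have e: "real_comb v \<oplus>\<^bsub>A\<^esub> complex_of_real s \<odot>\<^bsub>A\<^esub> real_comb (\<lambda>_. 1) = real_comb (\<lambda>i. v i + s)" for s
      unfolding lin_comb_add_scale by simp
    have "nil (real_comb v \<oplus>\<^bsub>A\<^esub> 0 \<odot>\<^bsub>A\<^esub> real_comb (\<lambda>_. 1))"
    proof (rule line[OF lin_comb_mem lin_comb_mem infinite_of_real_greaterThan])
      fix s assume "s \<in> complex_of_real ` {(\<Sum>i<d. \<bar>v i\<bar>)<..}"
      then obtain x where x: "s = complex_of_real x" "(\<Sum>i<d. \<bar>v i\<bar>) < x" by auto
      have "0 < v i + x" if "i < d" for i
        using member_le_sum[of i "{..<d}" "\<lambda>i. \<bar>v i\<bar>"] that x(2) by auto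
      then show "nil (real_comb v \<oplus>\<^bsub>A\<^esub> s \<odot>\<^bsub>A\<^esub> real_comb (\<lambda>_. 1))"
        unfolding x(1) e by (rule pos)
    qed
    then show ?thesis unfolding lin_comb_add_scale by simp
  qed
  \<comment> \<open>Real and imaginary parts span a line whose real points are real combinations.\<close>
  have "nil \<one>\<^bsub>A\<^esub>"
  proof -
    obtain c where c: "\<one>\<^bsub>A\<^esub> = lin_comb A d a c" using basis one_closed unfolding is_basis_def by blast
    let ?x = "real_comb (\<lambda>i. Re (c i))" and ?y = "real_comb (\<lambda>i. Im (c i))"
    have "nil (?x \<oplus>\<^bsub>A\<^esub> \<i> \<odot>\<^bsub>A\<^esub> ?y)"
    proof (rule line[OF lin_comb_mem lin_comb_mem infinite_of_real_greaterThan[of 0]])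
      fix s assume "s \<in> complex_of_real ` {0<..}"
      then obtain x where x: "s = complex_of_real x" by auto
      have "?x \<oplus>\<^bsub>A\<^esub> s \<odot>\<^bsub>A\<^esub> ?y = real_comb (\<lambda>i. Re (c i) + x * Im (c i))"
        unfolding lin_comb_add_scale x by simp
      with real[of "\<lambda>i. Re (c i) + x * Im (c i)"] show "nil (?x \<oplus>\<^bsub>A\<^esub> s \<odot>\<^bsub>A\<^esub> ?y)" by (simp only:)
    qed
    then show ?thesis unfolding lin_comb_add_scale c by (simp flip: complex_eq)
  qed
  then show False using act_pow_one[OF w0M] w0(2) by (simp add: nil_def)
qed

end

section \<open>Internal direct sums\<close>

lemma submoduleD:
  assumes "submodule H A M"
  shows "H \<subseteq> carrier M" "\<zero>\<^bsub>M\<^esub> \<in> H" "x \<in> H \<Longrightarrow> y \<in> H \<Longrightarrow> x \<oplus>\<^bsub>M\<^esub> y \<in> H"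
    "r \<in> carrier A \<Longrightarrow> x \<in> H \<Longrightarrow> r \<odot>\<^bsub>M\<^esub> x \<in> H"
  using submodule.smult_closed[OF assms] subgroup.subset[OF submodule.axioms(1)[OF assms]]
    subgroup.one_closed[OF submodule.axioms(1)[OF assms]] subgroup.m_closed[OF submodule.axioms(1)[OF assms]]
  by simp_all

lemma (in lmod) component_subset_sub_sum:
  assumes C: "\<And>j. j \<in> J \<Longrightarrow> submodule (C j) A M" and j: "j \<in> J"
  shows "C j \<subseteq> sub_sum M J C"
proof
  fix w assume w: "w \<in> C j"
  let ?f = "\<lambda>i\<in>J. if i = j then w else \<zero>\<^bsub>M\<^esub>"
  have fin: "finite {i \<in> J. ?f i \<noteq> \<zero>\<^bsub>M\<^esub>}" by (rule finite_subset[of _ "{j}"]) auto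
  have "?f i \<in> C i" if "i \<in> J" for i using that w submoduleD(2)[OF C[OF that]] by simp
  then have m: "?f \<in> carrier (direct_sum J (\<lambda>j. M\<lparr>carrier := C j\<rparr>))" using fin by simp
  have e: "sum_map M J ?f = w"
  proof (cases "w = \<zero>\<^bsub>M\<^esub>")
    case True
    then have e: "{i \<in> J. ?f i \<noteq> \<zero>\<^bsub>M\<^esub>} = {}" by auto
    show ?thesis unfolding sum_map_def e by (simp add: True)
  next
    case False
    then have e: "{i \<in> J. ?f i \<noteq> \<zero>\<^bsub>M\<^esub>} = {j}" using j by auto
    have "w \<in> carrier M" using w submoduleD(1)[OF C[OF j]] by auto
    then show ?thesis unfolding sum_map_def e using j by simp
  qed
  show "w \<in> sub_sum M J C" using imageI[OF m, of "sum_map M J"] unfolding e sub_sum_def .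
qed

lemma (in lmod) internal_direct_sum_induct:
  assumes J: "internal_direct_sum A M J C" and w: "w \<in> carrier M"
    and zero: "P \<zero>\<^bsub>M\<^esub>" and comp: "\<And>j x. j \<in> J \<Longrightarrow> x \<in> C j \<Longrightarrow> P x"
    and add: "\<And>x y. x \<in> carrier M \<Longrightarrow> y \<in> carrier M \<Longrightarrow> P x \<Longrightarrow> P y \<Longrightarrow> P (x \<oplus>\<^bsub>M\<^esub> y)"
  shows "P w"
proof -
  have C: "submodule (C j) A M" if "j \<in> J" for j using J that by (simp add: internal_direct_sum_def)
  have "w \<in> sum_map M J ` carrier (direct_sum J (\<lambda>j. M\<lparr>carrier := C j\<rparr>))"
    using J w unfolding internal_direct_sum_def bij_betw_def by blast
  then obtain f where f: "f \<in> carrier (direct_sum J (\<lambda>j. M\<lparr>carrier := C j\<rparr>))" "w = sum_map M J f" by blast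
  have fin: "finite {j \<in> J. f j \<noteq> \<zero>\<^bsub>M\<^esub>}" and fC: "\<And>j. j \<in> J \<Longrightarrow> f j \<in> C j"
    using f(1) by (simp_all add: PiE_iff)
  have "finsum M f F \<in> carrier M \<and> P (finsum M f F)" if "finite F" "F \<subseteq> J" for F
    using that
  proof (induction F)
    case empty
    show ?case using zero by simp
  next
    case (insert j F)
    have fj: "f j \<in> carrier M" using fC[of j] submoduleD(1)[OF C[of j]] insert.prems by auto
    have "f \<in> F \<rightarrow> carrier M" using fC submoduleD(1)[OF C] insert.prems by blast
    then have "finsum M f (insert j F) = f j \<oplus>\<^bsub>M\<^esub> finsum M f F" using insert.hyps fj by simp
    moreover have "P (f j)" using comp fC insert.prems by blast
    ultimately show ?case using insert.IH insert.prems fj add[OF fj, of "finsum M f F"] by simp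
  qed
  from this[OF fin] show ?thesis unfolding f(2) sum_map_def by simp
qed

section \<open>Coefficient rings as rings of polynomial families\<close>

definition poly_families :: "'j set \<Rightarrow> ('j \<Rightarrow> complex poly) set" where
  "poly_families J = {p. (\<forall>j. j \<notin> J \<longrightarrow> p j = 0) \<and> finite {j. p j \<noteq> 0} \<and> (\<forall>j. coeff (p j) 0 = 0)}"

lemma poly_families_induct [consumes 1, case_names zero single add]:
  assumes p: "p \<in> poly_families J" and zero: "P (\<lambda>_. 0)"
    and single: "\<And>j q. j \<in> J \<Longrightarrow> P (\<lambda>i. if i = j then pCons 0 q else 0)"
    and add: "\<And>p q. P p \<Longrightarrow> P q \<Longrightarrow> P (\<lambda>i. p i + q i)"
  shows "P p"
proof -
  have "P p" if "finite F" "p \<in> poly_families J" "{j. p j \<noteq> 0} \<subseteq> F" for F p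
    using that
  proof (induction F arbitrary: p)
    case empty
    then have "p = (\<lambda>_. 0)" by auto
    then show ?case using zero by simp
  next
    case (insert j F)
    show ?case
    proof (cases "p j = 0")
      case True
      then show ?thesis using insert by (intro insert.IH) auto
    next
      case False
      then have j: "j \<in> J" using insert.prems by (auto simp: poly_families_def)
      have "coeff (p j) 0 = 0" using insert.prems by (simp add: poly_families_def)
      then obtain q where q: "p j = pCons 0 q" by (cases "p j") simp
      have "finite {i. (p(j := 0)) i \<noteq> 0}" by (rule finite_subset[of _ "{i. p i \<noteq> 0}"])
          (use insert.prems in \<open>auto simp: poly_families_def\<close>)
      then have m: "p(j := 0) \<in> poly_families J" using insert.prems by (auto simp: poly_families_def)
      have "P (p(j := 0))" by (rule insert.IH[OF m]) (use insert.prems in auto)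
      then have "P (\<lambda>i. (if i = j then pCons 0 q else 0) + (p(j := 0)) i)" by (rule add[OF single[OF j]])
      moreover have "(\<lambda>i. (if i = j then pCons 0 q else 0) + (p(j := 0)) i) = p" using q by auto
      ultimately show ?thesis by simp
    qed
  qed
  from this[OF _ p order_refl] p show ?thesis by (simp add: poly_families_def)
qed

text \<open>The non-unital algebra \<open>R\<close> is a direct sum, over the index set \<open>J\<close>, of copies of the algebra of
  polynomials without constant term.\<close>

definition poly_family_iso :: "('r \<Rightarrow> 'j \<Rightarrow> complex poly) \<Rightarrow> (complex, 'r) module \<Rightarrow> 'j set \<Rightarrow> bool" where
  "poly_family_iso \<theta> R J \<longleftrightarrow> bij_betw \<theta> (carrier R) (poly_families J) \<and>
    (\<forall>x\<in>carrier R. \<forall>y\<in>carrier R.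
      x \<oplus>\<^bsub>R\<^esub> y \<in> carrier R \<and> \<theta> (x \<oplus>\<^bsub>R\<^esub> y) = (\<lambda>j. \<theta> x j + \<theta> y j) \<and>
      x \<otimes>\<^bsub>R\<^esub> y \<in> carrier R \<and> \<theta> (x \<otimes>\<^bsub>R\<^esub> y) = (\<lambda>j. \<theta> x j * \<theta> y j)) \<and>
    (\<forall>c. \<forall>x\<in>carrier R.
      c \<odot>\<^bsub>R\<^esub> x \<in> carrier R \<and> \<theta> (c \<odot>\<^bsub>R\<^esub> x) = (\<lambda>j. Polynomial.smult c (\<theta> x j)))"

definition is_poly_family_ring :: "(complex, 'r) module \<Rightarrow> 'j set \<Rightarrow> bool" where
  "is_poly_family_ring R J \<longleftrightarrow> (\<exists>\<theta>. poly_family_iso \<theta> R J)"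

lemma poly_family_isoD:
  assumes "poly_family_iso \<theta> R J"
  shows "bij_betw \<theta> (carrier R) (poly_families J)"
    and "\<lbrakk>x \<in> carrier R; y \<in> carrier R\<rbrakk> \<Longrightarrow> x \<oplus>\<^bsub>R\<^esub> y \<in> carrier R \<and> \<theta> (x \<oplus>\<^bsub>R\<^esub> y) = (\<lambda>j. \<theta> x j + \<theta> y j)"
    and "\<lbrakk>x \<in> carrier R; y \<in> carrier R\<rbrakk> \<Longrightarrow> x \<otimes>\<^bsub>R\<^esub> y \<in> carrier R \<and> \<theta> (x \<otimes>\<^bsub>R\<^esub> y) = (\<lambda>j. \<theta> x j * \<theta> y j)"
    and "x \<in> carrier R \<Longrightarrow> c \<odot>\<^bsub>R\<^esub> x \<in> carrier R \<and> \<theta> (c \<odot>\<^bsub>R\<^esub> x) = (\<lambda>j. Polynomial.smult c (\<theta> x j))"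
  using assms by (simp_all add: poly_family_iso_def)

locale graded_lmod = based_lmod A M d a \<kappa> for A :: "(complex, 'a) module" and M :: "('a, 'm) module"
    and d a and \<kappa> :: "'m \<Rightarrow> 'i \<Rightarrow> complex" +
  fixes J :: "'j set" and C :: "'j \<Rightarrow> 'm set"
  assumes decomp: "internal_direct_sum A M J C" and nontrivial: "j \<in> J \<Longrightarrow> \<exists>w\<in>C j. w \<noteq> \<zero>\<^bsub>M\<^esub>"
begin

abbreviation E :: "(complex, (nat \<Rightarrow> real) \<Rightarrow> 'm \<Rightarrow> 'm) module" where
  "E \<equiv> map_algebra (orthant d) (end_algebra (cspace A M))"

sublocale E: complex_space E
  by (rule complex_space.complex_space_map[OF V.complex_space_end])

lemma C_submodule: "j \<in> J \<Longrightarrow> submodule (C j) A M"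
  using decomp by (simp add: internal_direct_sum_def)

lemma C_closed: "j \<in> J \<Longrightarrow> w \<in> C j \<Longrightarrow> w \<in> carrier M"
  using submoduleD(1)[OF C_submodule] by blast

lemma poly_act_C: "j \<in> J \<Longrightarrow> w \<in> C j \<Longrightarrow> r \<in> carrier A \<Longrightarrow> poly_act A M r p w \<in> C j"
  by (rule poly_act_stable) (use submoduleD[OF C_submodule] in auto)

text \<open>\<open>x\<close> acts on the component \<open>C j\<close> as the polynomial \<open>p j\<close> in the integral profile.\<close>

definition rep :: "((nat \<Rightarrow> real) \<Rightarrow> 'm \<Rightarrow> 'm) \<Rightarrow> ('j \<Rightarrow> complex poly) \<Rightarrow> bool" where
  "rep x p \<longleftrightarrow> (\<forall>t\<in>orthant d. \<forall>j\<in>J. \<forall>w\<in>C j. x t w = poly_act A M (Q t) (p j) w)"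

lemma repD: "rep x p \<Longrightarrow> t \<in> orthant d \<Longrightarrow> j \<in> J \<Longrightarrow> w \<in> C j \<Longrightarrow> x t w = poly_act A M (Q t) (p j) w"
  by (simp add: rep_def)

lemma rep_zero: "rep \<zero>\<^bsub>E\<^esub> (\<lambda>_. 0)"
  using C_closed by (simp add: rep_def)

lemma rep_add: "rep x p \<Longrightarrow> rep y q \<Longrightarrow> rep (x \<oplus>\<^bsub>E\<^esub> y) (\<lambda>j. p j + q j)"
  using C_closed by (simp add: rep_def poly_act_add)

lemma rep_smult: "rep x p \<Longrightarrow> rep (c \<odot>\<^bsub>E\<^esub> x) (\<lambda>j. Polynomial.smult c (p j))"
  using C_closed by (simp add: rep_def poly_act_smult)

lemma rep_mult:
  assumes x: "rep x p" and y: "rep y q"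
  shows "rep (x \<otimes>\<^bsub>E\<^esub> y) (\<lambda>j. p j * q j)"
  unfolding rep_def
proof (intro ballI)
  fix t j w assume t: "t \<in> orthant d" and j: "j \<in> J" and w: "w \<in> C j"
  have "(x \<otimes>\<^bsub>E\<^esub> y) t w = x t (y t w)" using t C_closed[OF j w] by (simp add: compose_def)
  also have "\<dots> = poly_act A M (Q t) (p j) (poly_act A M (Q t) (q j) w)"
    using repD[OF y t j w] repD[OF x t j poly_act_C[OF j w Q_mem]] by simp
  also have "\<dots> = poly_act A M (Q t) (p j * q j) w"
    by (rule poly_act_mult[OF Q_mem C_closed[OF j w], symmetric])
  finally show "(x \<otimes>\<^bsub>E\<^esub> y) t w = poly_act A M (Q t) (p j * q j) w" .
qed

lemma rep_cong: "rep x p \<Longrightarrow> (\<And>j. j \<in> J \<Longrightarrow> p j = q j) \<Longrightarrow> rep x q"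
  by (simp add: rep_def)

text \<open>The freeness of the profile makes the representing polynomials unique on each component.\<close>

lemma rep_poly_unique:
  assumes "rep x p" "rep x q" "j \<in> J"
  shows "p j = q j"
proof -
  obtain w0 where w0: "w0 \<in> C j" "w0 \<noteq> \<zero>\<^bsub>M\<^esub>" using nontrivial[OF assms(3)] by blast
  have "p j + Polynomial.smult (- 1) (q j) = 0"
  proof (rule profile_free[OF submoduleD(1)[OF C_submodule[OF assms(3)]] submoduleD(4)[OF C_submodule[OF assms(3)]] w0])
    fix t w assume t: "t \<in> orthant d" and w: "w \<in> C j"
    let ?u = "poly_act A M (Q t) (p j) w"
    have wM: "w \<in> carrier M" by (rule C_closed[OF assms(3) w])
    have u: "?u \<in> carrier M" using wM by simp
    have "poly_act A M (Q t) (q j) w = ?u"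
      using repD[OF assms(1) t assms(3) w] repD[OF assms(2) t assms(3) w] by simp
    then have "poly_act A M (Q t) (p j + Polynomial.smult (- 1) (q j)) w = ?u \<oplus>\<^bsub>M\<^esub> (- 1) \<odot>\<^bsub>cspace A M\<^esub> ?u"
      by (simp only: poly_act_add[OF Q_mem wM] poly_act_smult[OF Q_mem wM])
    also have "\<dots> = \<zero>\<^bsub>M\<^esub>" using V.smult_minus_one[of ?u] u M.r_neg[OF u] by simp
    finally show "poly_act A M (Q t) (p j + Polynomial.smult (- 1) (q j)) w = \<zero>\<^bsub>M\<^esub>" .
  qed simp_all
  then show ?thesis by simp
qed

lemma rep_map_unique:
  assumes x: "x \<in> carrier E" "rep x p" and y: "y \<in> carrier E" "rep y p"
  shows "x = y"
proof (rule PiE_ext[OF x(1)[unfolded map_algebra_simps] y(1)[unfolded map_algebra_simps]])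
  fix t assume t: "t \<in> orthant d"
  have xt: "x t \<in> mod_hom cplx (cspace A M) (cspace A M)" and yt: "y t \<in> mod_hom cplx (cspace A M) (cspace A M)"
    using PiE_mem[OF x(1)[unfolded map_algebra_simps] t] PiE_mem[OF y(1)[unfolded map_algebra_simps] t] by simp_all
  show "x t = y t"
  proof (rule V.end_eqI[OF xt yt])
    fix w assume "w \<in> carrier (cspace A M)"
    then have "w \<in> carrier M" by simp
    then show "x t w = y t w"
    proof (rule internal_direct_sum_induct[OF decomp])
      have "\<zero>\<^bsub>M\<^esub> \<in> carrier (cspace A M)" by simp
      from V.endD(3)[OF xt this, of 0] V.endD(3)[OF yt this, of 0] V.endD(1)[OF xt this] V.endD(1)[OF yt this]
      show "x t \<zero>\<^bsub>M\<^esub> = y t \<zero>\<^bsub>M\<^esub>"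
        using V.smult_zero[of "\<zero>\<^bsub>M\<^esub>"] V.smult_zero[of "x t \<zero>\<^bsub>M\<^esub>"] V.smult_zero[of "y t \<zero>\<^bsub>M\<^esub>"] by simp
    next
      fix j w assume "j \<in> J" "w \<in> C j"
      then show "x t w = y t w" using repD[OF x(2) t] repD[OF y(2) t] by simp
    next
      fix u v assume uv: "u \<in> carrier M" "v \<in> carrier M" "x t u = y t u" "x t v = y t v"
      then show "x t (u \<oplus>\<^bsub>M\<^esub> v) = y t (u \<oplus>\<^bsub>M\<^esub> v)"
        using V.endD(2)[OF xt, of u v] V.endD(2)[OF yt, of u v] by simp
    qed
  qed
qed

lemma subalgebraD:
  assumes "nonunital_subalgebra E H"
  shows "H \<subseteq> carrier E" "\<zero>\<^bsub>E\<^esub> \<in> H" "x \<in> H \<Longrightarrow> y \<in> H \<Longrightarrow> x \<oplus>\<^bsub>E\<^esub> y \<in> H" "x \<in> H \<Longrightarrow> c \<odot>\<^bsub>E\<^esub> x \<in> H"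
    "x \<in> H \<Longrightarrow> y \<in> H \<Longrightarrow> x \<otimes>\<^bsub>E\<^esub> y \<in> H"
proof -
  have s: "submodule H cplx E" using assms by (simp add: nonunital_subalgebra_def)
  show "H \<subseteq> carrier E" by (rule submoduleD(1)[OF s])
  show "\<zero>\<^bsub>E\<^esub> \<in> H" by (rule submoduleD(2)[OF s])
  show "x \<in> H \<Longrightarrow> y \<in> H \<Longrightarrow> x \<oplus>\<^bsub>E\<^esub> y \<in> H" by (rule submoduleD(3)[OF s])
  show "x \<in> H \<Longrightarrow> c \<odot>\<^bsub>E\<^esub> x \<in> H" by (rule submoduleD(4)[OF s]) simp_all
  show "x \<in> H \<Longrightarrow> y \<in> H \<Longrightarrow> x \<otimes>\<^bsub>E\<^esub> y \<in> H" using assms unfolding nonunital_subalgebra_def by blast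
qed

lemma mult_closed: "x \<in> carrier E \<Longrightarrow> y \<in> carrier E \<Longrightarrow> x \<otimes>\<^bsub>E\<^esub> y \<in> carrier E"
proof -
  assume xy: "x \<in> carrier E" "y \<in> carrier E"
  have "compose (carrier (cspace A M)) (x t) (y t) \<in> mod_hom cplx (cspace A M) (cspace A M)" if t: "t \<in> orthant d" for t
  proof -
    have xt: "x t \<in> mod_hom cplx (cspace A M) (cspace A M)" and yt: "y t \<in> mod_hom cplx (cspace A M) (cspace A M)"
      using PiE_mem[OF xy(1)[unfolded map_algebra_simps] t] PiE_mem[OF xy(2)[unfolded map_algebra_simps] t] by simp_all
    show ?thesis
      by (rule V.endI) (use V.endD(1-3)[OF xt] V.endD(1-3)[OF yt] in \<open>simp_all add: compose_def\<close>)
  qed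
  then show ?thesis by simp
qed

definition represented :: "((nat \<Rightarrow> real) \<Rightarrow> 'm \<Rightarrow> 'm) set" where
  "represented = {x \<in> carrier E. \<exists>p\<in>poly_families J. rep x p}"

lemma representedI: "x \<in> carrier E \<Longrightarrow> p \<in> poly_families J \<Longrightarrow> rep x p \<Longrightarrow> x \<in> represented"
  unfolding represented_def by blast

lemma representedE:
  assumes "x \<in> represented"
  obtains p where "x \<in> carrier E" "p \<in> poly_families J" "rep x p"
  using assms unfolding represented_def by blast

lemma poly_families_closed:
  assumes "p \<in> poly_families J" "q \<in> poly_families J"
  shows "(\<lambda>j. p j + q j) \<in> poly_families J" "(\<lambda>j. p j * q j) \<in> poly_families J"
    "(\<lambda>j. Polynomial.smult c (p j)) \<in> poly_families J" "(\<lambda>j. 0) \<in> poly_families J"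
proof -
  have fin: "finite {j. p j \<noteq> 0}" "finite {j. q j \<noteq> 0}" using assms by (auto simp: poly_families_def)
  have "finite {j. p j + q j \<noteq> 0}" by (rule finite_subset[OF _ finite_UnI[OF fin]]) auto
  then show "(\<lambda>j. p j + q j) \<in> poly_families J" using assms by (simp add: poly_families_def)
  have "finite {j. p j * q j \<noteq> 0}" by (rule finite_subset[OF _ fin(1)]) auto
  then show "(\<lambda>j. p j * q j) \<in> poly_families J" using assms by (simp add: poly_families_def coeff_mult_0)
  have "finite {j. Polynomial.smult c (p j) \<noteq> 0}" by (rule finite_subset[OF _ fin(1)]) auto
  then show "(\<lambda>j. Polynomial.smult c (p j)) \<in> poly_families J" using assms by (simp add: poly_families_def)
  show "(\<lambda>j. 0) \<in> poly_families J" by (simp add: poly_families_def)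
qed

lemma represented_subalgebra: "nonunital_subalgebra E represented"
  unfolding nonunital_subalgebra_def
proof (intro conjI ballI)
  have smult: "c \<odot>\<^bsub>E\<^esub> x \<in> represented" if x: "x \<in> represented" for c x
  proof -
    obtain p where p: "x \<in> carrier E" "p \<in> poly_families J" "rep x p" using x by (rule representedE)
    show ?thesis
      by (rule representedI[OF E.smult_closed'[OF p(1)] poly_families_closed(3)[OF p(2) p(2)] rep_smult[OF p(3)]])
  qed
  show "submodule represented cplx E"
  proof (rule E.submoduleI)
    show "represented \<subseteq> carrier E" unfolding represented_def by blast
    show "\<zero>\<^bsub>E\<^esub> \<in> represented"
      by (rule representedI[OF E.zero_closed _ rep_zero]) (simp add: poly_families_def)
    fix x assume x: "x \<in> represented"
    then have "x \<in> carrier E" unfolding represented_def by blast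
    then show "\<ominus>\<^bsub>E\<^esub> x \<in> represented" using smult[OF x, of "- 1"] E.smult_minus_one[of x] by metis
  next
    fix x y assume "x \<in> represented" "y \<in> represented"
    then obtain p q where p: "x \<in> carrier E" "p \<in> poly_families J" "rep x p"
      and q: "y \<in> carrier E" "q \<in> poly_families J" "rep y q" by (elim representedE)
    show "x \<oplus>\<^bsub>E\<^esub> y \<in> represented"
      by (rule representedI[OF E.M.a_closed[OF p(1) q(1)] poly_families_closed(1)[OF p(2) q(2)] rep_add[OF p(3) q(3)]])
  next
    fix c x assume "x \<in> represented"
    then show "c \<odot>\<^bsub>E\<^esub> x \<in> represented" by (rule smult)
  qed
next
  fix x y assume "x \<in> represented" "y \<in> represented"
  then obtain p q where p: "x \<in> carrier E" "p \<in> poly_families J" "rep x p"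
    and q: "y \<in> carrier E" "q \<in> poly_families J" "rep y q" by (elim representedE)
  show "x \<otimes>\<^bsub>E\<^esub> y \<in> represented"
    by (rule representedI[OF mult_closed[OF p(1) q(1)] poly_families_closed(2)[OF p(2) q(2)] rep_mult[OF p(3) q(3)]])
qed

text \<open>Once the profile itself is available on every single component, so is every polynomial without
  constant term, by Horner's scheme inside the subalgebra; a finite family is a sum of such terms.\<close>

lemma subalgebra_represents:
  assumes H: "nonunital_subalgebra E H"
    and single: "\<And>j. j \<in> J \<Longrightarrow> \<exists>x\<in>H. rep x (\<lambda>i. if i = j then [:0, 1:] else 0)"
    and p: "p \<in> poly_families J"
  shows "\<exists>x\<in>H. rep x p"
  using p
proof (induction rule: poly_families_induct)
  case zero
  show ?case by (rule bexI[of _ "\<zero>\<^bsub>E\<^esub>"]) (rule rep_zero subalgebraD(2)[OF H])+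
next
  case (single j q)
  obtain x where x: "x \<in> H" "rep x (\<lambda>i. if i = j then [:0, 1:] else 0)" using assms(2)[OF single] by blast
  show ?case
  proof (induction q)
    case 0
    have "rep \<zero>\<^bsub>E\<^esub> (\<lambda>i. if i = j then pCons 0 0 else 0)" by (rule rep_cong[OF rep_zero]) simp
    then show ?case using subalgebraD(2)[OF H] by (rule bexI)
  next
    case (pCons c q)
    then obtain y where y: "y \<in> H" "rep y (\<lambda>i. if i = j then pCons 0 q else 0)" by blast
    have "rep (c \<odot>\<^bsub>E\<^esub> x \<oplus>\<^bsub>E\<^esub> x \<otimes>\<^bsub>E\<^esub> y) (\<lambda>i. if i = j then pCons 0 (pCons c q) else 0)"
      by (rule rep_cong[OF rep_add[OF rep_smult[OF x(2)] rep_mult[OF x(2) y(2)]]]) simp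
    moreover have "c \<odot>\<^bsub>E\<^esub> x \<oplus>\<^bsub>E\<^esub> x \<otimes>\<^bsub>E\<^esub> y \<in> H"
      by (intro subalgebraD(3)[OF H] subalgebraD(4)[OF H] subalgebraD(5)[OF H] x y)
    ultimately show ?case by blast
  qed
next
  case (add p q)
  then obtain x y where x: "x \<in> H" "rep x p" and y: "y \<in> H" "rep y q" by (elim bexE)
  show ?case
  proof (rule bexI[of _ "x \<oplus>\<^bsub>E\<^esub> y"])
    show "rep (x \<oplus>\<^bsub>E\<^esub> y) (\<lambda>i. p i + q i)" by (rule rep_add[OF x(2) y(2)])
    show "x \<oplus>\<^bsub>E\<^esub> y \<in> H" by (intro subalgebraD(3)[OF H] x y)
  qed
qed

text \<open>The represented maps form a subalgebra, and a subalgebra containing \<open>G\<close> represents every family, so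
  by uniqueness of the represented map the subalgebra generated by \<open>G\<close> consists of all represented
  maps.\<close>

theorem hull_iso_poly_families:
  assumes G: "G \<subseteq> represented"
    and single: "\<forall>j\<in>J. \<exists>x\<in>G. \<exists>y\<in>G. \<exists>p q. rep x p \<and> rep y q \<and>
        (\<forall>i\<in>J. p i - q i = (if i = j then [:0, 1:] else 0))"
  shows "is_poly_family_ring (E\<lparr>carrier := nonunital_subalgebra E hull G\<rparr>) J"
proof -
  have sub: "\<exists>x\<in>H. rep x p" if H: "nonunital_subalgebra E H" "G \<subseteq> H" and p: "p \<in> poly_families J" for H p
  proof (rule subalgebra_represents[OF H(1) _ p])
    fix j assume j: "j \<in> J"
    obtain x y p q where xy: "x \<in> G" "y \<in> G" "rep x p" "rep y q"
      and pq: "\<forall>i\<in>J. p i - q i = (if i = j then [:0, 1:] else 0)"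
      using bspec[OF single j] by (elim bexE exE conjE)
    have "rep (x \<oplus>\<^bsub>E\<^esub> (- 1) \<odot>\<^bsub>E\<^esub> y) (\<lambda>i. if i = j then [:0, 1:] else 0)"
      by (rule rep_cong[OF rep_add[OF xy(3) rep_smult[OF xy(4)]]]) (use pq in simp)
    moreover have "x \<oplus>\<^bsub>E\<^esub> (- 1) \<odot>\<^bsub>E\<^esub> y \<in> H"
      using xy(1,2) H(2) by (intro subalgebraD(3)[OF H(1)] subalgebraD(4)[OF H(1)]) auto
    ultimately show "\<exists>x\<in>H. rep x (\<lambda>i. if i = j then [:0, 1:] else 0)"
      by (intro bexI[of _ "x \<oplus>\<^bsub>E\<^esub> (- 1) \<odot>\<^bsub>E\<^esub> y"])
  qed
  have hull: "nonunital_subalgebra E hull G = represented"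
  proof
    show "nonunital_subalgebra E hull G \<subseteq> represented"
      by (rule hull_minimal[where S = "nonunital_subalgebra E"]) (rule G represented_subalgebra)+
    show "represented \<subseteq> nonunital_subalgebra E hull G"
    proof
      fix x assume "x \<in> represented"
      then obtain p where x: "x \<in> carrier E" "rep x p" and p: "p \<in> poly_families J" by (auto simp: represented_def)
      have "x \<in> H" if H: "nonunital_subalgebra E H" "G \<subseteq> H" for H
      proof -
        obtain y where y: "y \<in> H" "rep y p" using sub[OF H p] by blast
        then show ?thesis using rep_map_unique[OF x _ y(2)] subalgebraD(1)[OF H(1)] by blast
      qed
      then show "x \<in> nonunital_subalgebra E hull G" unfolding hull_def by blast
    qed
  qed
  have uniq: "p = q" if "p \<in> poly_families J" "q \<in> poly_families J" "rep x p" "rep x q" for x p q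
  proof
    fix j show "p j = q j"
      using rep_poly_unique[OF that(3,4)] that(1,2) by (cases "j \<in> J") (auto simp: poly_families_def)
  qed
  define \<theta> where "\<theta> x = (SOME p. p \<in> poly_families J \<and> rep x p)" for x
  have \<theta>: "\<theta> x \<in> poly_families J" "rep x (\<theta> x)" if "x \<in> represented" for x
  proof -
    have "\<exists>p. p \<in> poly_families J \<and> rep x p" using that by (auto simp: represented_def)
    from someI_ex[OF this] show "\<theta> x \<in> poly_families J" "rep x (\<theta> x)" by (simp_all add: \<theta>_def)
  qed
  have eq: "\<theta> x = p" if "x \<in> represented" "p \<in> poly_families J" "rep x p" for x p
    using uniq[OF \<theta>(1)[OF that(1)] that(2) \<theta>(2)[OF that(1)] that(3)] .
  note sR = subalgebraD[OF represented_subalgebra]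
  have "bij_betw \<theta> represented (poly_families J)"
  proof (rule bij_betw_imageI)
    show "inj_on \<theta> represented"
    proof
      fix x y assume xy: "x \<in> represented" "y \<in> represented" "\<theta> x = \<theta> y"
      show "x = y"
        by (rule rep_map_unique[OF subsetD[OF sR(1) xy(1)] \<theta>(2)[OF xy(1)]
              subsetD[OF sR(1) xy(2)] \<theta>(2)[OF xy(2), folded xy(3)]])
    qed
    show "\<theta> ` represented = poly_families J"
    proof
      show "\<theta> ` represented \<subseteq> poly_families J" using \<theta>(1) by blast
      show "poly_families J \<subseteq> \<theta> ` represented"
      proof
        fix p assume p: "p \<in> poly_families J"
        obtain x where "x \<in> represented" "rep x p" using sub[OF represented_subalgebra G p] by blast
        then show "p \<in> \<theta> ` represented" using eq[OF _ p] by (metis imageI)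
      qed
    qed
  qed
  moreover have "\<theta> (x \<oplus>\<^bsub>E\<^esub> y) = (\<lambda>j. \<theta> x j + \<theta> y j)"
    if xy: "x \<in> represented" "y \<in> represented" for x y
    by (rule eq[OF sR(3)[OF xy] poly_families_closed(1)[OF \<theta>(1)[OF xy(1)] \<theta>(1)[OF xy(2)]]
          rep_add[OF \<theta>(2)[OF xy(1)] \<theta>(2)[OF xy(2)]]])
  moreover have "\<theta> (x \<otimes>\<^bsub>E\<^esub> y) = (\<lambda>j. \<theta> x j * \<theta> y j)"
    if xy: "x \<in> represented" "y \<in> represented" for x y
    by (rule eq[OF sR(5)[OF xy] poly_families_closed(2)[OF \<theta>(1)[OF xy(1)] \<theta>(1)[OF xy(2)]]
          rep_mult[OF \<theta>(2)[OF xy(1)] \<theta>(2)[OF xy(2)]]])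
  moreover have "\<theta> (c \<odot>\<^bsub>E\<^esub> x) = (\<lambda>j. Polynomial.smult c (\<theta> x j))" if x: "x \<in> represented" for c x
    by (rule eq[OF sR(4)[OF x] poly_families_closed(3)[OF \<theta>(1)[OF x] \<theta>(1)[OF x]] rep_smult[OF \<theta>(2)[OF x]]])
  ultimately show ?thesis
    unfolding hull is_poly_family_ring_def poly_family_iso_def
    by (intro exI[of _ \<theta>] conjI ballI allI) (simp_all add: sR(3-5) del: map_algebra_simps)
qed

text \<open>A module that is embedded as a block of components contributes the profile itself on these
  components and zero on the others.\<close>

lemma emb_integral_profile:
  assumes A: "algebra_with_basis A d a" and N: "fd_module A N" and K: "left_module A K"
    and s: "s \<in> mod_iso A M (dsum N K)"
    and I: "\<And>j. j \<in> J \<inter> I \<Longrightarrow> s ` C j \<subseteq> carrier N \<times> {\<zero>\<^bsub>K\<^esub>}"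
      "\<And>j. j \<in> J - I \<Longrightarrow> s ` C j \<subseteq> {\<zero>\<^bsub>N\<^esub>} \<times> carrier K"
  shows "emb d M K s (integral_profile A d a N) \<in> carrier E"
    and "rep (emb d M K s (integral_profile A d a N)) (\<lambda>j. if j \<in> I then [:0, 1:] else 0)"
proof -
  let ?x = "emb d M K s (integral_profile A d a N)"
  interpret N: lmod A N using alg N by (simp add: lmod_def fd_module_def)
  interpret K: lmod A K using alg K by (simp add: lmod_def)
  have lD: "left_module A (dsum N K)" by (rule left_module_dsum[OF N.lm K])
  interpret D: lmod A "dsum N K" using alg lD by (simp add: lmod_def)
  let ?i = "\<lambda>y\<in>carrier (dsum N K). inv_into (carrier M) s y"
  have i: "?i \<in> mod_hom A (dsum N K) M" using mod_isoD(1)[OF mod_iso_inv[OF s lm lD]] .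
  note iD = mod_homD[OF i] and sD = mod_homD[OF mod_isoD(1)[OF s]]
  have inv_s: "?i (s w) = w" if "w \<in> carrier M" for w
    using mod_isoD(2)[OF s] sD(1)[OF that] that by (simp add: bij_betw_def)
  have sw: "\<exists>u v. s w = (u, v) \<and> u \<in> carrier N \<and> v \<in> carrier K" if "w \<in> carrier M" for w
    using sD(1)[OF that] by auto
  have cs: "c \<odot>\<^bsub>cspace A (dsum N K)\<^esub> (u, v) = (c \<odot>\<^bsub>cspace A N\<^esub> u, c \<odot>\<^bsub>cspace A K\<^esub> v)" for c u v
    by (simp add: cspace_def)
  define e where "e t u = ?i (Q t \<odot>\<^bsub>N\<^esub> u, \<zero>\<^bsub>K\<^esub>)" for t u
  have x: "?x t w = e t u" if t: "t \<in> orthant d" and w: "w \<in> carrier M" "s w = (u, v)" for t w u v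
  proof -
    have u: "u \<in> carrier N" using sD(1)[OF w(1)] w(2) by simp
    have "?x t w = inv_into (carrier M) s (Q t \<odot>\<^bsub>N\<^esub> u, \<zero>\<^bsub>K\<^esub>)"
      using t w u by (simp add: emb_def integral_profile_eq[OF A N t] structure_map_def)
    then show ?thesis using u by (simp add: e_def N.act_closed[OF Q_mem])
  qed
  have eM: "e t u \<in> carrier M" if "u \<in> carrier N" for t u
    unfolding e_def by (rule iD(1)) (simp add: that N.act_closed[OF Q_mem])
  have eadd: "e t (u \<oplus>\<^bsub>N\<^esub> u') = e t u \<oplus>\<^bsub>M\<^esub> e t u'" if u: "u \<in> carrier N" "u' \<in> carrier N" for t u u'
  proof -
    have m: "(Q t \<odot>\<^bsub>N\<^esub> u, \<zero>\<^bsub>K\<^esub>) \<in> carrier (dsum N K)" "(Q t \<odot>\<^bsub>N\<^esub> u', \<zero>\<^bsub>K\<^esub>) \<in> carrier (dsum N K)"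
      using u by (simp_all add: N.act_closed[OF Q_mem])
    have "(Q t \<odot>\<^bsub>N\<^esub> (u \<oplus>\<^bsub>N\<^esub> u'), \<zero>\<^bsub>K\<^esub>) = (Q t \<odot>\<^bsub>N\<^esub> u, \<zero>\<^bsub>K\<^esub>) \<oplus>\<^bsub>dsum N K\<^esub> (Q t \<odot>\<^bsub>N\<^esub> u', \<zero>\<^bsub>K\<^esub>)"
      using u by (simp add: N.smult_r_distr)
    then show ?thesis unfolding e_def using iD(2)[OF m] by simp
  qed
  have escale: "e t (c \<odot>\<^bsub>cspace A N\<^esub> u) = c \<odot>\<^bsub>cspace A M\<^esub> e t u" if u: "u \<in> carrier N" for t c u
  proof -
    have m: "(Q t \<odot>\<^bsub>N\<^esub> u, \<zero>\<^bsub>K\<^esub>) \<in> carrier (dsum N K)"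
      using u by (simp add: N.act_closed[OF Q_mem])
    have "(Q t \<odot>\<^bsub>N\<^esub> (c \<odot>\<^bsub>cspace A N\<^esub> u), \<zero>\<^bsub>K\<^esub>) = c \<odot>\<^bsub>cspace A (dsum N K)\<^esub> (Q t \<odot>\<^bsub>N\<^esub> u, \<zero>\<^bsub>K\<^esub>)"
      using K.V.smult_zero_right[of c] by (simp add: cs N.act_csmult(1)[OF Q_mem u])
    then show ?thesis unfolding e_def using mod_hom_csmult[OF D.lmod_axioms i m] by simp
  qed
  have "?x t \<in> mod_hom cplx (cspace A M) (cspace A M)" if t: "t \<in> orthant d" for t
  proof (rule V.endI)
    fix w assume "w \<in> carrier (cspace A M)"
    then show "?x t w \<in> carrier (cspace A M)" using sw[of w] x[OF t] eM by fastforce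
  next
    fix w w' assume "w \<in> carrier (cspace A M)" "w' \<in> carrier (cspace A M)"
    then have w: "w \<in> carrier M" "w' \<in> carrier M" by simp_all
    obtain u v u' v' where uv: "s w = (u, v)" "u \<in> carrier N" "s w' = (u', v')" "u' \<in> carrier N"
      using sw[OF w(1)] sw[OF w(2)] by blast
    have "s (w \<oplus>\<^bsub>M\<^esub> w') = (u \<oplus>\<^bsub>N\<^esub> u', v \<oplus>\<^bsub>K\<^esub> v')" using sD(2)[OF w] uv by simp
    from x[OF t M.a_closed[OF w] this] x[OF t w(1) uv(1)] x[OF t w(2) uv(3)] eadd[OF uv(2,4)]
    show "?x t (w \<oplus>\<^bsub>cspace A M\<^esub> w') = ?x t w \<oplus>\<^bsub>cspace A M\<^esub> ?x t w'" by simp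
  next
    fix c w assume "w \<in> carrier (cspace A M)"
    then have w: "w \<in> carrier M" by simp
    obtain u v where uv: "s w = (u, v)" "u \<in> carrier N" using sw[OF w] by blast
    have "s (c \<odot>\<^bsub>cspace A M\<^esub> w) = (c \<odot>\<^bsub>cspace A N\<^esub> u, c \<odot>\<^bsub>cspace A K\<^esub> v)"
      using mod_hom_csmult[OF lmod_axioms mod_isoD(1)[OF s] w] uv by (simp add: cs)
    from x[OF t csmult_closed[OF w] this] x[OF t w uv(1)] escale[OF uv(2)]
    show "?x t (c \<odot>\<^bsub>cspace A M\<^esub> w) = c \<odot>\<^bsub>cspace A M\<^esub> ?x t w" by simp
  next
    fix w assume "w \<notin> carrier (cspace A M)"
    then show "?x t w = undefined" using t by (simp add: emb_def)
  qed
  then show "?x \<in> carrier E" by (simp add: PiE_iff emb_def)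
  show "rep ?x (\<lambda>j. if j \<in> I then [:0, 1:] else 0)"
    unfolding rep_def
  proof (intro ballI)
    fix t j w assume t: "t \<in> orthant d" and j: "j \<in> J" and w: "w \<in> C j"
    have wM: "w \<in> carrier M" by (rule C_closed[OF j w])
    show "?x t w = poly_act A M (Q t) (if j \<in> I then [:0, 1:] else 0) w"
    proof (cases "j \<in> I")
      case True
      then obtain u where u: "s w = (u, \<zero>\<^bsub>K\<^esub>)" "u \<in> carrier N" using I(1)[of j] j w by blast
      have m: "s w \<in> carrier (dsum N K)" by (rule sD(1)[OF wM])
      have "?x t w = ?i (Q t \<odot>\<^bsub>dsum N K\<^esub> s w)"
        using x[OF t wM u(1)] K.act_zero[OF Q_mem] by (simp add: e_def u(1))
      also have "\<dots> = Q t \<odot>\<^bsub>M\<^esub> w" by (simp only: inv_s[OF wM] iD(3)[OF Q_mem m])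
      finally show ?thesis using True by (simp add: poly_act_X[OF Q_mem wM])
    next
      case False
      then obtain v where v: "s w = (\<zero>\<^bsub>N\<^esub>, v)" using I(2)[of j] j w by blast
      have "?x t w = ?i \<zero>\<^bsub>dsum N K\<^esub>"
        using x[OF t wM v] N.act_zero[OF Q_mem] by (simp add: e_def)
      also have "\<dots> = \<zero>\<^bsub>M\<^esub>" by (rule mod_hom_zero[OF D.lmod_axioms lmod_axioms i])
      finally show ?thesis using False by simp
    qed
  qed
qed

end

section \<open>The coefficient ring of a compatible orthogonal system\<close>

lemma Pi_N_left_module:
  assumes A: "complex_algebra A" and P: "\<And>v. v < n \<Longrightarrow> left_module A (P v)" "\<And>v. v < n \<Longrightarrow> left_module A (I v)"
  shows "left_module A (Pi_N n P I)"
  unfolding Pi_N_def using P by (intro left_module_direct_sum[OF A] left_module_dsum) auto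

lemma coords_direct_sum:
  assumes A: "complex_algebra A" and X: "\<And>j. j \<in> J \<Longrightarrow> left_module A (X j)"
    and \<kappa>: "\<And>j. j \<in> J \<Longrightarrow> coords (cspace A (X j)) (\<kappa> j)"
  shows "coords (cspace A (direct_sum J X)) (\<lambda>f (j, i). if j \<in> J then \<kappa> j (f j) i else 0)"
proof -
  let ?D = "direct_sum J X" and ?k = "\<lambda>f (j, i). if j \<in> J then \<kappa> j (f j) i else 0"
  have lin: "functional (cspace A (X j)) (\<lambda>x. \<kappa> j x i)" and inj: "inj_on (\<kappa> j) (carrier (X j))"
    and fin: "x \<in> carrier (X j) \<Longrightarrow> finite {i. \<kappa> j x i \<noteq> 0}" if "j \<in> J" for j i x
    using \<kappa>[OF that] by (simp_all add: coords_def)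
  have mem: "f j \<in> carrier (X j)" if "f \<in> carrier ?D" "j \<in> J" for f j using that by (simp add: PiE_iff)
  have sc: "(c \<odot>\<^bsub>cspace A ?D\<^esub> f) j = c \<odot>\<^bsub>cspace A (X j)\<^esub> f j" if "j \<in> J" for c f j
    using that by (simp add: cspace_def)
  have zero: "\<kappa> j \<zero>\<^bsub>X j\<^esub> i = 0" if "j \<in> J" for j i
  proof -
    interpret lmod A "X j" using A X[OF that] by (simp add: lmod_def)
    show ?thesis using V.functional_zero[OF lin[OF that]] by simp
  qed
  have "functional (cspace A ?D) (\<lambda>f. ?k f p)" for p
  proof (cases p)
    case (Pair j i)
    show ?thesis
    proof (cases "j \<in> J")
      case True
      show ?thesis
        unfolding functional_def cspace_simps
      proof (intro conjI ballI allI)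
        fix f g assume f: "f \<in> carrier ?D" and g: "g \<in> carrier ?D"
        show "?k (f \<oplus>\<^bsub>?D\<^esub> g) p = ?k f p + ?k g p"
          using functionalD(1)[OF lin[OF True, of i], of "f j" "g j"] mem[OF f True] mem[OF g True] True Pair by simp
      next
        fix c f assume f: "f \<in> carrier ?D"
        show "?k (c \<odot>\<^bsub>cspace A ?D\<^esub> f) p = c * ?k f p"
          using functionalD(2)[OF lin[OF True, of i], of "f j" c] mem[OF f True] True Pair by (simp add: sc)
      qed
    qed (simp add: functional_def Pair)
  qed
  moreover have "inj_on ?k (carrier ?D)"
  proof
    fix f g assume f: "f \<in> carrier ?D" and g: "g \<in> carrier ?D" and eq: "?k f = ?k g"
    have "f j = g j" if j: "j \<in> J" for j
    proof (rule inj_onD[OF inj[OF j] _ mem[OF f j] mem[OF g j]])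
      show "\<kappa> j (f j) = \<kappa> j (g j)"
      proof
        fix i show "\<kappa> j (f j) i = \<kappa> j (g j) i" using fun_cong[OF eq, of "(j, i)"] j by simp
      qed
    qed
    then show "f = g" using f g by (intro PiE_ext[of f J "\<lambda>j. carrier (X j)" g]) simp_all
  qed
  moreover have "finite {p. ?k f p \<noteq> 0}" if f: "f \<in> carrier ?D" for f
  proof (rule finite_subset)
    show "{p. ?k f p \<noteq> 0} \<subseteq> (SIGMA j:{j \<in> J. f j \<noteq> \<zero>\<^bsub>X j\<^esub>}. {i. \<kappa> j (f j) i \<noteq> 0})"
      using zero by (auto split: if_splits)
    show "finite (SIGMA j:{j \<in> J. f j \<noteq> \<zero>\<^bsub>X j\<^esub>}. {i. \<kappa> j (f j) i \<noteq> 0})"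
      using f by (intro finite_SigmaI fin) (auto intro: mem)
  qed
  ultimately show ?thesis by (simp add: coords_def)
qed

lemma Pi_N_coords:
  assumes A: "complex_algebra A" and P: "\<And>v. v < n \<Longrightarrow> fd_module A (P v)" and I: "\<And>v. v < n \<Longrightarrow> fd_module A (I v)"
  shows "\<exists>\<kappa> :: _ \<Rightarrow> nat \<times> nat \<times> nat \<Rightarrow> complex. coords (cspace A (Pi_N n P I)) \<kappa>"
proof -
  have fd: "fd_module A (dsum (P v) (I v))" if "v < n" for v by (rule fd_module_dsum[OF A P[OF that] I[OF that]])
  have "\<exists>\<kappa> :: _ \<Rightarrow> nat \<Rightarrow> complex. coords (cspace A (dsum (P v) (I v))) \<kappa>" if "v < n" for v
    using fd[OF that] bounded_coords_imp_coords unfolding fd_module_iff[OF A] by blast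
  then obtain \<kappa> :: "nat \<Rightarrow> _ \<Rightarrow> nat \<Rightarrow> complex" where \<kappa>: "\<And>v. v < n \<Longrightarrow> coords (cspace A (dsum (P v) (I v))) (\<kappa> v)" by metis
  let ?D = "direct_sum {..<n} (\<lambda>v. dsum (P v) (I v))"
  define k where "k = (\<lambda>f (v, i). if v \<in> {..<n} then \<kappa> v (f v) i else 0)"
  have k: "coords (cspace A ?D) k"
    unfolding k_def by (rule coords_direct_sum[OF A]) (use fd \<kappa> in \<open>simp_all add: fd_module_def\<close>)
  have "left_module A ?D"
    by (rule left_module_direct_sum[OF A]) (use fd in \<open>simp add: fd_module_def\<close>)
  then have "coords (cspace A (direct_sum (UNIV :: nat set) (\<lambda>_. ?D))) (\<lambda>f (j, i). if j \<in> (UNIV :: nat set) then k (f j) i else 0)"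
    by (rule coords_direct_sum[OF A]) (rule k)
  then show ?thesis unfolding Pi_N_def by blast
qed

lemma (in lmod) internal_direct_sum_independent:
  assumes J: "internal_direct_sum A M J C" and T: "finite T" "T \<subseteq> J"
    and x: "\<And>j. j \<in> T \<Longrightarrow> x j \<in> C j" and sum: "finsum M x T = \<zero>\<^bsub>M\<^esub>" and j: "j \<in> T"
  shows "x j = \<zero>\<^bsub>M\<^esub>"
proof -
  have C: "submodule (C j) A M" if "j \<in> J" for j using J that by (simp add: internal_direct_sum_def)
  let ?D = "direct_sum J (\<lambda>j. M\<lparr>carrier := C j\<rparr>)"
  have inj: "inj_on (sum_map M J) (carrier ?D)" using J by (simp add: internal_direct_sum_def bij_betw_def)
  let ?f = "\<lambda>j\<in>J. if j \<in> T then x j else \<zero>\<^bsub>M\<^esub>" and ?z = "\<lambda>j\<in>J. \<zero>\<^bsub>M\<^esub>"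
  have sub: "{j \<in> J. ?f j \<noteq> \<zero>\<^bsub>M\<^esub>} \<subseteq> T" by auto
  have "?f j \<in> C j" if "j \<in> J" for j using that x submoduleD(2)[OF C[OF that]] by simp
  then have f: "?f \<in> carrier ?D" using finite_subset[OF sub T(1)] by simp
  have z: "?z \<in> carrier ?D" using submoduleD(2)[OF C] by (simp cong: conj_cong)
  have xM: "x j \<in> carrier M" if "j \<in> T" for j using x[OF that] submoduleD(1)[OF C] T(2) that by blast
  have "sum_map M J ?f = finsum M x T"
    unfolding sum_map_def
    by (rule M.add.finprod_mono_neutral_cong_left[OF T(1) sub]) (use xM T(2) in auto)
  moreover have e: "{j \<in> J. ?z j \<noteq> \<zero>\<^bsub>M\<^esub>} = {}" by auto
  have "sum_map M J ?z = \<zero>\<^bsub>M\<^esub>" unfolding sum_map_def e by simp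
  ultimately have e2: "?f = ?z" using inj_onD[OF inj _ f z] sum by simp
  have "j \<in> J" using j T(2) by auto
  then show ?thesis using fun_cong[OF e2, of j] j by simp
qed

text \<open>Linear independence is required of the family and not of its range; in particular \<open>u\<close> is injective.\<close>

lemma finite_independent_family:
  fixes u :: "'s \<Rightarrow> 'i \<Rightarrow> complex"
  assumes F: "finite F" and supp: "\<And>s. s \<in> S \<Longrightarrow> {i. u s i \<noteq> 0} \<subseteq> F"
    and indep: "\<And>T c s. finite T \<Longrightarrow> T \<subseteq> S \<Longrightarrow> (\<And>i. (\<Sum>s\<in>T. c s * u s i) = 0) \<Longrightarrow> s \<in> T \<Longrightarrow> c s = 0"
  shows "finite S"
proof (rule ccontr)
  assume "infinite S"
  then obtain T where T: "T \<subseteq> S" "finite T" "card T = Suc (card F)"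
    using infinite_arbitrarily_large by blast
  have inj: "inj_on u T"
  proof
    fix s s' assume s: "s \<in> T" "s' \<in> T" "u s = u s'"
    show "s = s'"
    proof (rule ccontr)
      assume ne: "s \<noteq> s'"
      have "(1 :: complex) = 0"
        using indep[of "{s, s'}" "\<lambda>r. if r = s then 1 else - 1" s] s ne subsetD[OF T(1) s(1)]
          subsetD[OF T(1) s(2)] by simp
      then show False by simp
    qed
  qed
  let ?e = "(\<lambda>k i. if i = k then 1 else (0::complex)) ` F"
  have "cf.independent (u ` T)"
  proof (rule cf.independent_if_scalars_zero)
    show "finite (u ` T)" using T(2) by simp
    fix f x assume sum: "(\<Sum>x\<in>u ` T. (\<lambda>i. f x * x i)) = 0" and x: "x \<in> u ` T"
    then obtain s where s: "s \<in> T" "x = u s" by auto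
    have ev: "(\<Sum>x\<in>B. (\<lambda>i. g x * h x i)) i = (\<Sum>x\<in>B. g x * h x i)" if "finite B"
      for B :: "'s set" and g and h :: "'s \<Rightarrow> 'i \<Rightarrow> complex" and i
      using that by (induction B) auto
    have "(\<Sum>s\<in>T. (\<lambda>i. f (u s) * u s i)) = 0" using sum by (simp add: sum.reindex[OF inj])
    then have "(\<Sum>s\<in>T. f (u s) * u s i) = 0" for i using ev[OF T(2), of "\<lambda>s. f (u s)" u i] by simp
    then show "f x = 0" using indep[of T "\<lambda>s. f (u s)" s] T s by simp
  qed
  moreover have "u ` T \<subseteq> cf.span ?e"
    using finite_support_in_span[OF F supp] T(1) by blast
  ultimately have "card (u ` T) \<le> card ?e" using cf.independent_span_bound[of ?e "u ` T"] F by blast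
  also have "\<dots> \<le> card F" by (rule card_image_le[OF F])
  finally show False using card_image[OF inj] T(3) by simp
qed

text \<open>A space with coordinates in a countable index type has countable dimension, so a direct sum
  decomposition of it has only countably many nonzero components.\<close>

lemma (in lmod) countable_components:
  fixes \<kappa> :: "'m \<Rightarrow> 'i :: countable \<Rightarrow> complex"
  assumes \<kappa>: "coords (cspace A M) \<kappa>" and J: "internal_direct_sum A M J C"
    and nz: "\<And>j. j \<in> J \<Longrightarrow> \<exists>w\<in>C j. w \<noteq> \<zero>\<^bsub>M\<^esub>"
  shows "countable J"
proof -
  obtain w where w: "\<And>j. j \<in> J \<Longrightarrow> w j \<in> C j" "\<And>j. j \<in> J \<Longrightarrow> w j \<noteq> \<zero>\<^bsub>M\<^esub>" using nz by metis
  have C: "submodule (C j) A M" if "j \<in> J" for j using J that by (simp add: internal_direct_sum_def)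
  have wM: "w j \<in> carrier M" if "j \<in> J" for j using w(1)[OF that] submoduleD(1)[OF C[OF that]] by blast
  have lin: "functional (cspace A M) (\<lambda>x. \<kappa> x i)" for i using \<kappa> by (simp add: coords_def)
  have "finite {j \<in> J. {i. \<kappa> (w j) i \<noteq> 0} \<subseteq> F}" if F: "finite F" for F
  proof (rule finite_independent_family[OF F, of _ "\<lambda>j. \<kappa> (w j)"])
    fix T c j
    assume T: "finite T" "T \<subseteq> {j \<in> J. {i. \<kappa> (w j) i \<noteq> 0} \<subseteq> F}"
      and sum: "\<And>i. (\<Sum>s\<in>T. c s * \<kappa> (w s) i) = 0" and j: "j \<in> T"
    have TJ: "T \<subseteq> J" using T(2) by auto
    let ?x = "\<lambda>j. c j \<odot>\<^bsub>cspace A M\<^esub> w j"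
    have xM: "?x s \<in> carrier M" if "s \<in> T" for s using csmult_closed wM TJ that by blast
    then have xM': "?x \<in> T \<rightarrow> carrier (cspace A M)" by simp
    have fs: "finsum M ?x T \<in> carrier M" using xM by (intro M.finsum_closed) auto
    have "finsum M ?x T = \<zero>\<^bsub>M\<^esub>"
    proof -
      have "\<kappa> (finsum M ?x T) i = \<kappa> \<zero>\<^bsub>M\<^esub> i" for i
      proof -
        have "\<kappa> (finsum M ?x T) i = (\<Sum>s\<in>T. \<kappa> (?x s) i)"
          using V.functional_finsum[OF lin T(1) xM'] by simp
        also have "\<dots> = (\<Sum>s\<in>T. c s * \<kappa> (w s) i)"
          by (rule sum.cong[OF refl], rule functionalD(2)[OF lin]) (use wM TJ in auto)
        finally show ?thesis using sum V.functional_zero[OF lin, of i] by simp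
      qed
      then have "\<kappa> (finsum M ?x T) = \<kappa> \<zero>\<^bsub>M\<^esub>" by (rule HOL.ext)
      then show ?thesis using \<kappa> fs by (auto simp: coords_def dest: inj_onD)
    qed
    then have "?x j = \<zero>\<^bsub>M\<^esub>"
      by (rule internal_direct_sum_independent[OF J T(1) TJ, rotated])
        (use j w(1) TJ submoduleD(4)[OF C] in \<open>auto simp: csmult_def\<close>)
    then show "c j = 0" using V.smult_eq_zero[of "w j" "c j"] w(2) wM TJ j by auto
  qed auto
  then have "countable (\<Union>F\<in>{F. finite F}. {j \<in> J. {i. \<kappa> (w j) i \<noteq> 0} \<subseteq> F})"
    by (intro countable_UN) (auto intro: countable_finite simp: countable_Collect_finite)
  moreover have "J \<subseteq> (\<Union>F\<in>{F. finite F}. {j \<in> J. {i. \<kappa> (w j) i \<noteq> 0} \<subseteq> F})"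
    using \<kappa> wM by (auto simp: coords_def)
  ultimately show ?thesis by (rule countable_subset[rotated])
qed

lemma isomorphic_mod_nonzero:
  assumes W: "lmod A W" and X: "left_module A X" "carrier X \<noteq> {\<zero>\<^bsub>X\<^esub>}"
    and C: "submodule C A W" and iso: "isomorphic_mod A (W\<lparr>carrier := C\<rparr>) X"
  shows "\<exists>w\<in>C. w \<noteq> \<zero>\<^bsub>W\<^esub>"
proof (rule ccontr)
  assume "\<not> (\<exists>w\<in>C. w \<noteq> \<zero>\<^bsub>W\<^esub>)"
  then have C0: "C = {\<zero>\<^bsub>W\<^esub>}" using submoduleD(2)[OF C] by blast
  interpret W: lmod A W by (rule W)
  interpret X: left_module A X by (rule X(1))
  obtain f where f: "f \<in> mod_iso A (W\<lparr>carrier := C\<rparr>) X" using iso by (auto simp: isomorphic_mod_def)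
  have f0: "f \<zero>\<^bsub>W\<^esub> \<in> carrier X" using mod_homD(1)[OF mod_isoD(1)[OF f], of "\<zero>\<^bsub>W\<^esub>"] C0 by simp
  have "f (\<zero>\<^bsub>W\<^esub> \<oplus>\<^bsub>W\<^esub> \<zero>\<^bsub>W\<^esub>) = f \<zero>\<^bsub>W\<^esub> \<oplus>\<^bsub>X\<^esub> f \<zero>\<^bsub>W\<^esub>"
    using mod_homD(2)[OF mod_isoD(1)[OF f], of "\<zero>\<^bsub>W\<^esub>" "\<zero>\<^bsub>W\<^esub>"] C0 by simp
  then have "f \<zero>\<^bsub>W\<^esub> \<oplus>\<^bsub>X\<^esub> f \<zero>\<^bsub>W\<^esub> = f \<zero>\<^bsub>W\<^esub>" by simp
  then have "f \<zero>\<^bsub>W\<^esub> = \<zero>\<^bsub>X\<^esub>" using f0 by simp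
  moreover have "carrier X = f ` C" using mod_isoD(2)[OF f] by (simp add: bij_betw_def)
  ultimately show False using X(2) C0 by simp
qed

text \<open>A module \<open>M\<close> with multiplicities \<open>m\<close> contributes the generator that is the profile on the copies
  \<open>(X, r)\<close> with \<open>r \<le> m X\<close>; the modules \<open>X\<^sup>r\<close> and \<open>X\<^sup>r\<^sup>-\<^sup>1\<close> differ exactly in the copy \<open>(X, r)\<close>.\<close>

theorem coefficient_ring_structure:
  fixes A :: "(complex, 'a) module" and P I :: "nat \<Rightarrow> ('a, 'm) module" and S :: "('a, 'm) module set"
    and M' :: "('a, 'm) module \<Rightarrow> ('a, 'k) module"
    and \<sigma> :: "('a, 'm) module \<Rightarrow> (nat \<Rightarrow> nat \<Rightarrow> 'm \<times> 'm) \<Rightarrow> 'm \<times> 'k"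
  assumes U: "large_universe TYPE('m)" and A: "algebra_with_basis A d a"
    and PI: "proj_inj_reps A n P I" and S: "indec_reps A (add_proj_inj A) S"
    and fes: "fixed_embedding_system A (Pi_N n P I) M' \<sigma>"
    and co: "compatible_orthogonal A (Pi_N n P I) M' \<sigma> S"
  shows "countable S"
    and "is_poly_family_ring (integral_coefficient_ring A d a (Pi_N n P I) M' \<sigma>) (S \<times> {1 :: nat..})"
proof -
  let ?W = "Pi_N n P I"
  have alg: "complex_algebra A" and basis: "is_basis A d a" using A by (simp_all add: algebra_with_basis_def)
  have fP: "fd_module A (P v)" and fI: "fd_module A (I v)" if "v < n" for v
    using PI that by (auto simp: proj_inj_reps_def indec_reps_def projective_mod_def injective_mod_def)
  have lW: "left_module A ?W"
    by (rule Pi_N_left_module[OF alg]) (use fP fI in \<open>simp_all add: fd_module_def\<close>)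
  then have W: "lmod A ?W" using alg by (simp add: lmod_def)
  obtain \<kappa> :: "_ \<Rightarrow> nat \<times> nat \<times> nat \<Rightarrow> complex" where \<kappa>: "coords (cspace A ?W) \<kappa>"
    using Pi_N_coords[of A n P I, OF alg fP fI] by blast
  obtain C :: "('a, 'm) module \<times> nat \<Rightarrow> _" where C: "internal_direct_sum A ?W (S \<times> {1..}) C"
    and CX: "\<forall>X\<in>S. \<forall>r\<ge>1. isomorphic_mod A (?W\<lparr>carrier := C (X, r)\<rparr>) X"
    and Cm: "\<forall>M m. add_proj_inj A M \<and> isomorphic_mod A M (copies S m) \<longrightarrow>
           \<sigma> M ` sub_sum ?W {(X, r). X \<in> S \<and> 1 \<le> r \<and> r \<le> m X} C = carrier M \<times> {\<zero>\<^bsub>M' M\<^esub>} \<and>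
           \<sigma> M ` sub_sum ?W {(X, r). X \<in> S \<and> m X < r} C = {\<zero>\<^bsub>M\<^esub>} \<times> carrier (M' M)"
    using co unfolding compatible_orthogonal_def by (elim exE conjE)
  have Csub: "submodule (C j) A ?W" if "j \<in> S \<times> {1..}" for j
    using C that unfolding internal_direct_sum_def by blast
  have SX: "fd_module A X" "left_module A X" "carrier X \<noteq> {\<zero>\<^bsub>X\<^esub>}" if "X \<in> S" for X
  proof -
    have X: "add_proj_inj A X" "indecomposable A X" using S that unfolding indec_reps_def by blast+
    show "fd_module A X" by (rule add_proj_inj_imp_fd_module[OF X(1)])
    then show "left_module A X" by (simp add: fd_module_def)
    show "carrier X \<noteq> {\<zero>\<^bsub>X\<^esub>}" using X(2) unfolding indecomposable_def by (rule conjunct1)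
  qed
  have nz: "\<exists>w\<in>C j. w \<noteq> \<zero>\<^bsub>?W\<^esub>" if j: "j \<in> S \<times> {1..}" for j
  proof -
    obtain X r where Xr: "j = (X, r)" "X \<in> S" "1 \<le> r" using j by auto
    show ?thesis
      by (rule isomorphic_mod_nonzero[OF W SX(2,3)[OF Xr(2)] Csub[OF j]]) (use CX Xr in blast)
  qed
  have "countable (S \<times> {1 :: nat..})" by (rule lmod.countable_components[OF W \<kappa> C nz])
  then have "countable (fst ` (S \<times> {1 :: nat..}))" by (rule countable_image)
  moreover have "fst ` (S \<times> {1 :: nat..}) = S" by force
  ultimately show "countable S" by simp
  interpret graded_lmod A ?W d a \<kappa> "S \<times> {1..}" C
    using W basis \<kappa> C nz by (simp add: graded_lmod_def based_lmod_def based_lmod_axioms_def graded_lmod_axioms_def)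
  let ?e = "\<lambda>M. emb d ?W (M' M) (\<sigma> M) (integral_profile A d a M)"
  let ?I = "\<lambda>m :: ('a, 'm) module \<Rightarrow> nat. {(X, r). X \<in> S \<and> 1 \<le> r \<and> r \<le> m X}"
  have gen: "?e M \<in> carrier E" "rep (?e M) (\<lambda>j. if j \<in> ?I m then [:0, 1:] else 0)"
    if M: "add_proj_inj A M" "isomorphic_mod A M (copies S m)" for M m
  proof -
    have sM: "left_module A (M' M)" "\<sigma> M \<in> mod_iso A ?W (dsum M (M' M))"
      using fes M(1) unfolding fixed_embedding_system_def by blast+
    have im: "\<sigma> M ` sub_sum ?W (?I m) C = carrier M \<times> {\<zero>\<^bsub>M' M\<^esub>}"
      "\<sigma> M ` sub_sum ?W {(X, r). X \<in> S \<and> m X < r} C = {\<zero>\<^bsub>M\<^esub>} \<times> carrier (M' M)"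
      using Cm M by blast+
    have 1: "\<sigma> M ` C j \<subseteq> carrier M \<times> {\<zero>\<^bsub>M' M\<^esub>}" if j: "j \<in> S \<times> {1..} \<inter> ?I m" for j
    proof -
      have "C j \<subseteq> sub_sum ?W (?I m) C"
        by (rule component_subset_sub_sum) (use Csub j in auto)
      then show ?thesis using im(1) by blast
    qed
    have 2: "\<sigma> M ` C j \<subseteq> {\<zero>\<^bsub>M\<^esub>} \<times> carrier (M' M)" if j: "j \<in> S \<times> {1..} - ?I m" for j
    proof -
      have "C j \<subseteq> sub_sum ?W {(X, r). X \<in> S \<and> m X < r} C"
        by (rule component_subset_sub_sum) (use Csub j in auto)
      then show ?thesis using im(2) by blast
    qed
    note e = emb_integral_profile[OF A add_proj_inj_imp_fd_module[OF M(1)] sM, where I = "?I m"]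
    show "?e M \<in> carrier E" by (rule e(1)[OF 1 2])
    show "rep (?e M) (\<lambda>j. if j \<in> ?I m then [:0, 1:] else 0)" by (rule e(2)[OF 1 2])
  qed
  let ?G = "{?e M | M. add_proj_inj A M}"
  have G: "?G \<subseteq> represented"
  proof
    fix x assume "x \<in> ?G"
    then obtain M where M: "add_proj_inj A M" "x = ?e M" by blast
    obtain k \<kappa>M where "bounded_coords (cspace A M) k \<kappa>M"
      using add_proj_inj_imp_fd_module[OF M(1)] unfolding fd_module_iff[OF alg] by blast
    then obtain m where m: "finite {X \<in> S. m X \<noteq> 0}" "isomorphic_mod A M (copies S m)"
      using ex_copies[OF alg S M(1)] by blast
    have "(\<lambda>j. if j \<in> ?I m then [:0, 1:] else 0) \<in> poly_families (S \<times> {1..})"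
      using finite_copies_index[OF m(1)] by (auto simp: poly_families_def)
    then show "x \<in> represented"
      unfolding M(2) by (rule representedI[OF gen(1)[OF M(1) m(2)] _ gen(2)[OF M(1) m(2)]])
  qed
  have single: "\<forall>j\<in>S \<times> {1..}. \<exists>x\<in>?G. \<exists>y\<in>?G. \<exists>p q. rep x p \<and> rep y q \<and>
      (\<forall>i\<in>S \<times> {1..}. p i - q i = (if i = j then [:0, 1:] else 0))"
  proof
    fix j assume j: "j \<in> S \<times> {1 :: nat..}"
    obtain X r where Xr: "j = (X, r)" "X \<in> S" "1 \<le> r" using j by auto
    define m where "m k Y = (if Y = X then k else 0)" for k :: nat and Y :: "('a, 'm) module"
    obtain M :: "('a, 'm) module" where M: "add_proj_inj A M" "isomorphic_mod A M (copies S (m r))"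
      using ex_power[OF U alg S Xr(2), of r] unfolding m_def by blast
    obtain N :: "('a, 'm) module" where N: "add_proj_inj A N" "isomorphic_mod A N (copies S (m (r - 1)))"
      using ex_power[OF U alg S Xr(2), of "r - 1"] unfolding m_def by blast
    let ?p = "\<lambda>j. if j \<in> ?I (m r) then [:0, 1:] else (0 :: complex poly)"
      and ?q = "\<lambda>j. if j \<in> ?I (m (r - 1)) then [:0, 1:] else (0 :: complex poly)"
    have pq: "?p i - ?q i = (if i = j then [:0, 1:] else 0)" if iJ: "i \<in> S \<times> {1..}" for i
    proof -
      obtain Y s where i: "i = (Y, s)" "Y \<in> S" "1 \<le> s" using iJ by auto
      have "i \<in> ?I (m r) \<longleftrightarrow> Y = X \<and> s \<le> r" "i \<in> ?I (m (r - 1)) \<longleftrightarrow> Y = X \<and> s \<le> r - 1" "i = j \<longleftrightarrow> Y = X \<and> s = r"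
        using i Xr by (auto simp: m_def)
      moreover have "s \<le> r \<longleftrightarrow> s \<le> r - 1 \<or> s = r" "s = r \<Longrightarrow> \<not> s \<le> r - 1" using Xr(3) by arith+
      ultimately show ?thesis by (cases "s = r") (simp_all only: simp_thms if_True if_False split: if_splits, auto)
    qed
    show "\<exists>x\<in>?G. \<exists>y\<in>?G. \<exists>p q. rep x p \<and> rep y q \<and>
        (\<forall>i\<in>S \<times> {1..}. p i - q i = (if i = j then [:0, 1:] else 0))"
    proof (rule bexI[of _ "?e M"], rule bexI[of _ "?e N"], rule exI[of _ ?p], rule exI[of _ ?q], intro conjI ballI)
      show "rep (?e M) ?p" by (rule gen(2)[OF M])
      show "rep (?e N) ?q" by (rule gen(2)[OF N])
      show "?e M \<in> ?G" "?e N \<in> ?G" using M(1) N(1) by blast+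
    qed (rule pq)
  qed
  show "is_poly_family_ring (integral_coefficient_ring A d a ?W M' \<sigma>) (S \<times> {1 :: nat..})"
    unfolding integral_coefficient_ring_def Let_def by (rule hull_iso_poly_families[OF G single])
qed

lemma is_poly_family_ring_reindex:
  assumes R: "is_poly_family_ring R J" and g: "bij_betw g K J"
  shows "is_poly_family_ring R K"
proof -
  obtain \<theta> where \<theta>: "poly_family_iso \<theta> R J" using R unfolding is_poly_family_ring_def by blast
  note op = poly_family_isoD[OF \<theta>]
  define re where "re p = (\<lambda>k. if k \<in> K then p (g k) else 0)" for p :: "_ \<Rightarrow> complex poly"
  have gJ: "g k \<in> J" if "k \<in> K" for k using g that by (auto simp: bij_betw_def)
  have inj: "inj_on g K" and im: "g ` K = J" using g by (auto simp: bij_betw_def)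
  have "bij_betw re (poly_families J) (poly_families K)"
  proof (rule bij_betwI')
    fix p q assume pq: "p \<in> poly_families J" "q \<in> poly_families J"
    have "p = q" if eq: "re p = re q"
    proof
      fix j show "p j = q j"
      proof (cases "j \<in> J")
        case True
        then obtain k where "k \<in> K" "j = g k" using im by blast
        then show ?thesis using fun_cong[OF eq, of k] by (simp add: re_def)
      next
        case False
        then show ?thesis using pq by (simp add: poly_families_def)
      qed
    qed
    then show "(re p = re q) = (p = q)" by (intro iffI arg_cong[where f = re])
  next
    fix p assume p: "p \<in> poly_families J"
    have "{k. re p k \<noteq> 0} \<subseteq> K \<inter> g -` {j. p j \<noteq> 0}" by (auto simp: re_def)
    moreover have "finite (K \<inter> g -` {j. p j \<noteq> 0})"
      using finite_vimage_IntI[OF _ inj, of "{j. p j \<noteq> 0}"] p by (simp add: poly_families_def Int_commute)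
    ultimately have "finite {k. re p k \<noteq> 0}" by (rule finite_subset)
    then show "re p \<in> poly_families K" using p by (simp add: poly_families_def re_def)
  next
    fix q assume q: "q \<in> poly_families K"
    define p where "p j = (if j \<in> J then q (inv_into K g j) else 0)" for j
    have inv: "inv_into K g j \<in> K" "g (inv_into K g j) = j" if "j \<in> J" for j
      using that im by (auto intro: inv_into_into f_inv_into_f)
    have "{j. p j \<noteq> 0} \<subseteq> g ` {k. q k \<noteq> 0}"
      using inv by (force simp: p_def split: if_splits)
    then have "finite {j. p j \<noteq> 0}" by (rule finite_subset) (use q in \<open>simp add: poly_families_def\<close>)
    then have "p \<in> poly_families J" using q by (simp add: poly_families_def p_def)
    moreover have "q = re p"
      using q gJ inv_into_f_f[OF inj] by (auto simp: re_def p_def fun_eq_iff poly_families_def)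
    ultimately show "\<exists>p\<in>poly_families J. q = re p" by blast
  qed
  then have "bij_betw (re \<circ> \<theta>) (carrier R) (poly_families K)" by (rule bij_betw_trans[OF op(1)])
  moreover have "re (\<lambda>j. p j + q j) = (\<lambda>k. re p k + re q k)" "re (\<lambda>j. p j * q j) = (\<lambda>k. re p k * re q k)"
    "re (\<lambda>j. Polynomial.smult c (p j)) = (\<lambda>k. Polynomial.smult c (re p k))" for p q c
    by (auto simp: re_def fun_eq_iff)
  ultimately show ?thesis
    unfolding is_poly_family_ring_def poly_family_iso_def using op(2-4) by (intro exI[of _ "re \<circ> \<theta>"]) simp
qed

lemma poly_family_rings_isomorphic:
  assumes R: "is_poly_family_ring R J" and R': "is_poly_family_ring R' J"
  shows "nonunital_alg_isomorphic R R'"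
proof -
  obtain \<theta> \<phi> where "poly_family_iso \<theta> R J" "poly_family_iso \<phi> R' J"
    using R R' unfolding is_poly_family_ring_def by blast
  note op = poly_family_isoD[OF this(1)] and op' = poly_family_isoD[OF this(2)]
  note \<theta> = op(1) and \<phi> = op'(1)
  define h where "h = (\<lambda>x\<in>carrier R. inv_into (carrier R') \<phi> (\<theta> x))"
  have h: "h x \<in> carrier R'" "\<phi> (h x) = \<theta> x" if "x \<in> carrier R" for x
  proof -
    have "\<theta> x \<in> \<phi> ` carrier R'" using \<theta> \<phi> that by (auto simp: bij_betw_def)
    then show "h x \<in> carrier R'" "\<phi> (h x) = \<theta> x"
      using that by (simp_all add: h_def inv_into_into f_inv_into_f)
  qed
  have eq: "h x = y" if "x \<in> carrier R" "y \<in> carrier R'" "\<theta> x = \<phi> y" for x y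
    using h[OF that(1)] that \<phi> by (auto simp: bij_betw_def dest: inj_onD)
  have "h \<in> mod_hom cplx R R'"
  proof (rule mod_homI)
    fix x y assume xy: "x \<in> carrier R" "y \<in> carrier R"
    show "h (x \<oplus>\<^bsub>R\<^esub> y) = h x \<oplus>\<^bsub>R'\<^esub> h y"
      by (rule eq) (simp_all add: op(2)[OF xy] op'(2)[OF h(1)[OF xy(1)] h(1)[OF xy(2)]] h(2)[OF xy(1)] h(2)[OF xy(2)])
  next
    fix c x assume x: "x \<in> carrier R"
    show "h (c \<odot>\<^bsub>R\<^esub> x) = c \<odot>\<^bsub>R'\<^esub> h x"
      by (rule eq) (simp_all add: op(4)[OF x] op'(4)[OF h(1)[OF x]] h(2)[OF x])
  qed (use h(1) in \<open>simp_all add: h_def\<close>)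
  moreover have "bij_betw h (carrier R) (carrier R')"
  proof -
    have "bij_betw (inv_into (carrier R') \<phi> \<circ> \<theta>) (carrier R) (carrier R')"
      by (rule bij_betw_trans[OF \<theta> bij_betw_inv_into[OF \<phi>]])
    then show ?thesis by (subst bij_betw_cong[of _ _ "inv_into (carrier R') \<phi> \<circ> \<theta>"]) (simp_all add: h_def)
  qed
  moreover have "h (x \<otimes>\<^bsub>R\<^esub> y) = h x \<otimes>\<^bsub>R'\<^esub> h y" if xy: "x \<in> carrier R" "y \<in> carrier R" for x y
    by (rule eq) (simp_all add: op(3)[OF xy] op'(3)[OF h(1)[OF xy(1)] h(1)[OF xy(2)]] h(2)[OF xy(1)] h(2)[OF xy(2)])
  ultimately show ?thesis unfolding nonunital_alg_isomorphic_def mod_iso_def by blast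
qed

section \<open>The regular module and Morita equivalence\<close>

lemma large_universe_functions:
  assumes U: "large_universe TYPE('m)"
  shows "\<exists>h :: (nat \<Rightarrow> complex) \<Rightarrow> 'm. inj_on h {f. \<forall>i\<ge>N. f i = 0}"
proof (induction N)
  case 0
  have "inj_on (\<lambda>_. undefined :: 'm) {f :: nat \<Rightarrow> complex. \<forall>i\<ge>0. f i = 0}" by (rule inj_onI) (auto simp: fun_eq_iff)
  then show ?case by blast
next
  case (Suc N)
  then obtain h :: "(nat \<Rightarrow> complex) \<Rightarrow> 'm" where h: "inj_on h {f. \<forall>i\<ge>N. f i = 0}" by blast
  obtain p :: "'m \<times> 'm \<Rightarrow> 'm" where p: "inj p" using large_universe_pair[OF U] .
  obtain c :: "complex \<Rightarrow> 'm" where c: "inj c" using U by (auto simp: large_universe_def)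
  have "inj_on (\<lambda>f. p (h (f(N := 0)), c (f N))) {f. \<forall>i\<ge>Suc N. f i = 0}"
  proof
    fix f g assume f: "f \<in> {f. \<forall>i\<ge>Suc N. f i = 0}" and g: "g \<in> {f. \<forall>i\<ge>Suc N. f i = (0 :: complex)}"
      and eq: "p (h (f(N := 0)), c (f N)) = p (h (g(N := 0)), c (g N))"
    from eq have "h (f(N := 0)) = h (g(N := 0))" "f N = g N" by (simp_all add: inj_eq[OF p] inj_eq[OF c])
    moreover have "f(N := 0) \<in> {f. \<forall>i\<ge>N. f i = 0}" "g(N := 0) \<in> {f. \<forall>i\<ge>N. f i = 0}" using f g by auto
    ultimately have e: "f(N := 0) = g(N := 0)" "f N = g N" using h by (auto dest: inj_onD)
    show "f = g"
    proof
      fix i show "f i = g i" using fun_cong[OF e(1), of i] e(2) by (cases "i = N") auto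
    qed
  qed
  then show ?case by blast
qed

definition regular_mod :: "(complex, 'a) module \<Rightarrow> ('a, 'a) module" where
  "regular_mod A = \<lparr>carrier = carrier A, monoid.mult = undefined, one = undefined,
     ring.zero = \<zero>\<^bsub>A\<^esub>, add = add A, smult = monoid.mult A\<rparr>"

lemma regular_mod_simps [simp]:
  "carrier (regular_mod A) = carrier A" "\<zero>\<^bsub>regular_mod A\<^esub> = \<zero>\<^bsub>A\<^esub>"
  "x \<oplus>\<^bsub>regular_mod A\<^esub> y = x \<oplus>\<^bsub>A\<^esub> y" "r \<odot>\<^bsub>regular_mod A\<^esub> x = r \<otimes>\<^bsub>A\<^esub> x"
  by (simp_all add: regular_mod_def)

lemma left_module_regular:
  assumes "ring A"
  shows "left_module A (regular_mod A)"
proof -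
  interpret ring A by fact
  show ?thesis
  proof (rule left_moduleI)
    show "abelian_group (regular_mod A)"
      using abelian_groupE[OF is_abelian_group] by (intro abelian_groupI) simp_all
  qed (simp_all add: l_distr r_distr m_assoc ring_axioms)
qed

text \<open>Every universe of at least the cardinality of the continuum contains a copy of the regular module.\<close>

lemma ex_regular_copy:
  assumes U: "large_universe TYPE('m)" and A: "algebra_with_basis A d a"
  shows "\<exists>L :: ('a, 'm) module. fd_module A L \<and> isomorphic_mod A L (regular_mod A)"
proof -
  have alg: "complex_algebra A" and basis: "is_basis A d a" using A by (simp_all add: algebra_with_basis_def)
  have ring: "ring A" using alg by (simp add: complex_algebra_def)
  have lR: "left_module A (regular_mod A)" by (rule left_module_regular[OF ring])
  interpret R: lmod A "regular_mod A" using alg lR by (simp add: lmod_def)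
  obtain \<kappa> where \<kappa>: "bounded_coords A d \<kappa>" using R.S.basis_imp_bounded_coords[OF basis] .
  have "c \<odot>\<^bsub>cspace A (regular_mod A)\<^esub> x = c \<odot>\<^bsub>A\<^esub> x" if "x \<in> carrier A" for c x
    using R.smult_alg_eq(1)[OF that] by (simp add: R.csmult_def)
  then have "bounded_coords (cspace A (regular_mod A)) d \<kappa>"
    using \<kappa> by (simp add: bounded_coords_def functional_def)
  then have fR: "fd_module A (regular_mod A)" unfolding fd_module_iff[OF alg] using lR by blast
  obtain h :: "(nat \<Rightarrow> complex) \<Rightarrow> 'm" where h: "inj_on h {f. \<forall>i\<ge>d. f i = 0}"
    using large_universe_functions[OF U] by blast
  have inj: "inj_on \<kappa> (carrier A)" and sub: "\<kappa> ` carrier A \<subseteq> {f. \<forall>i\<ge>d. f i = 0}"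
    using \<kappa> by (auto simp: bounded_coords_def)
  have "inj_on (h \<circ> \<kappa>) (carrier (regular_mod A))"
    unfolding regular_mod_simps by (rule comp_inj_on[OF inj inj_on_subset[OF h sub]])
  note L = transport_mod[OF lR this]
  have iso: "isomorphic_mod A (transport_mod (h \<circ> \<kappa>) (regular_mod A)) (regular_mod A)"
    by (rule isomorphic_mod_sym[OF L(2) lR L(1)])
  have "fd_module A (transport_mod (h \<circ> \<kappa>) (regular_mod A))"
    by (rule fd_module_isomorphic[OF alg fR L(1) iso])
  with iso show ?thesis by blast
qed

text \<open>A morphism out of the regular module is determined by the image of the identity element, which can
  be chosen freely.\<close>

lemma projective_if_regular:
  fixes L :: "('a, 'm) module"
  assumes alg: "complex_algebra A" and L: "fd_module A L" and \<psi>: "\<psi> \<in> mod_iso A L (regular_mod A)"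
  shows "projective_mod A L"
  unfolding projective_mod_def
proof (intro conjI allI ballI impI)
  show "fd_module A L" by (rule L)
  fix N K :: "('a, 'm) module" and g f
  assume g: "g \<in> mod_hom A N K" and f: "f \<in> mod_hom A L K"
    and NK: "fd_module A N \<and> fd_module A K \<and> g ` carrier N = carrier K"
  interpret L: lmod A L using alg L by (simp add: lmod_def fd_module_def)
  interpret N: lmod A N using alg NK by (simp add: lmod_def fd_module_def)
  note \<psi>D = mod_homD[OF mod_isoD(1)[OF \<psi>], simplified]
  have bij: "bij_betw \<psi> (carrier L) (carrier A)" using mod_isoD(2)[OF \<psi>] by simp
  obtain e where e: "e \<in> carrier L" "\<psi> e = \<one>\<^bsub>A\<^esub>"
    using bij L.one_closed unfolding bij_betw_def by (metis imageE)
  have re: "\<psi> x \<odot>\<^bsub>L\<^esub> e = x" if x: "x \<in> carrier L" for x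
  proof -
    have "\<psi> (\<psi> x \<odot>\<^bsub>L\<^esub> e) = \<psi> x" using \<psi>D(3)[OF \<psi>D(1)[OF x] e(1)] e(2) \<psi>D(1)[OF x] by simp
    moreover have "\<psi> x \<odot>\<^bsub>L\<^esub> e \<in> carrier L" using \<psi>D(1)[OF x] e(1) by simp
    ultimately show ?thesis using bij x by (auto simp: bij_betw_def dest: inj_onD)
  qed
  have "f e \<in> g ` carrier N" using NK mod_homD(1)[OF f e(1)] by simp
  then obtain y where y: "y \<in> carrier N" "g y = f e" by auto
  let ?h = "\<lambda>x\<in>carrier L. \<psi> x \<odot>\<^bsub>N\<^esub> y"
  have "?h \<in> mod_hom A L N"
    by (rule mod_homI) (simp_all add: \<psi>D(1-3) y(1) N.smult_l_distr N.smult_assoc)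
  moreover have "compose (carrier L) g ?h = f"
  proof
    fix x show "compose (carrier L) g ?h x = f x"
    proof (cases "x \<in> carrier L")
      case True
      have "g (\<psi> x \<odot>\<^bsub>N\<^esub> y) = \<psi> x \<odot>\<^bsub>K\<^esub> f e" using mod_homD(3)[OF g \<psi>D(1)[OF True] y(1)] y(2) by simp
      also have "\<dots> = f x" using mod_homD(3)[OF f \<psi>D(1)[OF True] e(1)] re[OF True] by simp
      finally show ?thesis using True by (simp add: compose_def)
    next
      case False
      then show ?thesis using mod_homD(4)[OF f] by (simp add: compose_def)
    qed
  qed
  ultimately show "\<exists>h\<in>mod_hom A L N. compose (carrier L) g h = f" by blast
qed

lemma (in lmod) trivial_algebra_carrier:
  assumes "\<one>\<^bsub>A\<^esub> = \<zero>\<^bsub>A\<^esub>"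
  shows "carrier M = {\<zero>\<^bsub>M\<^esub>}"
proof -
  have "x = \<zero>\<^bsub>M\<^esub>" if "x \<in> carrier M" for x
    using smult_one[OF that] zero_act[OF that] assms by simp
  then show ?thesis using M.zero_closed by blast
qed

text \<open>The regular module is projective and hence a direct sum of copies of the representatives.  If there
  are none, it is zero.\<close>

lemma indec_reps_empty_iff:
  fixes S :: "('a, 'm) module set"
  assumes U: "large_universe TYPE('m)" and A: "algebra_with_basis A d a"
    and S: "indec_reps A (add_proj_inj A) S"
  shows "S = {} \<longleftrightarrow> \<one>\<^bsub>A\<^esub> = \<zero>\<^bsub>A\<^esub>"
proof
  have alg: "complex_algebra A" using A by (simp add: algebra_with_basis_def)
  assume empty: "S = {}"
  obtain L :: "('a, 'm) module" where L: "fd_module A L" "isomorphic_mod A L (regular_mod A)"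
    using ex_regular_copy[OF U A] by blast
  obtain \<psi> where \<psi>: "\<psi> \<in> mod_iso A L (regular_mod A)" using L(2) by (auto simp: isomorphic_mod_def)
  have add: "add_proj_inj A L" by (rule add_proj_inj.proj[OF projective_if_regular[OF alg L(1) \<psi>]])
  obtain k \<kappa> where "bounded_coords (cspace A L) k \<kappa>" using L(1) unfolding fd_module_iff[OF alg] by blast
  then obtain m where "isomorphic_mod A L (copies S m)" using ex_copies[OF alg S add] by blast
  then obtain f where f: "f \<in> mod_iso A L (copies S m)" by (auto simp: isomorphic_mod_def)
  interpret L: lmod A L using alg L(1) by (simp add: lmod_def fd_module_def)
  have "carrier (copies S m) = {\<lambda>_. undefined}" using empty by simp
  then have "f x = f y" if "x \<in> carrier L" "y \<in> carrier L" for x y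
    using mod_homD(1)[OF mod_isoD(1)[OF f] that(1)] mod_homD(1)[OF mod_isoD(1)[OF f] that(2)] by simp
  then have one: "x = y" if "x \<in> carrier L" "y \<in> carrier L" for x y
    using mod_isoD(2)[OF f] that unfolding bij_betw_def inj_on_def by blast
  have im: "\<psi> ` carrier L = carrier A" using mod_isoD(2)[OF \<psi>] by (simp add: bij_betw_def)
  have "\<one>\<^bsub>A\<^esub> \<in> \<psi> ` carrier L" "\<zero>\<^bsub>A\<^esub> \<in> \<psi> ` carrier L" unfolding im by simp_all
  then show "\<one>\<^bsub>A\<^esub> = \<zero>\<^bsub>A\<^esub>" using one by (metis imageE)
next
  assume triv: "\<one>\<^bsub>A\<^esub> = \<zero>\<^bsub>A\<^esub>"
  have alg: "complex_algebra A" using A by (simp add: algebra_with_basis_def)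
  show "S = {}"
  proof (rule equals0I)
    fix X assume "X \<in> S"
    then have X: "add_proj_inj A X" "indecomposable A X" using S unfolding indec_reps_def by blast+
    then interpret lmod A X using alg add_proj_inj_imp_fd_module[OF X(1)] by (simp add: lmod_def fd_module_def)
    show False using trivial_algebra_carrier[OF triv] X(2) unfolding indecomposable_def by blast
  qed
qed

lemma morita_equivalent_sym:
  "morita_equivalent TYPE('m) TYPE('n) A B \<Longrightarrow> morita_equivalent TYPE('n) TYPE('m) B A"
  unfolding morita_equivalent_def by blast

text \<open>A linear functor maps zero morphisms to zero morphisms, so a module whose image is zero, and hence
  has a zero identity, is zero up to natural isomorphism.\<close>

lemma morita_equivalent_trivial:
  fixes A :: "(complex, 'a) module" and B :: "(complex, 'b) module"
  assumes U: "large_universe TYPE('m)" and A: "algebra_with_basis A d a" and B: "complex_algebra B"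
    and morita: "morita_equivalent TYPE('m) TYPE('n) A B" and triv: "\<one>\<^bsub>B\<^esub> = \<zero>\<^bsub>B\<^esub>"
  shows "\<one>\<^bsub>A\<^esub> = \<zero>\<^bsub>A\<^esub>"
proof -
  have alg: "complex_algebra A" using A by (simp add: algebra_with_basis_def)
  obtain L :: "('a, 'm) module" where L: "fd_module A L" "isomorphic_mod A L (regular_mod A)"
    using ex_regular_copy[OF U A] by blast
  obtain \<psi> where \<psi>: "\<psi> \<in> mod_iso A L (regular_mod A)" using L(2) by (auto simp: isomorphic_mod_def)
  obtain F :: "('a, 'm, 'b, 'n) on_objects" and F1 and G :: "('b, 'n, 'a, 'm) on_objects" and G1
    where F: "linear_functor A B F F1" and G: "linear_functor B A G G1"
      and nat: "naturally_isomorphic A A (\<lambda>M. G (F M)) (\<lambda>M N f. G1 (F M) (F N) (F1 M N f)) (\<lambda>M. M) (\<lambda>M N f. f)"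
    using morita unfolding morita_equivalent_def by blast
  have fFL: "fd_module B (F L)" using F L(1) unfolding linear_functor_def by blast
  have fGFL: "fd_module A (G (F L))" using G fFL unfolding linear_functor_def by blast
  interpret FL: lmod B "F L" using B fFL by (simp add: lmod_def fd_module_def)
  interpret GFL: lmod A "G (F L)" using alg fGFL by (simp add: lmod_def fd_module_def)
  interpret L: lmod A L using alg L(1) by (simp add: lmod_def fd_module_def)
  have FL0: "carrier (F L) = {\<zero>\<^bsub>F L\<^esub>}" by (rule FL.trivial_algebra_carrier[OF triv])
  let ?id = "\<lambda>y\<in>carrier (F L). y" and ?id' = "\<lambda>y\<in>carrier (G (F L)). y"
  have id: "?id \<in> mod_hom B (F L) (F L)" by (rule mod_homI) simp_all
  have G1: "G1 (F L) (F L) \<in> mod_hom cplx (hom_space B (F L) (F L)) (hom_space A (G (F L)) (G (F L)))"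
    and G1id: "G1 (F L) (F L) ?id = ?id'"
    using G fFL unfolding linear_functor_def by blast+
  \<comment> \<open>The identity of a zero module is a zero morphism.\<close>
  have "0 \<odot>\<^bsub>hom_space B (F L) (F L)\<^esub> ?id = ?id"
    using FL.act_zero[OF FL.one_smult_closed[of 0]] by (simp add: hom_space_def FL0 fun_eq_iff)
  moreover have "G1 (F L) (F L) (0 \<odot>\<^bsub>hom_space B (F L) (F L)\<^esub> ?id) =
      0 \<odot>\<^bsub>hom_space A (G (F L)) (G (F L))\<^esub> G1 (F L) (F L) ?id"
    by (rule mod_homD(3)[OF G1]) (use id in \<open>simp_all add: hom_space_def\<close>)
  ultimately have e: "?id' = 0 \<odot>\<^bsub>hom_space A (G (F L)) (G (F L))\<^esub> ?id'" using G1id by simp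
  have GFL0: "x = \<zero>\<^bsub>G (F L)\<^esub>" if x: "x \<in> carrier (G (F L))" for x
  proof -
    have "x = (0 \<odot>\<^bsub>A\<^esub> \<one>\<^bsub>A\<^esub>) \<odot>\<^bsub>G (F L)\<^esub> x" using fun_cong[OF e, of x] x by (simp add: hom_space_def)
    then show ?thesis using GFL.V.smult_zero[of x] x by (simp add: GFL.csmult_def)
  qed
  obtain \<eta> where \<eta>: "\<eta> \<in> mod_iso A (G (F L)) L" using nat L(1) unfolding naturally_isomorphic_def by blast
  have "carrier A = (\<lambda>x. \<psi> (\<eta> x)) ` carrier (G (F L))"
    using mod_isoD(2)[OF \<eta>] mod_isoD(2)[OF \<psi>] by (simp add: bij_betw_def image_image[symmetric])
  then have all: "x = \<psi> (\<eta> \<zero>\<^bsub>G (F L)\<^esub>)" if "x \<in> carrier A" for x using that GFL0 by blast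
  have "\<one>\<^bsub>A\<^esub> \<in> carrier A" "\<zero>\<^bsub>A\<^esub> \<in> carrier A" by simp_all
  then show ?thesis using all by metis
qed

theorem theorem5:
  fixes A :: "(complex, 'a) module" and B :: "(complex, 'b) module"
    and a :: "nat \<Rightarrow> 'a" and b :: "nat \<Rightarrow> 'b"
    and P\<^sub>A I\<^sub>A :: "nat \<Rightarrow> ('a, 'm) module" and P\<^sub>B I\<^sub>B :: "nat \<Rightarrow> ('b, 'n) module"
    and M\<^sub>A :: "('a, 'm) module \<Rightarrow> ('a, 'k) module" and M\<^sub>B :: "('b, 'n) module \<Rightarrow> ('b, 'l) module"
    and \<sigma>\<^sub>A :: "('a, 'm) module \<Rightarrow> (nat \<Rightarrow> nat \<Rightarrow> 'm \<times> 'm) \<Rightarrow> 'm \<times> 'k"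
    and \<sigma>\<^sub>B :: "('b, 'n) module \<Rightarrow> (nat \<Rightarrow> nat \<Rightarrow> 'n \<times> 'n) \<Rightarrow> 'n \<times> 'l"
  assumes "large_universe TYPE('m)" and "large_universe TYPE('n)"
    and "algebra_with_basis A d\<^sub>A a" and "algebra_with_basis B d\<^sub>B b"
    and "proj_inj_reps A n\<^sub>A P\<^sub>A I\<^sub>A" and "proj_inj_reps B n\<^sub>B P\<^sub>B I\<^sub>B"
    and "indec_reps A (add_proj_inj A) S\<^sub>A" and "indec_reps B (add_proj_inj B) S\<^sub>B"
    and "fixed_embedding_system A (Pi_N n\<^sub>A P\<^sub>A I\<^sub>A) M\<^sub>A \<sigma>\<^sub>A"
    and "fixed_embedding_system B (Pi_N n\<^sub>B P\<^sub>B I\<^sub>B) M\<^sub>B \<sigma>\<^sub>B"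
    and "compatible_orthogonal A (Pi_N n\<^sub>A P\<^sub>A I\<^sub>A) M\<^sub>A \<sigma>\<^sub>A S\<^sub>A"
    and "compatible_orthogonal B (Pi_N n\<^sub>B P\<^sub>B I\<^sub>B) M\<^sub>B \<sigma>\<^sub>B S\<^sub>B"
    and "morita_equivalent TYPE('m) TYPE('n) A B"
  shows "nonunital_alg_isomorphic
           (integral_coefficient_ring A d\<^sub>A a (Pi_N n\<^sub>A P\<^sub>A I\<^sub>A) M\<^sub>A \<sigma>\<^sub>A)
           (integral_coefficient_ring B d\<^sub>B b (Pi_N n\<^sub>B P\<^sub>B I\<^sub>B) M\<^sub>B \<sigma>\<^sub>B)"
proof -
  note A = coefficient_ring_structure[OF assms(1,3,5,7,9,11)]
  note B = coefficient_ring_structure[OF assms(2,4,6,8,10,12)]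
  have alg: "complex_algebra A" "complex_algebra B" using assms(3,4) by (simp_all add: algebra_with_basis_def)
  have empty: "S\<^sub>A = {} \<longleftrightarrow> S\<^sub>B = {}"
    using morita_equivalent_trivial[OF assms(1,3) alg(2) assms(13)]
      morita_equivalent_trivial[OF assms(2,4) alg(1) morita_equivalent_sym[OF assms(13)]]
      indec_reps_empty_iff[OF assms(1,3,7)] indec_reps_empty_iff[OF assms(2,4,8)] by blast
  have "\<exists>g. bij_betw g (S\<^sub>B \<times> {1 :: nat..}) (S\<^sub>A \<times> {1 :: nat..})"
  proof (cases "S\<^sub>A = {}")
    case True
    then show ?thesis using empty by (simp add: bij_betw_def)
  next
    case False
    then have inf: "infinite (S\<^sub>A \<times> {1 :: nat..})" "infinite (S\<^sub>B \<times> {1 :: nat..})"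
      using empty infinite_Ici[of "1 :: nat"] by (auto dest: finite_cartesian_productD2)
    have c: "countable (S\<^sub>A \<times> {1 :: nat..})" "countable (S\<^sub>B \<times> {1 :: nat..})"
      using A(1) B(1) by auto
    obtain f :: "_ \<Rightarrow> nat" where f: "bij_betw f (S\<^sub>A \<times> {1 :: nat..}) UNIV" using countableE_infinite[OF c(1) inf(1)] .
    obtain g :: "_ \<Rightarrow> nat" where g: "bij_betw g (S\<^sub>B \<times> {1 :: nat..}) UNIV" using countableE_infinite[OF c(2) inf(2)] .
    show ?thesis by (rule exI, rule bij_betw_trans[OF g bij_betw_inv_into[OF f]])
  qed
  then obtain g where "bij_betw g (S\<^sub>B \<times> {1 :: nat..}) (S\<^sub>A \<times> {1 :: nat..})" by blast
  from poly_family_rings_isomorphic[OF is_poly_family_ring_reindex[OF A(2) this] B(2)] show ?thesis .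
qed

end
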